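(* Let $\Omega$ be an open set in $\mathbf{C}^n$ and let $f\colon\Omega\to\mathbf{C}$ be a continuous map. Suppose that there is a positive constant $K$ such that $|\overline\partial f|\le K|f|$ on $\Omega\setminus f^{-1}(0)$. Then $f^{-1}(0)$ is an analytic set, i.e. a (closed) complex analytic subset of $\Omega$.
   Context: The inequality $|\overline\partial f|\le K|f|$ on the open set $\Omega^*=\Omega\setminus f^{-1}(0)$ means: on $\Omega^*$ the identity $\overline\partial f=Af$ holds in the sense of distributions for some $(0,1)$-form $A$ on $\Omega^*$ with $L^\infty$ coefficients, with $|A|\le K$ almost everywhere. No assumption is made on $f$ at points of $f^{-1}(0)$ beyond continuity. *)

theory Defs
  imports "HOL-Analysis.Analysis"
begin

text \<open>\<open>C_k k S f\<close> is meant for open \<open>S\<close>. In finite dimension, continuity of every directional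
  derivative is the same as continuity of the derivative as an operator-valued map.\<close>

primrec C_k ::
  "nat \<Rightarrow> 'a::real_normed_vector set \<Rightarrow> ('a \<Rightarrow> 'b::real_normed_vector) \<Rightarrow> bool" where
  "C_k 0 S f \<longleftrightarrow> continuous_on S f"
| "C_k (Suc k) S f \<longleftrightarrow>
     (\<forall>x\<in>S. f differentiable (at x)) \<and> (\<forall>v. C_k k S (\<lambda>x. frechet_derivative f (at x) v))"

definition test_function :: "(complex ^ 'n) set \<Rightarrow> (complex ^ 'n \<Rightarrow> complex) \<Rightarrow> bool" where
  "test_function U \<phi> \<longleftrightarrow>
     (\<forall>k. C_k k UNIV \<phi>) \<and>
     compact (closure {z. \<phi> z \<noteq> 0}) \<and> closure {z. \<phi> z \<noteq> 0} \<subseteq> U"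

text \<open>The Wirtinger derivative
  \<open>\<partial>\<phi>/\<partial>(cnj z\<^sub>j) = (\<partial>\<phi>/\<partial>x\<^sub>j + \<i> \<partial>\<phi>/\<partial>y\<^sub>j) / 2\<close>, where \<open>z\<^sub>j = x\<^sub>j + \<i> y\<^sub>j\<close>.\<close>

definition dbar :: "'n \<Rightarrow> (complex ^ 'n \<Rightarrow> complex) \<Rightarrow> complex ^ 'n \<Rightarrow> complex" where
  "dbar j \<phi> z =
     (frechet_derivative \<phi> (at z) (axis j 1) + \<i> * frechet_derivative \<phi> (at z) (axis j \<i>)) / 2"

text \<open>A (0,1)-form \<open>\<Sum>\<^sub>j G\<^sub>j d(cnj z\<^sub>j)\<close> is represented by its coefficient vector \<open>G\<close>, so its
  pointwise norm is the Hermitian norm of \<open>complex ^ 'n\<close>. The following says that the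
  distributional derivative of \<open>u\<close> on the open set \<open>U\<close> is the form \<open>G\<close>. It is intended for
  locally integrable \<open>u\<close> and \<open>G\<close>, for which all the integrands are integrable.\<close>

definition weak_dbar ::
  "(complex ^ 'n) set \<Rightarrow> (complex ^ 'n \<Rightarrow> complex) \<Rightarrow> (complex ^ 'n \<Rightarrow> complex ^ 'n) \<Rightarrow> bool" where
  "weak_dbar U u G \<longleftrightarrow>
     (\<forall>\<phi> j. test_function U \<phi> \<longrightarrow>
        (LINT z|lebesgue_on U. u z * dbar j \<phi> z) = - (LINT z|lebesgue_on U. G z $ j * \<phi> z))"

text \<open>The inequality \<open>\<bar>dbar f\<bar> \<le> K \<bar>f\<bar>\<close> on \<open>U\<close>. The bound on the norm of the measurable form \<open>A\<close>
  already makes each of its coefficients essentially bounded.\<close>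

definition dbar_le :: "(complex ^ 'n) set \<Rightarrow> (complex ^ 'n \<Rightarrow> complex) \<Rightarrow> real \<Rightarrow> bool" where
  "dbar_le U f K \<longleftrightarrow>
     (\<exists>A :: complex ^ 'n \<Rightarrow> complex ^ 'n.
        A \<in> borel_measurable (lebesgue_on U) \<and>
        (AE z in lebesgue_on U. norm (A z) \<le> K) \<and>
        weak_dbar U f (\<lambda>z. f z *s A z))"

definition holomorphic_Cn :: "(complex ^ 'n) set \<Rightarrow> (complex ^ 'n \<Rightarrow> complex) \<Rightarrow> bool" where
  "holomorphic_Cn U g \<longleftrightarrow>
     (\<forall>z\<in>U. \<exists>D. (g has_derivative D) (at z) \<and> (\<forall>c v. D (c *s v) = c * D v))"

definition analytic_subset :: "(complex ^ 'n) set \<Rightarrow> (complex ^ 'n) set \<Rightarrow> bool" where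
  "analytic_subset \<Omega> Z \<longleftrightarrow>
     closedin (top_of_set \<Omega>) Z \<and>
     (\<forall>p\<in>\<Omega>. \<exists>U F. open U \<and> p \<in> U \<and> U \<subseteq> \<Omega> \<and> finite F \<and> (\<forall>g\<in>F. holomorphic_Cn U g) \<and>
        Z \<inter> U = {z \<in> U. \<forall>g\<in>F. g z = 0})"

end

theory Submission
  imports Defs "HOL-Complex_Analysis.Complex_Analysis"
begin

text \<open>
  In one variable the inequality bounds the \<open>\<partial>/\<partial>(cnj t)\<close> derivative of \<open>log f\<close>. Solving
  \<open>\<partial>U/\<partial>(cnj t) = (\<partial>f/\<partial>(cnj t)) / f\<close> by a Cauchy potential gives a bounded continuous \<open>U\<close>, and
  \<open>h = f * exp (- U)\<close> is holomorphic where \<open>f\<close> does not vanish. It is continuous and vanishes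
  elsewhere, so by Rado's theorem it is holomorphic everywhere. Thus \<open>f\<close> differs from a
  holomorphic function by a factor that is bounded above and below, with bounds that depend only
  on \<open>K\<close> and the size of the disc; this is \<open>similarity_principle\<close>.

  In several variables the distributional inequality has no restriction to a curve, but the
  mollifications of \<open>f\<close> satisfy it up to a constant on compact sets without zeros. They are
  smooth, so they can be composed with holomorphic curves. As \<open>f\<close> is the uniform limit of its
  mollifications, \<open>f\<close> composed with any holomorphic curve is comparable to a holomorphic function,
  with constants that are uniform over the curves of a given size
  (\<open>dbar_le_imp_curve_comparable\<close>). Everything after this uses only that property and continuity:
  along curves, the zeros of \<open>f\<close> are isolated, persist under small perturbations and are bounded in
  number, like zeros of holomorphic functions.

  Let \<open>p\<close> be a zero that is a limit of points with \<open>f \<noteq> 0\<close>. In a suitable direction \<open>b\<close> the zero is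
  isolated, so for \<open>z\<close> near \<open>p\<close> the slice \<open>w \<mapsto> f (z + w b)\<close> has finitely many zeros in a small disc
  and none on its boundary. Where their number (without multiplicity) is maximal, they are locally
  given by continuous functions of \<open>z\<close>, which are holomorphic by \<open>single_sheet_holomorphic\<close>: otherwise
  some affine expression in such a function would violate the maximum principle, and its level
  sets would yield a family of curves on which \<open>f\<close> loses a zero under a small perturbation. The
  product of the differences of the zeros, a discriminant, tends to \<open>0\<close> where the number of
  zeros drops, so by Rado's theorem the exceptional points are the zeros of a holomorphic function. The
  product of the zeros is bounded and holomorphic off this exceptional set and extends across it.
  The extension vanishes at \<open>z\<close> if and only if \<open>w = 0\<close> is a zero of the slice through \<open>z\<close>, that
  is, if and only if \<open>f z = 0\<close>.
\<close>

section \<open>Rado's theorem\<close>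

lemma norm_bounded_on_compact:
  fixes f :: "'a::metric_space \<Rightarrow> 'b::real_normed_vector"
  assumes "compact S" "continuous_on S f"
  shows "\<exists>B. \<forall>x\<in>S. norm (f x) \<le> B"
proof -
  have "bounded (f ` S)"
    using assms compact_continuous_image compact_imp_bounded by blast
  then show ?thesis by (auto simp: bounded_iff)
qed

lemma open_imp_fsigma:
  fixes S :: "'a::euclidean_space set"
  assumes "open S"
  shows "fsigma S"
proof -
  obtain C where "\<And>n. compact (C n)" "\<And>n::nat. C n \<subseteq> S" "\<Union> (range C) = S"
    using open_Union_compact_subsets[OF assms] by metis
  then show ?thesis unfolding fsigma_Union_compact by (intro exI[of _ C]) auto
qed

text \<open>On the unit circle \<open>cnj z = 1 / z\<close>, so the product is a Laurent polynomial; its real part does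
  not change if the negative powers are conjugated.\<close>

lemma Re_mult_cnj_poly_on_circle:
  fixes p q :: "complex poly"
  shows "\<exists>r. \<forall>z. norm z = 1 \<longrightarrow> Re (poly p z * cnj (poly q z)) = Re (poly r z)"
proof (induction p arbitrary: q)
  case 0
  then show ?case by (intro exI[of _ 0]) simp
next
  case (pCons a p)
  show ?case
  proof (cases q)
    case (pCons b q')
    obtain r where r: "\<And>z. norm z = 1 \<Longrightarrow> Re (poly p z * cnj (poly q' z)) = Re (poly r z)"
      using pCons.IH by blast
    \<comment> \<open>split off the constant coefficients of both factors; the product of the remainders carries \<open>z * cnj z = 1\<close>\<close>
    let ?r = "smult (cnj a) q + smult (cnj b) (pCons 0 p) + r"
    have "Re (poly (pCons a p) z * cnj (poly q z)) = Re (poly ?r z)" if z: "norm z = 1" for z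
    proof -
      have zz: "z * cnj z = 1"
        using z by (simp add: complex_norm_square[symmetric])
      have "poly (pCons a p) z * cnj (poly q z) =
          cnj (cnj a * poly q z) + z * poly p z * cnj b + (z * cnj z) * (poly p z * cnj (poly q' z))"
        by (simp add: pCons algebra_simps)
      then show ?thesis
        using r[OF z] unfolding zz by (simp add: algebra_simps)
    qed
    then show ?thesis by blast
  qed
qed

text \<open>Harmonic approximation of boundary values: a polynomial with this real part on the circle
  provides an explicit harmonic function inside, which replaces the Poisson integral below.\<close>

lemma continuous_on_circle_approx_Re_poly:
  fixes \<phi> :: "complex \<Rightarrow> real"
  assumes "continuous_on (sphere 0 1) \<phi>" and "e > 0"
  shows "\<exists>p. \<forall>z\<in>sphere 0 1. \<bar>\<phi> z - Re (poly p z)\<bar> < e"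
proof -
  define R where "R = {\<psi>. \<exists>p. \<forall>z\<in>sphere (0::complex) 1. \<psi> z = Re (poly p z)}"
  interpret R: function_ring_on R "sphere (0::complex) 1"
  proof
    show "compact (sphere (0::complex) 1)" by simp
  next
    fix f assume "f \<in> R"
    then obtain p where "\<forall>z\<in>sphere (0::complex) 1. f z = Re (poly p z)"
      by (auto simp: R_def)
    moreover have "continuous_on (sphere 0 1) (\<lambda>z. Re (poly p z))"
      by (intro continuous_intros)
    ultimately show "continuous_on (sphere 0 1) f"
      by (metis (no_types, lifting) continuous_on_cong)
  next
    fix f g assume "f \<in> R" "g \<in> R"
    then obtain p q where pq: "\<And>z. z \<in> sphere (0::complex) 1 \<Longrightarrow> f z = Re (poly p z)"
        "\<And>z. z \<in> sphere (0::complex) 1 \<Longrightarrow> g z = Re (poly q z)"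
      by (auto simp: R_def)
    have "\<forall>z\<in>sphere 0 1. f z + g z = Re (poly (p + q) z)"
      using pq by simp
    then show "(\<lambda>x. f x + g x) \<in> R" unfolding R_def by blast
    obtain r where r: "\<And>z. norm z = 1 \<Longrightarrow> Re (poly p z * cnj (poly q z)) = Re (poly r z)"
      using Re_mult_cnj_poly_on_circle by blast
    have "f z * g z = Re (poly (smult (1/2) (p * q + r)) z)" if "z \<in> sphere 0 1" for z
    proof -
      have "Re (poly r z) = Re (poly p z * cnj (poly q z))"
        using r[of z] that by simp
      then show ?thesis
        using pq[OF that] by (simp add: field_simps)
    qed
    then show "(\<lambda>x. f x * g x) \<in> R" unfolding R_def by blast
  next
    fix c
    have "\<forall>z\<in>sphere (0::complex) 1. c = Re (poly [:complex_of_real c:] z)" by simp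
    then show "(\<lambda>_. c) \<in> R" unfolding R_def by blast
  next
    fix x y :: complex assume "x \<noteq> y"
    have "Re \<in> R"
      unfolding R_def by (rule CollectI, rule exI[of _ "[:0, 1:]"]) simp
    moreover have "Im \<in> R"
      unfolding R_def by (rule CollectI, rule exI[of _ "[:0, -\<i>:]"]) simp
    ultimately show "\<exists>f\<in>R. f x \<noteq> f y"
      using \<open>x \<noteq> y\<close> by (metis complex_eqI)
  qed
  obtain f where "f \<in> R" "\<forall>x\<in>sphere 0 1. \<bar>\<phi> x - f x\<bar> < e"
    using R.Stone_Weierstrass_basic[OF assms] by blast
  then show ?thesis unfolding R_def by force
qed

text \<open>The holomorphic functions themselves need not converge, because their imaginary parts are only
  determined up to constants. Their exponentials are bounded away from \<open>0\<close> and \<open>\<infinity>\<close>, so they form a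
  normal family, and a logarithm of the limit has the right real part.\<close>

lemma Re_limit_of_holomorphic:
  fixes q :: "nat \<Rightarrow> complex \<Rightarrow> complex"
  assumes hol: "\<And>n. q n holomorphic_on ball z0 \<rho>"
    and bnd: "\<And>n z. z \<in> ball z0 \<rho> \<Longrightarrow> \<bar>Re (q n z)\<bar> \<le> B"
    and "\<rho> > 0"
  shows "\<exists>\<psi>. \<psi> holomorphic_on ball z0 \<rho> \<and>
          (\<forall>z\<in>ball z0 \<rho>. \<forall>l. (\<lambda>n. Re (q n z)) \<longlonglongrightarrow> l \<longrightarrow> Re (\<psi> z) = l)"
proof -
  define F where "F n z = exp (q n z)" for n z
  obtain E r where E: "E holomorphic_on ball z0 \<rho>" "strict_mono (r::nat\<Rightarrow>nat)"
    "\<And>x. x \<in> ball z0 \<rho> \<Longrightarrow> ((\<lambda>n. F (r n) x) \<longlongrightarrow> E x) sequentially"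
  proof (rule Montel[of "ball z0 \<rho>" "range F" F])
    fix K assume K: "K \<subseteq> ball z0 \<rho>"
    have "norm (h z) \<le> exp B" if "h \<in> range F" "z \<in> K" for h z
    proof -
      from that obtain n where "h = F n" by auto
      moreover have "Re (q n z) \<le> B" using bnd[of z n] K that by auto
      ultimately show ?thesis by (simp add: F_def)
    qed
    then show "\<exists>B. \<forall>h\<in>range F. \<forall>z\<in>K. cmod (h z) \<le> B" by blast
  qed (auto simp: F_def[abs_def] intro!: holomorphic_intros hol)
  have nz: "E z \<noteq> 0" if "z \<in> ball z0 \<rho>" for z
  proof -
    have "(\<lambda>n. norm (F (r n) z)) \<longlonglongrightarrow> norm (E z)"
      using E(3)[OF that] by (rule tendsto_norm)
    moreover have "exp (-B) \<le> norm (F (r n) z)" for n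
      using bnd[OF that, of "r n"] by (simp add: F_def)
    ultimately have "exp (-B) \<le> norm (E z)"
      by (intro LIMSEQ_le_const) auto
    then show ?thesis using exp_gt_zero[of "-B"] by auto
  qed
  obtain \<psi> where \<psi>: "\<psi> holomorphic_on ball z0 \<rho>" "\<And>z. z \<in> ball z0 \<rho> \<Longrightarrow> exp (\<psi> z) = E z"
    using holomorphic_logarithm_exists[OF convex_ball open_ball E(1) nz, of z0] assms(3) by auto
  have "Re (\<psi> z) = l" if z: "z \<in> ball z0 \<rho>" and l: "(\<lambda>n. Re (q n z)) \<longlonglongrightarrow> l" for z l
  proof -
    have "(\<lambda>n. exp (Re (q (r n) z))) \<longlonglongrightarrow> exp l"
      using LIMSEQ_subseq_LIMSEQ[OF l E(2)] by (intro tendsto_exp) (simp add: o_def)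
    moreover have "(\<lambda>n. exp (Re (q (r n) z))) \<longlonglongrightarrow> norm (E z)"
      using tendsto_norm[OF E(3)[OF z]] by (simp add: F_def)
    ultimately have "exp l = norm (E z)" by (rule LIMSEQ_unique)
    also have "\<dots> = exp (Re (\<psi> z))" using \<psi>(2)[OF z, symmetric] by simp
    finally show ?thesis by simp
  qed
  with \<psi>(1) show ?thesis by blast
qed

text \<open>A function is holomorphic as soon as all expressions \<open>a * c + b\<close> with holomorphic \<open>a\<close>, \<open>b\<close> and
  nonvanishing \<open>a\<close> satisfy the maximum principle in their real part. With constant \<open>a\<close>, comparison
  with harmonic functions of the same boundary values shows that \<open>c\<close> is harmonic on \<open>W\<close>, so
  \<open>c = \<alpha> + cnj \<beta>\<close>. If \<open>\<beta>\<close> were not constant, the choice \<open>a = 1 - b\<close> with \<open>b = \<beta> - \<beta> t0\<close> would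
  turn the expression into \<open>- (norm b)\<^sup>2\<close>, which has a strict local maximum at \<open>t0\<close>. The function \<open>c\<close>
  is controlled on \<open>W\<close> only, which allows \<open>W\<close> to be the complement of a zero set.\<close>

lemma holomorphic_of_affine_maximum_principle:
  fixes c :: "complex \<Rightarrow> complex"
  assumes "\<rho> > 0" and cont: "continuous_on (cball z0 \<rho>) c"
    and W: "open W" "W \<subseteq> ball z0 \<rho>" "W \<noteq> {}"
    and MP: "\<And>t0 \<tau> N a b M t. \<lbrakk>\<tau> > 0; cball t0 \<tau> \<subseteq> cball z0 \<rho>; open N; cball t0 \<tau> \<subseteq> N;
        a holomorphic_on N; b holomorphic_on N; \<And>x. x \<in> N \<Longrightarrow> a x \<noteq> 0;
        \<And>x. x \<in> sphere t0 \<tau> \<Longrightarrow> Re (a x * c x + b x) \<le> M; t \<in> W; t \<in> ball t0 \<tau>\<rbrakk>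
        \<Longrightarrow> Re (a t * c t + b t) \<le> M"
  shows "\<exists>F. F holomorphic_on ball z0 \<rho> \<and> (\<forall>z\<in>W. c z = F z)"
proof -
  \<comment> \<open>every rotated real part is harmonic; \<open>\<kappa> = 1\<close> and \<open>\<kappa> = -\<i>\<close> give the real and the imaginary part\<close>
  have harm: "\<exists>\<psi>. \<psi> holomorphic_on ball z0 \<rho> \<and> (\<forall>z\<in>W. Re (\<kappa> * c z) = Re (\<psi> z))"
    if "norm \<kappa> = 1" for \<kappa>
  proof -
    have "\<kappa> \<noteq> 0" using that by auto
    have "continuous_on (sphere 0 1) (\<lambda>w::complex. Re (\<kappa> * c (z0 + \<rho> * w)))"
      by (intro continuous_intros continuous_on_compose2[OF cont])
         (use \<open>\<rho> > 0\<close> in \<open>auto simp: dist_norm norm_mult\<close>)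
    then have "\<exists>p. \<forall>w\<in>sphere (0::complex) 1. \<bar>Re (\<kappa> * c (z0 + \<rho> * w)) - Re (poly p w)\<bar> < 1 / Suc n" for n
      using continuous_on_circle_approx_Re_poly[of "\<lambda>w. Re (\<kappa> * c (z0 + \<rho> * w))" "1 / Suc n"] by simp
    then obtain p where p: "\<And>n (w::complex). w \<in> sphere (0::complex) 1 \<Longrightarrow>
        \<bar>Re (\<kappa> * c (z0 + \<rho> * w)) - Re (poly (p n) w)\<bar> < 1 / Suc n"
      by metis
    define q where "q n z = poly (p n) ((z - z0) / \<rho>)" for n z
    have qhol: "q n holomorphic_on S" for n S
      unfolding q_def[abs_def] using \<open>\<rho> > 0\<close> by (intro holomorphic_intros) auto
    have qs: "\<bar>Re (\<kappa> * c x) - Re (q n x)\<bar> \<le> 1 / Suc n" if "x \<in> sphere z0 \<rho>" for n x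
    proof -
      have "(x - z0) / \<rho> \<in> sphere 0 1" "z0 + \<rho> * ((x - z0) / \<rho>) = x"
        using that \<open>\<rho> > 0\<close> by (auto simp: dist_norm norm_divide norm_minus_commute)
      then show ?thesis using p[of "(x - z0) / \<rho>" n] by (simp add: q_def)
    qed
    have qW: "\<bar>Re (\<kappa> * c x) - Re (q n x)\<bar> \<le> 1 / Suc n" if "x \<in> W" for n x
    proof -
      have 1: "Re (\<kappa> * c x + (- q n x)) \<le> 1 / Suc n"
        by (rule MP[where N = UNIV and ?t0.0 = z0 and \<tau> = \<rho>])
           (use \<open>\<rho> > 0\<close> \<open>\<kappa> \<noteq> 0\<close> W that qs in \<open>auto intro!: holomorphic_intros qhol simp: abs_le_iff\<close>)
      have 2: "Re ((- \<kappa>) * c x + q n x) \<le> 1 / Suc n"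
        by (rule MP[where N = UNIV and ?t0.0 = z0 and \<tau> = \<rho>])
           (use \<open>\<rho> > 0\<close> \<open>\<kappa> \<noteq> 0\<close> W that qs in \<open>auto intro!: holomorphic_intros qhol simp: abs_le_iff\<close>)
      show ?thesis using 1 2 by (simp add: abs_le_iff)
    qed
    obtain C where C: "\<And>x. x \<in> cball z0 \<rho> \<Longrightarrow> norm (c x) \<le> C"
      using norm_bounded_on_compact[OF compact_cball cont] by blast
    have sph: "\<bar>Re (q n x)\<bar> \<le> C + 1" if "x \<in> sphere z0 \<rho>" for n x
    proof -
      have "\<bar>Re (\<kappa> * c x)\<bar> \<le> C"
        using abs_Re_le_cmod[of "\<kappa> * c x"] C[of x] that \<open>norm \<kappa> = 1\<close> by (auto simp: norm_mult)
      moreover have "1 / real (Suc n) \<le> 1" by simp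
      ultimately show ?thesis using qs[OF that, of n] by linarith
    qed
    have bnd: "\<bar>Re (q n x)\<bar> \<le> C + 1" if "x \<in> ball z0 \<rho>" for n x
    proof -
      have 1: "Re (q n x) \<le> C + 1"
        by (rule maximum_real_frontier[where S = "ball z0 \<rho>"])
           (use sph that \<open>\<rho> > 0\<close> in \<open>auto intro!: qhol holomorphic_on_imp_continuous_on simp: abs_le_iff\<close>)
      have 2: "Re (- q n x) \<le> C + 1"
        by (rule maximum_real_frontier[where S = "ball z0 \<rho>"])
           (use sph that \<open>\<rho> > 0\<close> in \<open>auto intro!: holomorphic_intros qhol holomorphic_on_imp_continuous_on simp: abs_le_iff\<close>)
      show ?thesis using 1 2 by (simp add: abs_le_iff)
    qed
    obtain \<psi> where \<psi>: "\<psi> holomorphic_on ball z0 \<rho>"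
      "\<And>z l. z \<in> ball z0 \<rho> \<Longrightarrow> (\<lambda>n. Re (q n z)) \<longlonglongrightarrow> l \<Longrightarrow> Re (\<psi> z) = l"
      using Re_limit_of_holomorphic[of q z0 \<rho> "C + 1", OF qhol bnd \<open>\<rho> > 0\<close>] by blast
    have "Re (\<kappa> * c z) = Re (\<psi> z)" if "z \<in> W" for z
    proof -
      have "(\<lambda>n. Re (q n z)) \<longlonglongrightarrow> Re (\<kappa> * c z)"
        unfolding LIMSEQ_iff
      proof (intro allI impI)
        fix r :: real assume "r > 0"
        then obtain N where N: "1 / real (Suc N) < r" using nat_approx_posE by blast
        have "norm (Re (q n z) - Re (\<kappa> * c z)) < r" if "n \<ge> N" for n
        proof -
          have "1 / real (Suc n) \<le> 1 / real (Suc N)" using that by (simp add: frac_le)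
          then show ?thesis using qW[OF \<open>z \<in> W\<close>, of n] N by simp
        qed
        then show "\<exists>no. \<forall>n\<ge>no. norm (Re (q n z) - Re (\<kappa> * c z)) < r" by blast
      qed
      then show ?thesis using \<psi>(2) W that by (metis subsetD)
    qed
    with \<psi>(1) show ?thesis by blast
  qed
  obtain \<psi>1 where \<psi>1: "\<psi>1 holomorphic_on ball z0 \<rho>" "\<And>z. z \<in> W \<Longrightarrow> Re (c z) = Re (\<psi>1 z)"
    using harm[of 1] by auto
  obtain \<psi>2 where \<psi>2: "\<psi>2 holomorphic_on ball z0 \<rho>" "\<And>z. z \<in> W \<Longrightarrow> Im (c z) = Re (\<psi>2 z)"
    using harm[of "-\<i>"] by auto
  define \<alpha> where "\<alpha> z = (\<psi>1 z + \<i> * \<psi>2 z) / 2" for z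
  define \<beta> where "\<beta> z = (\<psi>1 z - \<i> * \<psi>2 z) / 2" for z
  have c_eq: "c z = \<alpha> z + cnj (\<beta> z)" if "z \<in> W" for z
    using \<psi>1(2)[OF that] \<psi>2(2)[OF that] by (auto simp: \<alpha>_def \<beta>_def complex_eq_iff field_simps)
  have \<alpha>h: "\<alpha> holomorphic_on ball z0 \<rho>" and \<beta>h: "\<beta> holomorphic_on ball z0 \<rho>"
    unfolding \<alpha>_def[abs_def] \<beta>_def[abs_def] by (auto intro!: holomorphic_intros \<psi>1 \<psi>2)
  obtain t0 where t0: "t0 \<in> W" using W by auto
  have "\<beta> z = \<beta> t0" if z: "z \<in> ball z0 \<rho>" for z
  proof (rule ccontr)
    assume neq: "\<beta> z \<noteq> \<beta> t0"
    define b where "b t = \<beta> t - \<beta> t0" for t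
    have bh: "b holomorphic_on ball z0 \<rho>" unfolding b_def[abs_def] by (intro holomorphic_intros \<beta>h)
    obtain r where r: "r > 0" "ball t0 r \<subseteq> ball z0 \<rho>" "\<And>x. x \<in> ball t0 r - {t0} \<Longrightarrow> b x \<noteq> 0"
    proof (rule isolated_zeros[OF bh open_ball connected_ball, of t0 z])
      show "t0 \<in> ball z0 \<rho>" using t0 W by blast
    qed (use z neq in \<open>auto simp: b_def\<close>)
    define N where "N = W \<inter> ball t0 r \<inter> {x \<in> ball z0 \<rho>. b x \<in> ball 0 1}"
    have "open {x \<in> ball z0 \<rho>. b x \<in> ball 0 1}"
      using continuous_open_preimage[OF holomorphic_on_imp_continuous_on[OF bh] open_ball open_ball, of 0 1]
      by (simp add: vimage_def Int_def)
    then have "open N" unfolding N_def using W(1) by (intro open_Int open_ball)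
    moreover have "t0 \<in> N" using t0 subsetD[OF W(2) t0] r(1) by (simp add: N_def b_def)
    ultimately obtain \<tau> where \<tau>: "\<tau> > 0" "cball t0 \<tau> \<subseteq> N" by (meson open_contains_cball)
    have N: "N \<subseteq> W" "N \<subseteq> ball z0 \<rho>" "N \<subseteq> ball t0 r" by (auto simp: N_def)
    have sph: "x \<in> N" if "x \<in> sphere t0 \<tau>" for x using \<tau> that by auto
    define a where "a t = 1 - b t" for t
    \<comment> \<open>chosen such that \<open>a * c + B\<close> equals \<open>cnj b - b - (norm b)\<^sup>2\<close>, with real part \<open>- (norm b)\<^sup>2\<close>\<close>
    define B where "B t = - (1 - b t) * (\<alpha> t + cnj (\<beta> t0)) - b t" for t
    have val: "Re (a x * c x + B x) = - (norm (b x))\<^sup>2" if "x \<in> W" for x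
    proof -
      have "a x * c x + B x = (1 - b x) * cnj (b x) - b x"
        by (simp add: a_def B_def c_eq[OF that] b_def algebra_simps)
      also have "\<dots> = cnj (b x) - b x - (norm (b x))\<^sup>2"
        by (subst complex_norm_square) (simp add: algebra_simps)
      finally show ?thesis by simp
    qed
    have "sphere t0 \<tau> \<subseteq> ball z0 \<rho>"
      using \<tau>(2) N(2) sphere_cball by blast
    then have "continuous_on (sphere t0 \<tau>) (\<lambda>x. norm (b x))"
      by (intro continuous_on_norm continuous_on_subset[OF holomorphic_on_imp_continuous_on[OF bh]])
    then obtain x0 where x0: "x0 \<in> sphere t0 \<tau>" "\<And>x. x \<in> sphere t0 \<tau> \<Longrightarrow> norm (b x0) \<le> norm (b x)"
      using continuous_attains_inf[OF compact_sphere, of t0 \<tau> "\<lambda>x. norm (b x)"] \<tau>(1)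
      by (metis less_le_not_le sphere_eq_empty)
    note hols = holomorphic_on_subset[OF bh N(2)] holomorphic_on_subset[OF \<alpha>h N(2)]
    have "Re (a t0 * c t0 + B t0) \<le> - (norm (b x0))\<^sup>2"
    proof (rule MP[where N = N and ?t0.0 = t0 and \<tau> = \<tau> and a = a and b = B and t = t0])
      show "a holomorphic_on N"
        unfolding a_def[abs_def] by (intro holomorphic_intros hols)
      show "B holomorphic_on N"
        unfolding B_def[abs_def] by (intro holomorphic_intros hols)
      show "cball t0 \<tau> \<subseteq> cball z0 \<rho>" using \<tau>(2) N(2) ball_subset_cball by blast
      show "a x \<noteq> 0" if "x \<in> N" for x using that by (auto simp: N_def a_def)
      show "Re (a x * c x + B x) \<le> - (norm (b x0))\<^sup>2" if "x \<in> sphere t0 \<tau>" for x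
      proof -
        have "x \<in> W" using sph[OF that] N by blast
        then show ?thesis using x0(2)[OF that] unfolding val[OF \<open>x \<in> W\<close>] by (simp add: power_mono)
      qed
    qed (use \<tau> t0 \<open>open N\<close> in simp_all)
    then have "- (norm (b t0))\<^sup>2 \<le> - (norm (b x0))\<^sup>2" using val[OF t0] by simp
    then have "b x0 = 0" by (simp add: b_def[of t0])
    moreover have "x0 \<in> ball t0 r - {t0}" using x0(1) sph[OF x0(1)] N(3) \<tau>(1) by auto
    ultimately show False using r by blast
  qed
  then have "c z = \<alpha> z + cnj (\<beta> t0)" if "z \<in> W" for z
    using c_eq[OF that] W that by (metis subsetD)
  moreover have "(\<lambda>z. \<alpha> z + cnj (\<beta> t0)) holomorphic_on ball z0 \<rho>"
    by (intro holomorphic_intros \<alpha>h)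
  ultimately show ?thesis by blast
qed

text \<open>A zero set is negligible for the maximum principle: the function \<open>G ^ n * h\<close> vanishes on it, so the
  maximum principle bounds \<open>norm (G t) ^ n * norm (h t)\<close> by the values on the circle, and the
  factor \<open>norm (h t)\<close> disappears after taking \<open>n\<close>-th roots.\<close>

lemma maximum_modulus_off_zeros:
  fixes G h :: "complex \<Rightarrow> complex"
  assumes h: "continuous_on (cball t0 \<tau>) h" "h holomorphic_on {z \<in> ball t0 \<tau>. h z \<noteq> 0}"
    and G: "continuous_on (cball t0 \<tau>) G" "G holomorphic_on {z \<in> ball t0 \<tau>. h z \<noteq> 0}"
    and m: "\<And>x. x \<in> sphere t0 \<tau> \<Longrightarrow> norm (G x) \<le> m"
    and t: "t \<in> ball t0 \<tau>" "h t \<noteq> 0"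
  shows "norm (G t) \<le> m"
proof -
  define U where "U = {z \<in> ball t0 \<tau>. h z \<noteq> 0}"
  have "\<tau> > 0" using t by (metis ball_eq_empty empty_iff not_le)
  have Ub: "U \<subseteq> ball t0 \<tau>" by (auto simp: U_def)
  have "continuous_on (ball t0 \<tau>) h" using h(1) ball_subset_cball continuous_on_subset by blast
  then have "open {z \<in> ball t0 \<tau>. h z \<in> - {0}}"
    using continuous_open_preimage[of "ball t0 \<tau>" h "-{0}"]
    by (simp add: vimage_def Int_def open_Compl)
  then have oU: "open U" by (simp add: U_def)
  have clU: "closure U \<subseteq> cball t0 \<tau>" using Ub \<open>\<tau> > 0\<close>
    by (metis closure_ball closure_mono)
  have fr: "x \<in> sphere t0 \<tau> \<or> (x \<in> cball t0 \<tau> \<and> h x = 0)" if "x \<in> frontier U" for x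
  proof -
    have "x \<in> cball t0 \<tau>" "x \<notin> U" using that clU oU by (auto simp: frontier_def interior_open)
    then show ?thesis by (auto simp: U_def)
  qed
  obtain H where H: "\<And>x. x \<in> cball t0 \<tau> \<Longrightarrow> norm (h x) \<le> H"
    using norm_bounded_on_compact[OF compact_cball h(1)] by blast
  have "\<exists>x. x \<in> sphere t0 \<tau>" using \<open>\<tau> > 0\<close> by (metis all_not_in_conv less_le_not_le sphere_eq_empty)
  then have m0: "m \<ge> 0" using m norm_ge_zero order_trans by metis
  have H0: "H \<ge> 0" using order_trans[OF norm_ge_zero H[of t]] t by simp
  have pow: "norm (G t) ^ n * norm (h t) \<le> m ^ n * H" for n
  proof -
    have "norm (G t ^ n * h t) \<le> m ^ n * H"
    proof (rule maximum_modulus_frontier[where S = U and f = "\<lambda>x. G x ^ n * h x" and \<xi> = t])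
      show "(\<lambda>x. G x ^ n * h x) holomorphic_on interior U"
        using h(2) G(2) oU by (auto intro!: holomorphic_intros simp: interior_open U_def)
      show "continuous_on (closure U) (\<lambda>x. G x ^ n * h x)"
        using clU by (intro continuous_intros continuous_on_subset[OF h(1)] continuous_on_subset[OF G(1)])
      show "bounded U" using Ub bounded_ball bounded_subset by blast
      show "t \<in> U" using t by (simp add: U_def)
      show "norm (G z ^ n * h z) \<le> m ^ n * H" if "z \<in> frontier U" for z
        using fr[OF that]
      proof
        assume z: "z \<in> sphere t0 \<tau>"
        then have "norm (G z) ^ n * norm (h z) \<le> m ^ n * H"
          using m[OF z] H[of z] m0 by (intro mult_mono power_mono) auto
        then show ?thesis by (simp add: norm_mult norm_power)
      qed (use m0 H0 in auto)
    qed
    then show ?thesis by (simp add: norm_mult norm_power)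
  qed
  show ?thesis
  proof (rule ccontr)
    assume "\<not> ?thesis"
    then have gt: "norm (G t) > m" by simp
    show False
    proof (cases "m = 0")
      case True
      then show False using pow[of 1] gt t by (simp add: mult_le_0_iff)
    next
      case False
      with m0 have "m > 0" by simp
      then have "1 < norm (G t) / m" using gt by simp
      then obtain n where n: "H / norm (h t) < (norm (G t) / m) ^ n"
        using real_arch_pow by blast
      then have "H < norm (G t) ^ n / m ^ n * norm (h t)"
        using t(2) by (simp add: divide_less_eq power_divide)
      then have "m ^ n * H < norm (G t) ^ n * norm (h t)"
        using \<open>m > 0\<close> by (simp add: field_simps)
      then show False using pow[of n] by simp
    qed
  qed
qed

text \<open>On a disc, \<open>h\<close> agrees off its zeros with a holomorphic function \<open>F\<close>, by the two preceding
  lemmas. The zeros of \<open>F\<close> are countable, hence do not disconnect the disc, while the sets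
  where \<open>h \<noteq> 0\<close> and where \<open>h \<noteq> F\<close> are disjoint and open and cover their complement. So \<open>h = F\<close>
  throughout.\<close>

theorem Rado:
  fixes h :: "complex \<Rightarrow> complex"
  assumes S: "open S" and cont: "continuous_on S h" and hol: "h holomorphic_on {z \<in> S. h z \<noteq> 0}"
  shows "h holomorphic_on S"
proof -
  have "\<exists>\<rho>>0. h holomorphic_on ball z0 \<rho>" if "z0 \<in> S" for z0
  proof -
    obtain \<rho> where \<rho>: "\<rho> > 0" "cball z0 \<rho> \<subseteq> S"
      using S \<open>z0 \<in> S\<close> by (meson open_contains_cball)
    define W where "W = {z \<in> ball z0 \<rho>. h z \<noteq> 0}"
    have contc: "continuous_on (cball z0 \<rho>) h" using cont \<rho> continuous_on_subset by blast
    then have contb: "continuous_on (ball z0 \<rho>) h" using ball_subset_cball continuous_on_subset by blast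
    then have "open {z \<in> ball z0 \<rho>. h z \<in> - {0}}"
      using continuous_open_preimage[of "ball z0 \<rho>" h "-{0}"]
      by (simp add: vimage_def Int_def open_Compl)
    then have oW: "open W" by (simp add: W_def)
    have "h holomorphic_on ball z0 \<rho>"
    proof (cases "W = {}")
      case True
      then show ?thesis
        by (intro holomorphic_transform[OF holomorphic_on_const[of 0]]) (auto simp: W_def)
    next
      case False
      have "\<exists>F. F holomorphic_on ball z0 \<rho> \<and> (\<forall>z\<in>W. h z = F z)"
      proof (rule holomorphic_of_affine_maximum_principle[OF \<rho>(1) contc oW _ False])
        show "W \<subseteq> ball z0 \<rho>" by (auto simp: W_def)
        fix t0 \<tau> N a b M t
        assume *: "(\<tau>::real) > 0" "cball t0 \<tau> \<subseteq> cball z0 \<rho>" "open N" "cball t0 \<tau> \<subseteq> N"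
          "a holomorphic_on N" "b holomorphic_on N"
          "\<And>x. x \<in> sphere t0 \<tau> \<Longrightarrow> Re (a x * h x + b x) \<le> M" "t \<in> W" "t \<in> ball t0 \<tau>"
        define G where "G x = exp (a x * h x + b x)" for x
        have sub: "cball t0 \<tau> \<subseteq> S" using * \<rho> by blast
        have hh: "h holomorphic_on {z \<in> ball t0 \<tau>. h z \<noteq> 0}"
          by (rule holomorphic_on_subset[OF hol]) (use sub in auto)
        have "norm (G t) \<le> exp M"
        proof (rule maximum_modulus_off_zeros[of t0 \<tau> h G "exp M" t])
          show "continuous_on (cball t0 \<tau>) h" using cont sub continuous_on_subset by blast
          then show "continuous_on (cball t0 \<tau>) G"
            unfolding G_def[abs_def] using *
            by (intro continuous_intros) (auto intro: continuous_on_subset[OF holomorphic_on_imp_continuous_on])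
          have sN: "{z \<in> ball t0 \<tau>. h z \<noteq> 0} \<subseteq> N" using *(4) ball_subset_cball by blast
          show "G holomorphic_on {z \<in> ball t0 \<tau>. h z \<noteq> 0}"
            unfolding G_def[abs_def]
            using holomorphic_on_subset[OF *(5) sN] holomorphic_on_subset[OF *(6) sN] hh
            by (intro holomorphic_intros)
        qed (use * hh in \<open>auto simp: G_def W_def\<close>)
        then show "Re (a t * h t + b t) \<le> M" by (simp add: G_def)
      qed
      then obtain F where F: "F holomorphic_on ball z0 \<rho>" "\<And>z. z \<in> W \<Longrightarrow> h z = F z" by blast
      obtain w0 where w0: "w0 \<in> W" using False by blast
      have cF: "continuous_on (ball z0 \<rho>) F" by (rule holomorphic_on_imp_continuous_on[OF F(1)])
      define Z where "Z = {z \<in> ball z0 \<rho>. F z = 0}"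
      have FW: "F w \<noteq> 0" if "w \<in> W" for w using F(2)[OF that] that by (simp add: W_def)
      have "countable Z"
      proof (cases "F constant_on ball z0 \<rho>")
        case True
        then have "Z = {}" using FW[OF w0] w0 by (auto simp: constant_on_def Z_def W_def)
        then show ?thesis by simp
      next
        case False
        then show ?thesis
          unfolding Z_def using holomorphic_countable_zeros[OF F(1)] open_imp_fsigma[OF open_ball] by auto
      qed
      then have conn: "connected (ball z0 \<rho> - Z)"
        by (intro connected_open_diff_countable) auto
      define V where "V = {z \<in> ball z0 \<rho>. h z - F z \<in> - {0}}"
      have "open V"
        using continuous_open_preimage[OF continuous_on_diff[OF contb cF], of "-{0}"]
        by (simp add: vimage_def Int_def V_def open_Compl)
      have "W \<inter> (ball z0 \<rho> - Z) = {} \<or> V \<inter> (ball z0 \<rho> - Z) = {}"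
      proof (rule connectedD[OF conn oW \<open>open V\<close>])
        show "W \<inter> V \<inter> (ball z0 \<rho> - Z) = {}" using F(2) by (force simp: V_def)
        show "ball z0 \<rho> - Z \<subseteq> W \<union> V"
        proof
          fix x assume x: "x \<in> ball z0 \<rho> - Z"
          show "x \<in> W \<union> V"
            using x by (cases "h x = F x") (simp_all add: W_def V_def Z_def)
        qed
      qed
      moreover have "w0 \<in> ball z0 \<rho> - Z" using w0 FW[OF w0] by (simp add: W_def Z_def)
      ultimately have V0: "V \<inter> (ball z0 \<rho> - Z) = {}" using w0 by blast
      have "h z = F z" if z: "z \<in> ball z0 \<rho>" for z
      proof (cases "z \<in> W")
        case False
        then have "h z = 0" using z by (simp add: W_def)
        moreover have "F z = 0"
        proof (rule ccontr)
          assume "F z \<noteq> 0"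
          then have "z \<in> V \<inter> (ball z0 \<rho> - Z)" using \<open>h z = 0\<close> z by (simp add: V_def Z_def)
          then show False using V0 by blast
        qed
        ultimately show ?thesis by simp
      qed (rule F(2))
      then show ?thesis using holomorphic_transform[OF F(1)] by simp
    qed
    with \<rho> show ?thesis by blast
  qed
  then have "h analytic_on S" by (auto simp: analytic_on_def)
  then show ?thesis by (rule analytic_imp_holomorphic)
qed

section \<open>Integrals around triangles\<close>

lemma has_derivative_complex_decompose:
  fixes D :: "complex \<Rightarrow> complex"
  assumes "(f has_derivative D) F"
  shows "D v = of_real (Re v) * D 1 + of_real (Im v) * D \<i>"
proof -
  have lin: "linear D" using assms has_derivative_linear by blast
  have "v = Re v *\<^sub>R 1 + Im v *\<^sub>R \<i>" by (simp add: complex_eq_iff)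
  then have "D v = Re v *\<^sub>R D 1 + Im v *\<^sub>R D \<i>"
    using linear_add[OF lin] linear_scale[OF lin] by metis
  then show ?thesis by (simp add: scaleR_conv_of_real)
qed

text \<open>A quantitative form of Goursat's theorem. The integral around the triangle with vertices \<open>a\<close>,
  \<open>a + t (b - a)\<close>, \<open>a + t (c - a)\<close> is differentiated in \<open>t\<close>; the complex linear part of the
  derivative of \<open>F\<close> cancels, and what is left is the antilinear part \<open>D z 1 + \<i> * D z \<i>\<close>.\<close>

lemma norm_triangle_contour_le:
  fixes F :: "complex \<Rightarrow> complex"
  assumes hull: "convex hull {a, b, c} \<subseteq> N" and N: "open N"
    and D: "\<And>z. z \<in> N \<Longrightarrow> (F has_derivative D z) (at z)"
    and Dc: "\<And>v. continuous_on N (\<lambda>z. D z v)"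
    and e: "\<And>z. z \<in> convex hull {a, b, c} \<Longrightarrow> norm (D z 1 + \<i> * D z \<i>) \<le> e"
  shows "norm (contour_integral (linepath a b) F + contour_integral (linepath b c) F
               + contour_integral (linepath c a) F)
         \<le> e * ((norm (b - a) + norm (c - a)) * norm (c - b))"
proof -
  \<comment> \<open>polar coordinates of the triangle: its points are \<open>a + t * p s\<close> for \<open>t\<close>, \<open>s\<close> in the unit interval\<close>
  define p where "p s = (b - a) + of_real s * (c - b)" for s :: real
  define H where "H = convex hull {a, b, c}"
  have HN: "H \<subseteq> N" using hull by (simp add: H_def)
  have pH: "a + of_real t * p s \<in> H" if "t \<in> {0..1}" "s \<in> {0..1}" for s t
  proof -
    have "a + of_real t * p s = (1 - t) *\<^sub>R a + (t * (1 - s)) *\<^sub>R b + (t * s) *\<^sub>R c"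
      by (simp add: p_def scaleR_conv_of_real algebra_simps)
    moreover have "(1 - t) + t * (1 - s) + t * s = 1" by (simp add: algebra_simps)
    ultimately show ?thesis
      unfolding H_def convex_hull_3 using that
      by (intro CollectI exI[of _ "1 - t"] exI[of _ "t * (1 - s)"] exI[of _ "t * s"]) auto
  qed
  have cF: "continuous_on N F"
    using D by (meson continuous_at_imp_continuous_on has_derivative_continuous)
  have dec: "D z v = of_real (Re v) * D z 1 + of_real (Im v) * D z \<i>" if "z \<in> N" for z v
    by (rule has_derivative_complex_decompose[OF D[OF that]])
  define I1 where "I1 = {0..1::real}"
  have cp: "continuous_on I1 p" unfolding p_def[abs_def] by (intro continuous_intros)
  have pN: "a + of_real t * p s \<in> N" if "t \<in> I1" "s \<in> I1" for s t
    using pH[of t s] HN that by (auto simp: I1_def)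
  define G where "G t s = F (a + of_real t * p s) * (of_real t * (c - b))" for t s :: real
  define Gt where "Gt t s = D (a + of_real t * p s) (p s) * (of_real t * (c - b))
                            + F (a + of_real t * p s) * (c - b)" for t s :: real
  have cont2: "continuous_on (I1 \<times> I1) (\<lambda>(t, s). g (a + of_real t * p s))" if "continuous_on N g"
    for g :: "complex \<Rightarrow> complex"
    unfolding split_beta
    by (rule continuous_on_compose2[OF that])
       (auto simp: p_def intro!: continuous_intros pN[unfolded p_def])
  have DI: "((\<lambda>t. F (a + of_real t * q)) has_vector_derivative D (a + of_real t * q) q) (at t within S)"
    if "a + of_real t * q \<in> N" for t q S
  proof -
    have "((\<lambda>t. a + of_real t * q) has_vector_derivative q) (at t within S)"
      by (auto intro!: derivative_eq_intros simp: has_vector_derivative_def scaleR_conv_of_real)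
    then have "((\<lambda>t. F (a + of_real t * q)) has_derivative (\<lambda>h. D (a + of_real t * q) (h *\<^sub>R q))) (at t within S)"
      unfolding has_vector_derivative_def
      by (rule has_derivative_compose[where g = F, OF _ D]) (rule that)
    moreover have "D (a + of_real t * q) (h *\<^sub>R q) = h *\<^sub>R D (a + of_real t * q) q" for h
      using has_derivative_linear[OF D[OF that]] by (simp add: linear_scale)
    ultimately show ?thesis unfolding has_vector_derivative_def by simp
  qed
  have Gd: "((\<lambda>t. G t s) has_vector_derivative Gt t s) (at t within S)" if "t \<in> I1" "s \<in> I1" for s t S
  proof -
    have 1: "((\<lambda>t. of_real t * (c - b)) has_vector_derivative (c - b)) (at t within S)"
      by (auto intro!: derivative_eq_intros simp: has_vector_derivative_def scaleR_conv_of_real)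
    show ?thesis
      unfolding G_def Gt_def
      using has_vector_derivative_mult[OF DI[OF pN[OF that]] 1] by (simp add: add.commute)
  qed
  have cGt: "continuous_on (I1 \<times> I1) (\<lambda>(t, s). Gt t s)"
  proof -
    have "continuous_on (I1 \<times> I1) (\<lambda>(t, s). (of_real (Re (p s)) * D (a + of_real t * p s) 1
        + of_real (Im (p s)) * D (a + of_real t * p s) \<i>) * (of_real t * (c - b))
                            + F (a + of_real t * p s) * (c - b))"
      using cont2[OF Dc[of 1]] cont2[OF Dc[of \<i>]] cont2[OF cF]
      unfolding split_beta p_def by (intro continuous_intros)
    then show ?thesis
      by (rule continuous_on_cong[THEN iffD1, rotated 2])
         (use pN in \<open>auto simp: Gt_def dec[symmetric]\<close>)
  qed
  have Gint: "G t integrable_on cbox 0 1" if "t \<in> I1" for t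
  proof -
    have "continuous_on I1 (\<lambda>s. G t s)"
      unfolding G_def by (intro continuous_intros continuous_on_compose2[OF cF] cp) (use pN that in auto)
    then show ?thesis by (auto intro!: integrable_continuous_real simp: I1_def)
  qed
  \<comment> \<open>the integral around the triangle scaled by \<open>t\<close> towards \<open>a\<close>\<close>
  define E where "E t = integral {0..t} (\<lambda>r. F (a + of_real r * (b - a)) * (b - a)) + integral I1 (G t)
      - integral {0..t} (\<lambda>r. F (a + of_real r * (c - a)) * (c - a))" for t
  \<comment> \<open>the derivative of \<open>E\<close> is the integral of \<open>R t\<close>; it vanishes if the derivative of \<open>F\<close> is complex linear\<close>
  define R where "R t s = of_real t * (D (a + of_real t * p s) (p s) * (c - b)
                          - D (a + of_real t * p s) (c - b) * p s)" for t s :: real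
  have p01: "p 0 = b - a" "p 1 = c - a" by (simp_all add: p_def)
  have Ed: "(E has_vector_derivative integral I1 (R t)) (at t within I1)" if t: "t \<in> I1" for t
  proof -
    have seg: "((\<lambda>t. integral {0..t} (\<lambda>r. F (a + of_real r * p s) * p s))
        has_vector_derivative F (a + of_real t * p s) * p s) (at t within I1)" if "s \<in> I1" for s
      unfolding I1_def using t pN[OF _ that]
      by (intro integral_has_vector_derivative continuous_intros continuous_on_compose2[OF cF])
         (auto simp: I1_def)
    have mid: "((\<lambda>t. integral I1 (G t)) has_vector_derivative integral I1 (Gt t)) (at t within I1)"
      using leibniz_rule_vector_derivative[of I1 0 1 G Gt t] Gd Gint cGt t
      by (simp add: I1_def)
    have 1: "(E has_vector_derivative F (a + of_real t * p 0) * p 0 + integral I1 (Gt t)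
               - F (a + of_real t * p 1) * p 1) (at t within I1)"
      unfolding E_def[abs_def]
      using seg[of 0] seg[of 1] mid
      by (intro has_vector_derivative_add has_vector_derivative_diff) (simp_all add: p01 I1_def)
    define L where "L s = D (a + of_real t * p s) (of_real t * (c - b)) * p s
                          + F (a + of_real t * p s) * (c - b)" for s
    have "(L has_integral F (a + of_real t * p 1) * p 1 - F (a + of_real t * p 0) * p 0) I1"
      unfolding I1_def
    proof (rule fundamental_theorem_of_calculus)
      fix s :: real assume s: "s \<in> {0..1}"
      have z: "a + of_real t * p s \<in> N" using pN[OF t, of s] s by (simp add: I1_def)
      have pd: "(p has_vector_derivative (c - b)) (at s within {0..1})"
        unfolding p_def[abs_def]
        by (auto intro!: derivative_eq_intros simp: has_vector_derivative_def scaleR_conv_of_real)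
      then have "((\<lambda>s. a + of_real t * p s) has_derivative (\<lambda>h. h *\<^sub>R (of_real t * (c - b)))) (at s within {0..1})"
        unfolding has_vector_derivative_def
        by (auto intro!: derivative_eq_intros)
      then have "((\<lambda>s. F (a + of_real t * p s)) has_derivative
           (\<lambda>h. D (a + of_real t * p s) (h *\<^sub>R (of_real t * (c - b))))) (at s within {0..1})"
        by (rule has_derivative_compose[where g = F, OF _ D]) (rule z)
      then have "((\<lambda>s. F (a + of_real t * p s)) has_vector_derivative
           D (a + of_real t * p s) (of_real t * (c - b))) (at s within {0..1})"
        unfolding has_vector_derivative_def
        using has_derivative_linear[OF D[OF z]] by (simp add: linear_scale)
      from has_vector_derivative_mult[OF this pd]
      show "((\<lambda>s. F (a + of_real t * p s) * p s) has_vector_derivative L s) (at s within {0..1})"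
        unfolding L_def by (simp add: add.commute)
    qed simp
    moreover have "(Gt t has_integral integral I1 (Gt t)) I1"
    proof -
      have "continuous_on I1 (\<lambda>s. Gt t s)"
        by (rule continuous_on_compose2[OF cGt continuous_on_Pair[OF continuous_on_const[of I1 t] continuous_on_id],
              unfolded case_prod_conv]) (use t in auto)
      then show ?thesis
        by (auto intro!: integrable_integral integrable_continuous_real simp: I1_def)
    qed
    ultimately have gl: "((\<lambda>s. Gt t s - L s) has_integral integral I1 (Gt t)
        - (F (a + of_real t * p 1) * p 1 - F (a + of_real t * p 0) * p 0)) I1"
      by (intro has_integral_diff)
    have glr: "Gt t s - L s = R t s" if "s \<in> I1" for s
    proof -
      have "D (a + of_real t * p s) (of_real t * (c - b)) = of_real t * D (a + of_real t * p s) (c - b)"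
        using linear_scale[OF has_derivative_linear[OF D[OF pN[OF t that]]], of t "c - b"]
        by (simp add: scaleR_conv_of_real)
      then show ?thesis by (simp add: Gt_def L_def R_def algebra_simps)
    qed
    have "(R t has_integral integral I1 (Gt t)
        - (F (a + of_real t * p 1) * p 1 - F (a + of_real t * p 0) * p 0)) I1"
      by (rule has_integral_eq[OF glr gl])
    then have "integral I1 (R t) = F (a + of_real t * p 0) * p 0 + integral I1 (Gt t)
               - F (a + of_real t * p 1) * p 1"
      by (simp add: integral_unique)
    then show ?thesis using 1 by simp
  qed
  define B where "B = e * ((norm (b - a) + norm (c - a)) * norm (c - b))"
  have e0: "0 \<le> e"
    using e[of a] norm_ge_zero order_trans by (metis hull_inc insertI1)
  have Rb: "norm (R t s) \<le> B" if "t \<in> I1" "s \<in> I1" for t s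
  proof -
    let ?z = "a + of_real t * p s"
    have z: "?z \<in> N" "?z \<in> H" using pN that pH by (auto simp: I1_def)
    have "R t s = of_real t * ((D ?z 1 + \<i> * D ?z \<i>) * (cnj (p s) * (c - b) - cnj (c - b) * p s)) / 2"
      unfolding R_def dec[OF z(1), of "p s"] dec[OF z(1), of "c - b"]
      by (simp add: complex_eq_iff algebra_simps)
    then have "norm (R t s) = \<bar>t\<bar> * (norm (D ?z 1 + \<i> * D ?z \<i>) * norm (cnj (p s) * (c - b) - cnj (c - b) * p s)) / 2"
      by (simp only: norm_mult norm_divide norm_of_real norm_numeral)
    also have "\<dots> \<le> 1 * (e * (2 * (norm (p s) * norm (c - b)))) / 2"
    proof -
      have "norm (cnj (p s) * (c - b) - cnj (c - b) * p s) \<le> 2 * (norm (p s) * norm (c - b))"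
        by (rule order_trans[OF norm_triangle_ineq4]) (simp add: norm_mult del: complex_cnj_diff)
      then show ?thesis
        using e[of ?z] z that e0
        by (intro divide_right_mono mult_mono) (auto simp: H_def I1_def)
    qed
    also have "\<dots> \<le> e * ((norm (b - a) + norm (c - a)) * norm (c - b))"
    proof -
      have "p s = (1 - s) *\<^sub>R (b - a) + s *\<^sub>R (c - a)"
        by (simp add: p_def scaleR_conv_of_real algebra_simps)
      then have "norm (p s) \<le> \<bar>1 - s\<bar> * norm (b - a) + \<bar>s\<bar> * norm (c - a)"
        by (metis norm_scaleR norm_triangle_ineq)
      also have "\<dots> \<le> 1 * norm (b - a) + 1 * norm (c - a)"
        using that by (intro add_mono mult_right_mono) (auto simp: I1_def)
      finally have "norm (p s) \<le> norm (b - a) + norm (c - a)" by simp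
      then have "norm (p s) * norm (c - b) \<le> (norm (b - a) + norm (c - a)) * norm (c - b)"
        by (rule mult_right_mono) simp
      then show ?thesis using e0 by (simp add: mult_left_mono)
    qed
    finally show ?thesis by (simp add: B_def)
  qed
  have B0: "B \<ge> 0" unfolding B_def using e0 by (intro mult_nonneg_nonneg add_nonneg_nonneg) auto
  have Ib: "norm (integral I1 (R t)) \<le> B" if "t \<in> I1" for t
  proof -
    have "continuous_on I1 (\<lambda>s. of_real t * ((of_real (Re (p s)) * D (a + of_real t * p s) 1
        + of_real (Im (p s)) * D (a + of_real t * p s) \<i>) * (c - b)
        - (of_real (Re (c - b)) * D (a + of_real t * p s) 1
        + of_real (Im (c - b)) * D (a + of_real t * p s) \<i>) * p s))"
      using pN that
      by (intro continuous_intros cp continuous_on_compose2[OF Dc[of 1]] continuous_on_compose2[OF Dc[of \<i>]]) auto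
    then have "continuous_on I1 (R t)"
      by (rule continuous_on_cong[THEN iffD1, rotated 2])
         (use pN that in \<open>simp_all add: R_def dec[of _ "p _"] dec[of _ "c - b"]\<close>)
    then have "norm (integral {0..1} (R t)) \<le> B * (1 - 0)"
      by (intro integral_bound) (use Rb that in \<open>auto simp: I1_def\<close>)
    then show ?thesis by (simp add: I1_def)
  qed
  have "norm (E 1 - E 0) \<le> B * norm (1 - (0::real))"
  proof (rule differentiable_bound[of I1 E])
    show "(E has_derivative (\<lambda>h. h *\<^sub>R integral I1 (R t))) (at t within I1)" if "t \<in> I1" for t
      using Ed[OF that] by (simp add: has_vector_derivative_def)
    show "onorm (\<lambda>h. h *\<^sub>R integral I1 (R t)) \<le> B" if "t \<in> I1" for t
      by (rule onorm_le) (use Ib[OF that] in \<open>simp add: mult.commute[of B] mult_left_mono\<close>)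
  qed (auto simp: I1_def)
  moreover have "G 0 = (\<lambda>_. 0)" by (simp add: G_def fun_eq_iff)
  then have "E 0 = 0" by (simp add: E_def)
  moreover have "E 1 = contour_integral (linepath a b) F + contour_integral (linepath b c) F
               + contour_integral (linepath c a) F"
  proof -
    have li: "contour_integral (linepath x y) F = integral {0..1} (\<lambda>r. F (x + of_real r * (y - x)) * (y - x))" for x y
      unfolding contour_integral_integral
      by (rule integral_cong) (simp add: linepath_def scaleR_conv_of_real algebra_simps)
    have cs: "continuous_on (closed_segment c a) F"
      using closed_segment_subset_convex_hull[of c "{a, b, c}" a] hull
      by (intro continuous_on_subset[OF cF]) (auto simp: hull_inc)
    have "contour_integral (linepath c a) F = - contour_integral (linepath a c) F"
      using contour_integral_reverse_linepath[of a c F] cs by (simp add: closed_segment_commute)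
    moreover have "integral I1 (G 1) = contour_integral (linepath b c) F"
      unfolding li I1_def G_def p_def by (simp add: algebra_simps)
    ultimately show ?thesis by (simp add: E_def li I1_def)
  qed
  ultimately show ?thesis by (simp add: B_def)
qed

section \<open>The regularised Cauchy kernel\<close>

text \<open>The value \<open>\<infinity>\<close> at the origin is what makes the product over the two coordinates dominate the
  planar kernel on the axes, where \<open>0 powr a = 0\<close> would destroy the estimate.\<close>

lemma nn_integral_abs_powr_finite:
  fixes R :: real
  assumes "R \<ge> 0"
  shows "(\<integral>\<^sup>+x. (if \<bar>x\<bar> \<le> R then if x = 0 then \<infinity> else ennreal (\<bar>x\<bar> powr (-3/4)) else 0) \<partial>lborel) < \<infinity>"
proof -
  define g where "g x = ennreal (indicator {0..R} x * x powr (-3/4))" for x :: real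
  have gm: "g \<in> borel_measurable borel" unfolding g_def by measurable
  have "((\<lambda>x. x powr (-3/4)) has_integral (R powr (-3/4+1) / (-3/4+1))) {0..R}"
    using has_integral_powr_from_0[of "-3/4" R] assms by simp
  then have "integral\<^sup>N lborel g = ennreal (R powr (-3/4+1) / (-3/4+1))"
    unfolding g_def
    using nn_integral_has_integral_lebesgue[of "{0..R}" "\<lambda>x. x powr (-3/4)"] by (simp add: mult.commute)
  then have gfin: "integral\<^sup>N lborel g < \<infinity>" by simp
  have "(\<integral>\<^sup>+x. (if \<bar>x\<bar> \<le> R then if x = 0 then \<infinity> else ennreal (\<bar>x\<bar> powr (-3/4)) else 0) \<partial>lborel)
        \<le> (\<integral>\<^sup>+x. g x + g (- x) \<partial>lborel)"
  proof (rule nn_integral_mono_AE)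
    have "AE x in lborel. x \<noteq> (0::real)" by (rule AE_lborel_singleton)
    then show "AE x in lborel. (if \<bar>x\<bar> \<le> R then if x = 0 then \<infinity> else ennreal (\<bar>x\<bar> powr (-3/4)) else 0)
        \<le> g x + g (- x)"
      by eventually_elim (auto simp: g_def indicator_def)
  qed
  also have "\<dots> = integral\<^sup>N lborel g + (\<integral>\<^sup>+x. g (- x) \<partial>lborel)"
    using gm by (intro nn_integral_add) auto
  also have "(\<integral>\<^sup>+x. g (- x) \<partial>lborel) = integral\<^sup>N lborel g"
    using nn_integral_real_affine[OF gm, of "-1" 0] by simp
  finally show ?thesis by (rule le_less_trans) (use gfin in simp)
qed

text \<open>Since \<open>norm x\<close> dominates both coordinates, \<open>norm x powr (-3/2)\<close> is at most the product of two
  integrable functions of one coordinate each. The exponent leaves room for a Hoelder estimate of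
  order \<open>1/2\<close> on the kernel \<open>1 / z\<close>.\<close>

lemma nn_integral_norm_powr_finite:
  "(\<integral>\<^sup>+x. indicator (cball 0 R) x * ennreal (norm (x::complex) powr (-3/2)) \<partial>lborel) < \<infinity>"
proof (cases "R \<ge> 0")
  case True
  define f where "f x = (if \<bar>x\<bar> \<le> R then if x = 0 then \<infinity> else ennreal (\<bar>x\<bar> powr (-3/4)) else 0)" for x :: real
  have fm: "f \<in> borel_measurable borel" unfolding f_def by measurable
  have "(\<integral>\<^sup>+x. indicator (cball 0 R) x * ennreal (norm (x::complex) powr (-3/2)) \<partial>lborel)
      \<le> (\<integral>\<^sup>+x. (\<Prod>b\<in>Basis. f (x \<bullet> b)) \<partial>(lborel :: complex measure))"
  proof (rule nn_integral_mono)
    fix x :: complex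
    have "indicator (cball 0 R) x * ennreal (norm x powr (-3/2)) \<le> f (Re x) * f (Im x)"
    proof (cases "x \<in> cball 0 R")
      case x: True
      then have le: "\<bar>Re x\<bar> \<le> R" "\<bar>Im x\<bar> \<le> R"
        using abs_Re_le_cmod[of x] abs_Im_le_cmod[of x] by auto
      show ?thesis
      proof (cases "Re x = 0 \<or> Im x = 0")
        case True
        have "f (Re x) \<noteq> 0" "f (Im x) \<noteq> 0" using le by (auto simp: f_def)
        moreover have "f (Re x) = \<infinity> \<or> f (Im x) = \<infinity>" using True le by (auto simp: f_def)
        ultimately have "f (Re x) * f (Im x) = \<infinity>" by (auto simp: ennreal_mult_eq_top_iff)
        then show ?thesis by simp
      next
        case False
        have "norm x powr (-3/2) = norm x powr (-3/4) * norm x powr (-3/4)"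
          by (simp add: powr_add[symmetric])
        also have "\<dots> \<le> \<bar>Re x\<bar> powr (-3/4) * \<bar>Im x\<bar> powr (-3/4)"
          using False by (intro mult_mono powr_mono2' abs_Re_le_cmod abs_Im_le_cmod) auto
        finally show ?thesis using False le x
          by (simp add: f_def ennreal_mult[symmetric] ennreal_leI)
      qed
    qed simp
    also have "f (Re x) * f (Im x) = (\<Prod>b\<in>Basis. f (x \<bullet> b))"
      by (simp add: Basis_complex_def)
    finally show "indicator (cball 0 R) x * ennreal (norm x powr (-3/2)) \<le> (\<Prod>b\<in>Basis. f (x \<bullet> b))" .
  qed
  also have "\<dots> = (\<Prod>b\<in>(Basis::complex set). integral\<^sup>N lborel f)"
    by (rule nn_integral_lborel_prod) (use fm in auto)
  also have "\<dots> < \<infinity>"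
    using nn_integral_abs_powr_finite[OF True]
    by (simp add: f_def[symmetric] Basis_complex_def ennreal_mult_less_top)
  finally show ?thesis .
qed simp

lemma lborel_distr_reflect:
  fixes z :: "'a::euclidean_space"
  shows "distr lborel borel (\<lambda>x. z - x) = lborel"
proof -
  have "(lborel :: 'a measure) = density (distr lborel borel (\<lambda>x. z + (-1) *\<^sub>R x)) (\<lambda>_. ennreal (\<bar>-1::real\<bar> ^ DIM('a)))"
    by (rule lborel_affine) simp
  then show ?thesis by (simp add: density_1)
qed

lemma nn_integral_lborel_reflect:
  fixes z :: "'a::euclidean_space"
  assumes "f \<in> borel_measurable borel"
  shows "(\<integral>\<^sup>+x. f (z - x) \<partial>lborel) = (\<integral>\<^sup>+x. f x \<partial>lborel)"
  by (subst (2) lborel_distr_reflect[of z, symmetric]) (use assms in \<open>simp add: nn_integral_distr\<close>)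

lemma integral_lborel_reflect:
  fixes z :: "'a::euclidean_space" and f :: "'a \<Rightarrow> 'b::{banach, second_countable_topology}"
  assumes "f \<in> borel_measurable borel"
  shows "(\<integral>x. f (z - x) \<partial>lborel) = (\<integral>x. f x \<partial>lborel)"
  by (subst (2) lborel_distr_reflect[of z, symmetric]) (use assms in \<open>simp add: integral_distr\<close>)

lemma nn_integral_shifted_powr_bound:
  "\<exists>J\<ge>0. \<forall>t0. \<forall>z\<in>cball t0 R. (\<integral>\<^sup>+x. indicator (cball t0 R) x * ennreal (norm (z - x :: complex) powr (-3/2)) \<partial>lborel) \<le> ennreal J"
proof -
  define I where "I = (\<integral>\<^sup>+x. indicator (cball 0 (2*R)) x * ennreal (norm (x::complex) powr (-3/2)) \<partial>lborel)"
  have "I < \<infinity>" unfolding I_def by (rule nn_integral_norm_powr_finite)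
  then obtain J where J: "I = ennreal J" "J \<ge> 0"
    by (cases I) auto
  have "(\<integral>\<^sup>+x. indicator (cball t0 R) x * ennreal (norm (z - x) powr (-3/2)) \<partial>lborel) \<le> I"
    if "z \<in> cball t0 R" for z t0 :: complex
  proof -
    have "(\<integral>\<^sup>+x. indicator (cball t0 R) x * ennreal (norm (z - x) powr (-3/2)) \<partial>lborel)
       \<le> (\<integral>\<^sup>+x. indicator (cball 0 (2*R)) (z - x) * ennreal (norm (z - x) powr (-3/2)) \<partial>lborel)"
    proof (rule nn_integral_mono)
      fix x
      have "norm (z - x) \<le> 2 * R" if "x \<in> cball t0 R"
        using that \<open>z \<in> cball t0 R\<close> dist_triangle2[of z x t0] by (simp add: dist_norm norm_minus_commute)
      then show "indicator (cball t0 R) x * ennreal (norm (z - x) powr (-3/2))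
          \<le> indicator (cball 0 (2*R)) (z - x) * ennreal (norm (z - x) powr (-3/2))"
        by (cases "x \<in> cball t0 R") (auto simp: indicator_def)
    qed
    also have "\<dots> = I"
      unfolding I_def
      by (rule nn_integral_lborel_reflect[where f = "\<lambda>x. indicator (cball 0 (2*R)) x * ennreal (norm x powr (-3/2))"])
         (intro borel_measurable_times_ennreal borel_measurable_indicator; simp)
    finally show ?thesis .
  qed
  then show ?thesis using J by blast
qed

lemma norm_integral_le_if_nn_integral_le:
  fixes f :: "'a \<Rightarrow> 'b::{banach, second_countable_topology}"
  assumes "(\<integral>\<^sup>+x. ennreal (norm (f x)) \<partial>M) \<le> ennreal r" "r \<ge> 0"
  shows "norm (integral\<^sup>L M f) \<le> r"
proof (cases "integrable M f")
  case True
  have "ennreal (norm (integral\<^sup>L M f)) \<le> ennreal r"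
    by (rule order_trans[OF integral_norm_bound_ennreal[OF True] assms(1)])
  then show ?thesis using assms(2) by simp
qed (simp add: not_integrable_integral_eq assms)

text \<open>A smooth version of the Cauchy kernel \<open>1 / x = cnj x / (norm x)\<^sup>2\<close>. Its \<open>\<partial>/\<partial>(cnj x)\<close> derivative is
  \<open>cbump s\<close>, which concentrates at the origin as \<open>s\<close> tends to \<open>0\<close>, with total mass \<open>\<pi>\<close>. Dividing by
  \<open>cmass s\<close> normalises it; only the mass in the unit disc is counted, so that all integrals are over
  compact sets.\<close>

definition ckernel :: "real \<Rightarrow> complex \<Rightarrow> complex" where
  "ckernel s x = cnj x / of_real ((norm x)\<^sup>2 + s\<^sup>2)"

definition cbump :: "real \<Rightarrow> complex \<Rightarrow> real" where
  "cbump s x = s\<^sup>2 / ((norm x)\<^sup>2 + s\<^sup>2)\<^sup>2"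

definition cmass :: "real \<Rightarrow> real" where
  "cmass s = (\<integral>x. indicator (cball 0 1) x * cbump s x \<partial>lborel)"

lemma norm_ckernel_le: "s > 0 \<Longrightarrow> x \<noteq> 0 \<Longrightarrow> norm (ckernel s x) \<le> 1 / norm x"
proof -
  assume s: "s > 0" and x: "x \<noteq> 0"
  have "norm (ckernel s x) = norm x / ((norm x)\<^sup>2 + s\<^sup>2)"
    unfolding ckernel_def norm_divide norm_of_real by simp
  also have "\<dots> \<le> norm x / (norm x)\<^sup>2"
    using x by (intro divide_left_mono) (auto intro!: mult_pos_pos add_pos_nonneg)
  also have "\<dots> = 1 / norm x" by (simp add: power2_eq_square)
  finally show ?thesis .
qed

text \<open>The same bound as for the kernel \<open>1 / x\<close> itself, so that everything derived from it is
  uniform in \<open>s\<close>.\<close>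

lemma norm_ckernel_diff_le:
  assumes "s > 0" "x \<noteq> 0" "y \<noteq> 0"
  shows "norm (ckernel s x - ckernel s y) \<le> norm (x - y) / (norm x * norm y)"
proof -
  define X where "X = (norm x)\<^sup>2 + s\<^sup>2"
  define Y where "Y = (norm y)\<^sup>2 + s\<^sup>2"
  have pos: "X > 0" "Y > 0" using assms by (auto simp: X_def Y_def intro: add_nonneg_pos)
  have num: "cnj x * of_real Y - cnj y * of_real X = cnj x * cnj y * (y - x) + of_real (s\<^sup>2) * (cnj x - cnj y)"
    unfolding X_def Y_def of_real_add complex_norm_square by (simp add: algebra_simps)
  have "ckernel s x - ckernel s y = (cnj x * of_real Y - cnj y * of_real X) / of_real (X * Y)"
    using pos unfolding ckernel_def X_def[symmetric] Y_def[symmetric] by (simp add: field_simps)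
  then have "norm (ckernel s x - ckernel s y) = norm (cnj x * cnj y * (y - x) + of_real (s\<^sup>2) * (cnj x - cnj y)) / (X * Y)"
    using pos unfolding num by (simp add: norm_divide norm_mult del: of_real_power)
  also have "\<dots> \<le> (norm x * norm y + s\<^sup>2) * norm (x - y) / (X * Y)"
  proof (rule divide_right_mono)
    have "norm (cnj x - cnj y) = norm (x - y)" by (metis complex_cnj_diff complex_mod_cnj)
    then have "norm (of_real (s\<^sup>2) * (cnj x - cnj y)) = s\<^sup>2 * norm (x - y)"
      by (simp only: norm_mult norm_of_real) simp
    moreover have "norm (cnj x * cnj y * (y - x)) = norm x * norm y * norm (x - y)"
      by (simp only: norm_mult complex_mod_cnj norm_minus_commute)
    ultimately show "norm (cnj x * cnj y * (y - x) + of_real (s\<^sup>2) * (cnj x - cnj y)) \<le> (norm x * norm y + s\<^sup>2) * norm (x - y)"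
      using norm_triangle_ineq[of "cnj x * cnj y * (y - x)" "of_real (s\<^sup>2) * (cnj x - cnj y)"]
      by (simp only: distrib_right)
  qed (use pos in simp)
  also have "\<dots> \<le> norm (x - y) / (norm x * norm y)"
  proof -
    have "(norm x * norm y + s\<^sup>2) * (norm x * norm y) \<le> X * Y"
    proof -
      have "2 * (norm x * norm y) \<le> (norm x)\<^sup>2 + (norm y)\<^sup>2"
        using sum_squares_bound[of "norm x" "norm y"] by simp
      then have "norm x * norm y \<le> (norm x)\<^sup>2 + (norm y)\<^sup>2"
        using mult_nonneg_nonneg[OF norm_ge_zero norm_ge_zero, of x y] by linarith
      then have "s\<^sup>2 * (norm x * norm y) \<le> s\<^sup>2 * ((norm x)\<^sup>2 + (norm y)\<^sup>2)"
        by (intro mult_left_mono) auto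
      moreover have "X * Y = (norm x * norm y) * (norm x * norm y) + s\<^sup>2 * ((norm x)\<^sup>2 + (norm y)\<^sup>2) + s\<^sup>2 * s\<^sup>2"
        by (simp add: X_def Y_def algebra_simps power2_eq_square)
      moreover have "0 \<le> s\<^sup>2 * s\<^sup>2" by simp
      ultimately show ?thesis by (simp only: distrib_right)
    qed
    then have "(norm x * norm y + s\<^sup>2) * (norm x * norm y) * norm (x - y) \<le> X * Y * norm (x - y)"
      by (rule mult_right_mono) simp
    then show ?thesis using pos assms by (simp add: field_simps)
  qed
  finally show ?thesis .
qed

text \<open>Only the square root of \<open>norm (x - y)\<close> is kept; the other square root is spent on making the
  singularities integrable.\<close>

lemma norm_diff_divide_le_powr:
  fixes x y :: "'a::real_normed_vector"
  assumes "x \<noteq> 0" "y \<noteq> 0"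
  shows "norm (x - y) / (norm x * norm y)
     \<le> 2 * sqrt (norm (x - y)) * (norm x powr (-3/2) + norm y powr (-3/2))"
proof -
  have main: "norm (x - y) / (norm x * norm y) \<le> 2 * sqrt (norm (x - y)) * norm x powr (-3/2)"
    if "x \<noteq> 0" "y \<noteq> 0" and le: "norm x \<le> norm y" for x y :: 'a
  proof -
    define d where "d = norm (x - y)"
    have d: "0 \<le> d" "d \<le> 2 * norm y"
      using norm_triangle_ineq4[of x y] le by (auto simp: d_def)
    have "sqrt d \<le> sqrt (4 * norm y)" using d by simp
    also have "\<dots> = 2 * sqrt (norm y)" by (simp add: real_sqrt_mult)
    finally have "d \<le> sqrt d * (2 * sqrt (norm y))"
      using mult_left_mono[of "sqrt d" "2 * sqrt (norm y)" "sqrt d"] d by simp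
    then have "d / (norm x * norm y) \<le> sqrt d * (2 * sqrt (norm y)) / (norm x * norm y)"
      by (rule divide_right_mono) simp
    also have "\<dots> = 2 * sqrt d * (1 / norm x) * (1 / sqrt (norm y))"
      using that real_sqrt_mult_self[of "norm y"] by (simp add: divide_simps)
    also have "\<dots> \<le> 2 * sqrt d * (1 / norm x) * (1 / sqrt (norm x))"
      using that d by (intro mult_left_mono divide_left_mono) auto
    also have "\<dots> = 2 * sqrt d * norm x powr (-3/2)"
    proof -
      have "norm x powr (-3/2) = norm x powr (-1 + -1/2)" by simp
      also have "\<dots> = norm x powr (-1) * norm x powr (-1/2)" by (rule powr_add)
      also have "norm x powr (-1) * norm x powr (-1/2) = (1 / norm x) * (1 / sqrt (norm x))"
        using that by (simp add: powr_minus powr_half_sqrt divide_simps)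
      finally show ?thesis by simp
    qed
    finally show ?thesis by (simp add: d_def)
  qed
  show ?thesis
  proof (cases "norm x \<le> norm y")
    case True
    have "norm x powr (-3/2) \<le> norm x powr (-3/2) + norm y powr (-3/2)" by simp
    then have "2 * sqrt (norm (x - y)) * norm x powr (-3/2) \<le> 2 * sqrt (norm (x - y)) * (norm x powr (-3/2) + norm y powr (-3/2))"
      by (intro mult_left_mono) auto
    then show ?thesis using main[OF assms True] by linarith
  next
    case False
    have "norm y powr (-3/2) \<le> norm x powr (-3/2) + norm y powr (-3/2)" by simp
    then have "2 * sqrt (norm (x - y)) * norm y powr (-3/2) \<le> 2 * sqrt (norm (x - y)) * (norm x powr (-3/2) + norm y powr (-3/2))"
      by (intro mult_left_mono) auto
    moreover have "norm (y - x) / (norm y * norm x) \<le> 2 * sqrt (norm (y - x)) * norm y powr (-3/2)"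
      using main[of y x] assms False by simp
    ultimately show ?thesis by (simp add: norm_minus_commute mult.commute)
  qed
qed

lemma has_derivative_ckernel:
  assumes "s > 0"
  shows "(ckernel s has_derivative (\<lambda>v. cnj v / of_real ((norm x)\<^sup>2 + s\<^sup>2)
           - cnj x * of_real (2 * (x \<bullet> v)) / of_real (((norm x)\<^sup>2 + s\<^sup>2)\<^sup>2))) (at x)"
proof -
  have pos: "x \<bullet> x + s\<^sup>2 > 0" using assms by (simp add: add_nonneg_pos)
  have eq: "ckernel s = (\<lambda>x. cnj x * of_real (inverse (x \<bullet> x + s\<^sup>2)))"
    by (simp add: ckernel_def[abs_def] power2_norm_eq_inner divide_inverse fun_eq_iff)
  have "((\<lambda>x. x \<bullet> x + s\<^sup>2) has_derivative (\<lambda>v. 2 * (x \<bullet> v))) (at x)"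
    by (auto intro!: derivative_eq_intros simp: inner_commute)
  from Deriv.has_derivative_inverse[OF _ this]
  have "((\<lambda>x. inverse (x \<bullet> x + s\<^sup>2)) has_derivative
      (\<lambda>v. - (inverse (x \<bullet> x + s\<^sup>2) * (2 * (x \<bullet> v)) * inverse (x \<bullet> x + s\<^sup>2)))) (at x)"
    using pos by simp
  from has_derivative_mult[OF bounded_linear_imp_has_derivative[OF bounded_linear_cnj] has_derivative_of_real[OF this]]
  have "(ckernel s has_derivative (\<lambda>v. cnj x * of_real (- (inverse (x \<bullet> x + s\<^sup>2) * (2 * (x \<bullet> v)) * inverse (x \<bullet> x + s\<^sup>2)))
       + cnj v * of_real (inverse (x \<bullet> x + s\<^sup>2)))) (at x)"
    unfolding eq .
  then show ?thesis
    unfolding power2_norm_eq_inner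
    by (rule has_derivative_eq_rhs) (simp add: fun_eq_iff divide_inverse power2_eq_square del: of_real_add)
qed

lemma dbar_ckernel:
  fixes x :: complex assumes "s > 0"
  defines "D \<equiv> \<lambda>v. cnj v / of_real ((norm x)\<^sup>2 + s\<^sup>2)
           - cnj x * of_real (2 * (x \<bullet> v)) / of_real (((norm x)\<^sup>2 + s\<^sup>2)\<^sup>2)"
  shows "D 1 + \<i> * D \<i> = of_real (2 * cbump s x)"
proof -
  define N where "N = (norm x)\<^sup>2 + s\<^sup>2"
  have N: "N > 0" using assms by (simp add: N_def add_nonneg_pos)
  have xx: "cnj x * (of_real (Re x) + \<i> * of_real (Im x)) = of_real ((norm x)\<^sup>2)"
    by (subst complex_norm_square) (simp add: complex_eq_iff)
  have "D 1 + \<i> * D \<i> = 2 / of_real N - 2 * (cnj x * (of_real (Re x) + \<i> * of_real (Im x))) / of_real (N\<^sup>2)"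
    unfolding D_def N_def[symmetric]
    by (simp add: inner_complex_def algebra_simps add_divide_distrib)
  also have "\<dots> = of_real (2 / N - 2 * (norm x)\<^sup>2 / N\<^sup>2)"
    unfolding xx by simp
  also have "2 / N - 2 * (norm x)\<^sup>2 / N\<^sup>2 = 2 * cbump s x"
    unfolding cbump_def N_def[symmetric] using N
    by (simp add: field_simps power2_eq_square) (simp add: N_def algebra_simps power2_eq_square)
  finally show ?thesis .
qed

lemma cbump_nonneg [simp]: "cbump s x \<ge> 0" by (simp add: cbump_def)

lemma cbump_le: assumes "norm x \<ge> \<delta>" "\<delta> > 0" shows "cbump s x \<le> s\<^sup>2 / \<delta> ^ 4"
proof -
  have "\<delta>\<^sup>2 \<le> (norm x)\<^sup>2 + s\<^sup>2" using assms power_mono[of \<delta> "norm x" 2] by (simp add: add_increasing2)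
  then have "(\<delta>\<^sup>2)\<^sup>2 \<le> ((norm x)\<^sup>2 + s\<^sup>2)\<^sup>2" by (intro power_mono) auto
  then show ?thesis unfolding cbump_def using assms
    by (intro divide_left_mono) (auto simp: power_mult[symmetric] intro!: mult_pos_pos zero_less_power add_pos_nonneg)
qed

lemma continuous_on_cbump: "s > 0 \<Longrightarrow> continuous_on S (cbump s)"
  unfolding cbump_def[abs_def]
  by (intro continuous_intros) (auto simp: add_nonneg_eq_0_iff)

text \<open>On the disc of radius \<open>s\<close> the bump is at least \<open>1 / (4 * s\<^sup>2)\<close>.\<close>

lemma cmass_ge: assumes "0 < s" "s \<le> 1" shows "cmass s \<ge> pi / 4"
proof -
  have "(\<integral>x. indicator (cball (0::complex) s) x *\<^sub>R (1 / (4 * s\<^sup>2)) \<partial>lborel) \<le> cmass s"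
    unfolding cmass_def
  proof (rule integral_mono)
    show "integrable lborel (\<lambda>x. indicator (cball (0::complex) s) x *\<^sub>R (1 / (4 * s\<^sup>2)))"
      by (rule borel_integrable_compact[OF compact_cball]) (intro continuous_intros)
    show "integrable lborel (\<lambda>x. indicator (cball 0 1) x * cbump s x)"
      using borel_integrable_compact[OF compact_cball continuous_on_cbump[OF assms(1)], of 0 1] by simp
    fix x :: complex
    show "indicator (cball 0 s) x *\<^sub>R (1 / (4 * s\<^sup>2)) \<le> indicator (cball 0 1) x * cbump s x"
    proof (cases "x \<in> cball 0 s")
      case True
      have "(norm x)\<^sup>2 + s\<^sup>2 \<le> 2 * s\<^sup>2" using True power_mono[of "norm x" s 2] by simp
      then have "((norm x)\<^sup>2 + s\<^sup>2)\<^sup>2 \<le> (2 * s\<^sup>2)\<^sup>2" by (intro power_mono) auto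
      then have "s\<^sup>2 / (2 * s\<^sup>2)\<^sup>2 \<le> cbump s x"
        unfolding cbump_def using assms by (intro divide_left_mono) (auto intro!: mult_pos_pos add_nonneg_pos)
      moreover have "s\<^sup>2 / (2 * s\<^sup>2)\<^sup>2 = 1 / (4 * s\<^sup>2)" using assms by (simp add: field_simps power2_eq_square)
      ultimately show ?thesis using True assms by auto
    qed (auto simp: cbump_def)
  qed
  moreover have "(\<integral>x. indicator (cball (0::complex) s) x *\<^sub>R (1 / (4 * s\<^sup>2)) \<partial>lborel) = pi / 4"
    using assms content_cball[of s "0::complex"] by (simp add: unit_ball_vol_2 power2_eq_square)
  ultimately show ?thesis by simp
qed

section \<open>Convolution with a compactly supported integrable function\<close>

lemma integrable_mult_continuous_compact_support:
  fixes A g :: "'a::euclidean_space \<Rightarrow> complex"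
  assumes A: "integrable lborel A" and S: "compact S" "\<And>x. x \<notin> S \<Longrightarrow> A x = 0"
    and g: "continuous_on UNIV g"
  shows "integrable lborel (\<lambda>x. A x * g x)"
proof -
  have "bounded (g ` S)"
    using S g by (meson compact_continuous_image compact_imp_bounded continuous_on_subset subset_UNIV)
  then obtain B where B: "\<And>x. x \<in> S \<Longrightarrow> norm (g x) \<le> B" by (auto simp: bounded_iff)
  have gm: "g \<in> borel_measurable lborel" using borel_measurable_continuous_onI[OF g] by simp
  show ?thesis
  proof (rule Bochner_Integration.integrable_bound[of lborel "\<lambda>x. B * norm (A x)"])
    show "integrable lborel (\<lambda>x. B * norm (A x))" using A by simp
    show "(\<lambda>x. A x * g x) \<in> borel_measurable lborel"
      using borel_measurable_integrable[OF A] gm by (intro borel_measurable_times)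
    have "norm (A x * g x) \<le> norm (B * norm (A x))" for x
    proof (cases "x \<in> S")
      case True
      have "norm (A x) * norm (g x) \<le> norm (A x) * B" using B[OF True] by (intro mult_left_mono) auto
      also have "\<dots> \<le> norm (B * norm (A x))" by (simp add: mult.commute)
      finally show ?thesis by (simp add: norm_mult)
    qed (simp add: S)
    then show "AE x in lborel. norm (A x * g x) \<le> norm (B * norm (A x))" by simp
  qed
qed

lemma continuous_on_UNIV_reflect:
  fixes k :: "'a::real_normed_vector \<Rightarrow> 'b::topological_space"
  shows "continuous_on UNIV k \<Longrightarrow> continuous_on UNIV (\<lambda>x. k (z - x))"
  by (rule continuous_on_compose2[of UNIV k]) (auto intro!: continuous_intros)

lemma continuous_on_convolution:
  fixes A k :: "'a::euclidean_space \<Rightarrow> complex"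
  assumes A: "integrable lborel A" and S: "compact S" "\<And>x. x \<notin> S \<Longrightarrow> A x = 0"
    and k: "continuous_on UNIV k"
  shows "continuous_on UNIV (\<lambda>z. \<integral>x. A x * k (z - x) \<partial>lborel)"
  unfolding continuous_on_iff
proof (intro ballI allI impI)
  fix z :: 'a and e :: real assume e: "e > 0"
  define T where "T = (\<lambda>p. fst p - snd p) ` (cball z 1 \<times> S)"
  have "compact T" unfolding T_def
    by (intro compact_continuous_image compact_Times S continuous_intros) simp
  then have "uniformly_continuous_on T k"
    using k by (intro compact_uniformly_continuous) (auto intro: continuous_on_subset)
  define I where "I = (\<integral>x. norm (A x) \<partial>lborel)"
  have I0: "I \<ge> 0" unfolding I_def by simp
  define e' where "e' = e / (I + 1)"
  have e': "e' > 0" using e I0 by (simp add: e'_def)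
  obtain d where d: "d > 0" "\<And>x y. x \<in> T \<Longrightarrow> y \<in> T \<Longrightarrow> dist y x < d \<Longrightarrow> dist (k y) (k x) < e'"
    using \<open>uniformly_continuous_on T k\<close> e' unfolding uniformly_continuous_on_def by metis
  have int: "integrable lborel (\<lambda>x. A x * k (u - x))" for u
    by (rule integrable_mult_continuous_compact_support[OF A S continuous_on_UNIV_reflect[OF k]])
  have "dist (\<integral>x. A x * k (y - x) \<partial>lborel) (\<integral>x. A x * k (z - x) \<partial>lborel) < e"
    if y: "dist y z < min d 1" for y
  proof -
    have le: "norm (A x * k (y - x) - A x * k (z - x)) \<le> e' * norm (A x)" for x
    proof (cases "x \<in> S")
      case True
      have "y - x \<in> T"
        unfolding T_def by (rule image_eqI[of _ _ "(y, x)"]) (use True y in \<open>auto simp: dist_commute\<close>)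
      moreover have "z - x \<in> T"
        unfolding T_def by (rule image_eqI[of _ _ "(z, x)"]) (use True in auto)
      moreover have "dist (y - x) (z - x) < d" using y by (simp add: dist_norm)
      ultimately have "norm (k (y - x) - k (z - x)) \<le> e'" using d(2) by (force simp: dist_norm)
      then have "norm (A x) * norm (k (y - x) - k (z - x)) \<le> norm (A x) * e'"
        by (intro mult_left_mono) auto
      then show ?thesis by (simp add: norm_mult right_diff_distrib[symmetric] mult.commute)
    qed (simp add: S)
    have "norm (\<integral>x. A x * k (y - x) - A x * k (z - x) \<partial>lborel) \<le> (\<integral>x. e' * norm (A x) \<partial>lborel)"
      using A int le by (intro Bochner_Integration.integral_norm_bound_integral Bochner_Integration.integrable_diff) auto
    also have "\<dots> = e' * I" by (simp add: I_def)
    also have "\<dots> < e" using e I0 by (simp add: e'_def divide_simps)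
    finally show ?thesis using int by (simp add: dist_norm)
  qed
  then show "\<exists>d>0. \<forall>x'\<in>UNIV. dist x' z < d \<longrightarrow>
      dist (\<integral>x. A x * k (x' - x) \<partial>lborel) (\<integral>x. A x * k (z - x) \<partial>lborel) < e"
    using d(1) by (intro exI[of _ "min d 1"]) auto
qed

text \<open>Continuity of every directional derivative gives, by compactness and finite dimension, a modulus
  of differentiability that does not depend on the point; this is what allows differentiation under
  the convolution integral without any regularity of the other factor.\<close>

lemma uniform_differentiability_on_cball:
  fixes k :: "'a::euclidean_space \<Rightarrow> 'b::real_normed_vector"
  assumes k: "\<And>x. (k has_derivative k' x) (at x)"
    and k'c: "\<And>v. continuous_on UNIV (\<lambda>x. k' x v)" and e: "e > 0"
  shows "\<exists>d>0. \<forall>x\<in>cball a r. \<forall>y\<in>cball a r. norm (y - x) < d \<longrightarrow>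
           norm (k y - k x - k' x (y - x)) \<le> e * norm (y - x)"
proof -
  define e' where "e' = e / DIM('a)"
  have e': "e' > 0" using e by (simp add: e'_def)
  have "\<exists>d>0. \<forall>x\<in>cball a r. \<forall>y\<in>cball a r. dist y x < d \<longrightarrow> dist (k' y b) (k' x b) < e'" for b
    using compact_uniformly_continuous[OF continuous_on_subset[OF k'c subset_UNIV] compact_cball, of a r b] e'
    unfolding uniformly_continuous_on_def by metis
  then obtain \<delta> where \<delta>: "\<And>b. \<delta> b > 0"
    "\<And>b x y. x \<in> cball a r \<Longrightarrow> y \<in> cball a r \<Longrightarrow> dist y x < \<delta> b \<Longrightarrow> dist (k' y b) (k' x b) < e'"
    by metis
  define d where "d = Min (\<delta> ` Basis)"
  have d: "d > 0" "\<And>b. b \<in> Basis \<Longrightarrow> d \<le> \<delta> b" using \<delta> by (auto simp: d_def)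
  have on: "onorm (\<lambda>v. k' y v - k' x v) \<le> e"
    if xy: "x \<in> cball a r" "y \<in> cball a r" "norm (y - x) < d" for x y
  proof (rule onorm_le)
    fix v
    have lin: "linear (k' x)" "linear (k' y)" using k has_derivative_linear by blast+
    have "k' y v - k' x v = (\<Sum>b\<in>Basis. (v \<bullet> b) *\<^sub>R (k' y b - k' x b))"
    proof -
      have "k' z v = (\<Sum>b\<in>Basis. (v \<bullet> b) *\<^sub>R k' z b)" if "linear (k' z)" for z
        by (subst (1) euclidean_representation[of v, symmetric])
           (simp add: linear_sum[OF that] linear_scale[OF that] del: euclidean_representation)
      then show ?thesis using lin by (simp add: scaleR_diff_right sum_subtractf)
    qed
    also have "norm \<dots> \<le> (\<Sum>b\<in>(Basis::'a set). norm v * e')"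
    proof (rule sum_norm_le)
      fix b :: 'a assume b: "b \<in> Basis"
      have "norm (k' y b - k' x b) \<le> e'"
        using \<delta>(2)[of x y b] xy d(2)[OF b] by (force simp: dist_norm)
      then show "norm ((v \<bullet> b) *\<^sub>R (k' y b - k' x b)) \<le> norm v * e'"
        using Basis_le_norm[OF b, of v] e' by (auto intro!: mult_mono)
    qed
    also have "\<dots> = e * norm v" by (simp add: e'_def)
    finally show "norm (k' y v - k' x v) \<le> e * norm v" .
  qed
  have "norm (k y - k x - k' x (y - x)) \<le> e * norm (y - x)"
    if xy: "x \<in> cball a r" "y \<in> cball a r" "norm (y - x) < d" for x y
  proof -
    define B where "B = cball a r \<inter> ball x d"
    have cB: "convex B" unfolding B_def by (intro convex_Int convex_cball convex_ball)
    have B: "x \<in> B" "y \<in> B" using xy d by (auto simp: B_def dist_norm norm_minus_commute)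
    have dl: "(\<lambda>v. k' u v - k' x v) = k' u - k' x" for u by (simp add: fun_eq_iff)
    have "norm (k y - k x - k' x (y - x)) \<le> norm (y - x) * e"
    proof (rule differentiable_bound_linearization[where S = B and f' = k'])
      show "x + t *\<^sub>R (y - x) \<in> B" if "t \<in> {0..1}" for t
      proof -
        have "x + t *\<^sub>R (y - x) = (1 - t) *\<^sub>R x + t *\<^sub>R y" by (simp add: algebra_simps)
        then show ?thesis using convexD_alt[OF cB B, of t] that by simp
      qed
      show "(k has_derivative k' u) (at u within B)" for u using k by (rule has_derivative_at_withinI)
      show "onorm (k' u - k' x) \<le> e" if "u \<in> B" for u
        using on[of x u] that xy unfolding dl by (auto simp: B_def dist_norm norm_minus_commute)
    qed (use B in auto)
    then show ?thesis by (simp add: mult.commute)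
  qed
  then show ?thesis using d(1) by blast
qed

lemma has_derivative_convolution:
  fixes A k :: "'a::euclidean_space \<Rightarrow> complex"
  assumes A: "integrable lborel A" and S: "compact S" "\<And>x. x \<notin> S \<Longrightarrow> A x = 0"
    and k: "\<And>x. (k has_derivative k' x) (at x)"
    and k'c: "\<And>v. continuous_on UNIV (\<lambda>x. k' x v)"
  shows "((\<lambda>z. \<integral>x. A x * k (z - x) \<partial>lborel) has_derivative
           (\<lambda>v. \<integral>x. A x * k' (z - x) v \<partial>lborel)) (at z)"
proof -
  have kc: "continuous_on UNIV k"
    using k by (meson continuous_at_imp_continuous_on has_derivative_continuous)
  have int: "integrable lborel (\<lambda>x. A x * k (u - x))" for u
    by (rule integrable_mult_continuous_compact_support[OF A S continuous_on_UNIV_reflect[OF kc]])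
  have int': "integrable lborel (\<lambda>x. A x * k' (u - x) v)" for u v
    by (rule integrable_mult_continuous_compact_support[OF A S continuous_on_UNIV_reflect[OF k'c]])
  have lin: "linear (k' x)" for x using k has_derivative_linear by blast
  define L where "L v = (\<integral>x. A x * k' (z - x) v \<partial>lborel)" for v
  have "linear L"
    unfolding L_def
  proof (rule linearI)
    show "(\<integral>x. A x * k' (z - x) (u + v) \<partial>lborel) = (\<integral>x. A x * k' (z - x) u \<partial>lborel) + (\<integral>x. A x * k' (z - x) v \<partial>lborel)" for u v
      using int' by (simp add: linear_add[OF lin] distrib_left)
    show "(\<integral>x. A x * k' (z - x) (r *\<^sub>R v) \<partial>lborel) = r *\<^sub>R (\<integral>x. A x * k' (z - x) v \<partial>lborel)" for r v
      by (simp add: linear_scale[OF lin])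
  qed
  then have bl: "bounded_linear L" by (simp add: linear_conv_bounded_linear)
  define I where "I = (\<integral>x. norm (A x) \<partial>lborel)"
  have I0: "I \<ge> 0" unfolding I_def by simp
  obtain r where r: "\<And>x. x \<in> S \<Longrightarrow> norm x \<le> r"
    using compact_imp_bounded[OF S(1)] by (auto simp: bounded_iff)
  have "\<exists>d>0. \<forall>y. norm (y - z) < d \<longrightarrow>
      norm ((\<integral>x. A x * k (y - x) \<partial>lborel) - (\<integral>x. A x * k (z - x) \<partial>lborel) - L (y - z)) \<le> e * norm (y - z)"
    if e: "e > 0" for e
  proof -
    define e' where "e' = e / (I + 1)"
    have e': "e' > 0" using e I0 by (simp add: e'_def)
    obtain d where d: "d > 0" "\<And>x y. x \<in> cball 0 (norm z + 1 + r) \<Longrightarrow> y \<in> cball 0 (norm z + 1 + r) \<Longrightarrow>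
        norm (y - x) < d \<Longrightarrow> norm (k y - k x - k' x (y - x)) \<le> e' * norm (y - x)"
      using uniform_differentiability_on_cball[of k k' e' 0 "norm z + 1 + r", OF k k'c e'] by blast
    have "norm ((\<integral>x. A x * k (y - x) \<partial>lborel) - (\<integral>x. A x * k (z - x) \<partial>lborel) - L (y - z)) \<le> e * norm (y - z)"
      if y: "norm (y - z) < min d 1" for y
    proof -
      have le: "norm (A x * k (y - x) - A x * k (z - x) - A x * k' (z - x) (y - z)) \<le> (e' * norm (y - z)) * norm (A x)" for x
      proof (cases "x \<in> S")
        case True
        have "norm (z - x) \<le> norm z + 1 + r" using norm_triangle_ineq4[of z x] r[OF True] by linarith
        moreover have "norm (y - x) \<le> norm z + 1 + r"
          using norm_triangle_ineq4[of y x] norm_triangle_sub[of y z] r[OF True] y by linarith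
        ultimately have "norm (k (y - x) - k (z - x) - k' (z - x) (y - z)) \<le> e' * norm (y - z)"
          using d(2)[of "z - x" "y - x"] y by simp
        then have "norm (A x) * norm (k (y - x) - k (z - x) - k' (z - x) (y - z)) \<le> norm (A x) * (e' * norm (y - z))"
          by (intro mult_left_mono) auto
        then show ?thesis by (simp add: norm_mult right_diff_distrib[symmetric] mult.commute)
      qed (simp add: S)
      have "norm (\<integral>x. A x * k (y - x) - A x * k (z - x) - A x * k' (z - x) (y - z) \<partial>lborel)
          \<le> (\<integral>x. (e' * norm (y - z)) * norm (A x) \<partial>lborel)"
        using A int int' le by (intro Bochner_Integration.integral_norm_bound_integral Bochner_Integration.integrable_diff) auto
      also have "\<dots> = (e' * I) * norm (y - z)" by (simp add: I_def)
      also have "\<dots> \<le> e * norm (y - z)"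
        using e I0 by (intro mult_right_mono) (simp_all add: e'_def divide_simps)
      finally show ?thesis using int int' by (simp add: L_def)
    qed
    then show ?thesis using d(1) by (intro exI[of _ "min d 1"]) auto
  qed
  then show ?thesis
    using bl unfolding has_derivative_at_alt L_def[symmetric] by blast
qed

section \<open>The regularised Cauchy potential\<close>

definition cpot :: "real \<Rightarrow> (complex \<Rightarrow> complex) \<Rightarrow> complex \<Rightarrow> complex" where
  "cpot s A z = (\<integral>x. A x * ckernel s (z - x) \<partial>lborel) / of_real (cmass s)"

lemma integrable_bounded_compact_support:
  fixes A :: "'a::euclidean_space \<Rightarrow> complex"
  assumes "A \<in> borel_measurable borel" "compact S" "\<And>x. x \<notin> S \<Longrightarrow> A x = 0" "\<And>x. norm (A x) \<le> K"
  shows "integrable lborel A"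
proof (rule Bochner_Integration.integrable_bound)
  show "integrable lborel (\<lambda>x. indicator S x *\<^sub>R K)"
    by (rule borel_integrable_compact[OF assms(2)]) (rule continuous_on_const)
  have "norm (A x) \<le> norm (indicator S x *\<^sub>R K)" for x
    using assms(3)[of x] assms(4)[of x] by (cases "x \<in> S") auto
  then show "AE x in lborel. norm (A x) \<le> norm (indicator S x *\<^sub>R K)" by simp
qed (use assms(1) in simp)

lemma norm_integral_powr_kernel_le:
  fixes A \<kappa> :: "complex \<Rightarrow> complex"
  assumes A: "\<And>x. norm (A x) \<le> K" "\<And>x. x \<notin> cball t0 R \<Longrightarrow> A x = 0" and c: "c \<ge> 0" "J \<ge> 0"
    and J: "\<And>z. z \<in> cball t0 R \<Longrightarrow>
        (\<integral>\<^sup>+x. indicator (cball t0 R) x * ennreal (norm (z - x) powr (-3/2)) \<partial>lborel) \<le> ennreal J"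
    and z: "z \<in> cball t0 R" "z' \<in> cball t0 R"
    and \<kappa>: "\<And>x. x \<in> cball t0 R \<Longrightarrow> x \<noteq> z \<Longrightarrow> x \<noteq> z' \<Longrightarrow>
        norm (\<kappa> x) \<le> c * (norm (z - x) powr (-3/2) + norm (z' - x) powr (-3/2))"
  shows "norm (\<integral>x. A x * \<kappa> x \<partial>lborel) \<le> K * c * (2 * J)"
proof (rule norm_integral_le_if_nn_integral_le)
  have K0: "K \<ge> 0" using A(1)[of 0] norm_ge_zero order_trans by blast
  then show "0 \<le> K * c * (2 * J)" using c by simp
  define p where "p u x = indicator (cball t0 R) x * ennreal (norm (u - x) powr (-3/2))" for u x :: complex
  have pm: "p u \<in> borel_measurable lborel" for u
    unfolding p_def by (intro borel_measurable_times_ennreal borel_measurable_indicator; simp)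
  have "(\<integral>\<^sup>+x. ennreal (norm (A x * \<kappa> x)) \<partial>lborel) \<le> (\<integral>\<^sup>+x. ennreal (K * c) * (p z x + p z' x) \<partial>lborel)"
  proof (rule nn_integral_mono_AE)
    have "AE x in lborel. x \<noteq> z" "AE x in lborel. x \<noteq> z'" by (rule AE_lborel_singleton)+
    then show "AE x in lborel. ennreal (norm (A x * \<kappa> x)) \<le> ennreal (K * c) * (p z x + p z' x)"
    proof eventually_elim
      case (elim x)
      show ?case
      proof (cases "x \<in> cball t0 R")
        case True
        have "norm (A x) * norm (\<kappa> x) \<le> K * (c * (norm (z - x) powr (-3/2) + norm (z' - x) powr (-3/2)))"
          using A(1)[of x] \<kappa>[OF True] elim K0 by (intro mult_mono) auto
        then have "ennreal (norm (A x * \<kappa> x)) \<le> ennreal (K * c * (norm (z - x) powr (-3/2) + norm (z' - x) powr (-3/2)))"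
          by (intro ennreal_leI) (simp add: norm_mult mult.assoc)
        also have "\<dots> = ennreal (K * c) * (p z x + p z' x)"
          using True K0 c by (simp add: p_def ennreal_mult ennreal_plus)
        finally show ?thesis .
      qed (simp add: A)
    qed
  qed
  also have "\<dots> = ennreal (K * c) * (integral\<^sup>N lborel (p z) + integral\<^sup>N lborel (p z'))"
    using pm by (simp add: nn_integral_cmult nn_integral_add)
  also have "\<dots> \<le> ennreal (K * c) * (ennreal J + ennreal J)"
    using J[OF z(1)] J[OF z(2)] unfolding p_def by (intro mult_left_mono add_mono) auto
  also have "\<dots> = ennreal (K * c * (2 * J))"
    using K0 c by (simp add: ennreal_mult[symmetric] ennreal_plus[symmetric] del: ennreal_plus)
  finally show "(\<integral>\<^sup>+x. ennreal (norm (A x * \<kappa> x)) \<partial>lborel) \<le> ennreal (K * c * (2 * J))" .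
qed

lemma continuous_on_ckernel: "s > 0 \<Longrightarrow> continuous_on S (ckernel s)"
  by (meson continuous_at_imp_continuous_on has_derivative_ckernel has_derivative_continuous)

text \<open>The constant is independent of the density and of \<open>s\<close>, so that potentials of varying densities
  and parameters are equicontinuous.\<close>

lemma cpot_bounds:
  fixes R K :: real
  assumes "R \<ge> 0" "K \<ge> 0"
  shows "\<exists>M\<ge>0. \<forall>t0 A s. A \<in> borel_measurable borel \<longrightarrow> (\<forall>x. norm (A x) \<le> K) \<longrightarrow>
      (\<forall>x. x \<notin> cball t0 R \<longrightarrow> A x = 0) \<longrightarrow> 0 < s \<longrightarrow> s \<le> 1 \<longrightarrow>
      (\<forall>z\<in>cball t0 R. norm (cpot s A z) \<le> M) \<and>
      (\<forall>z\<in>cball t0 R. \<forall>z'\<in>cball t0 R. norm (cpot s A z - cpot s A z') \<le> M * sqrt (norm (z - z')))"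
proof -
  obtain J where J: "J \<ge> 0" "\<And>t0 z. z \<in> cball t0 R \<Longrightarrow>
      (\<integral>\<^sup>+x. indicator (cball t0 R) x * ennreal (norm (z - x :: complex) powr (-3/2)) \<partial>lborel) \<le> ennreal J"
    using nn_integral_shifted_powr_bound[of R] by blast
  define M where "M = K * (sqrt (2 * R) + 2) * (2 * J) * (4 / pi)"
  have M0: "M \<ge> 0" unfolding M_def using assms J by (intro mult_nonneg_nonneg add_nonneg_nonneg) auto
  have main: "(\<forall>z\<in>cball t0 R. norm (cpot s A z) \<le> M) \<and>
      (\<forall>z\<in>cball t0 R. \<forall>z'\<in>cball t0 R. norm (cpot s A z - cpot s A z') \<le> M * sqrt (norm (z - z')))"
    if A: "A \<in> borel_measurable borel" "\<And>x. norm (A x) \<le> K" "\<And>x. x \<notin> cball t0 R \<Longrightarrow> A x = 0"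
      and s: "0 < s" "s \<le> 1" for t0 A s
  proof (intro conjI ballI)
    have mass: "cmass s \<ge> pi / 4" "cmass s > 0" using cmass_ge[OF s] pi_gt_zero by linarith+
    have div: "norm (I / of_real (cmass s)) \<le> r * (4 / pi)" if "norm I \<le> r" for I :: complex and r
    proof -
      have r0: "r \<ge> 0" using that norm_ge_zero order_trans by blast
      have "norm (I / of_real (cmass s)) = norm I / cmass s" using mass by (simp add: norm_divide)
      also have "\<dots> \<le> r / (pi / 4)" using that mass r0 by (intro frac_le) auto
      finally show ?thesis by simp
    qed
    have int: "integrable lborel (\<lambda>x. A x * ckernel s (z - x))" for z
      by (rule integrable_mult_continuous_compact_support[OF
            integrable_bounded_compact_support[OF A(1) compact_cball A(3,2)] compact_cball A(3)
            continuous_on_UNIV_reflect[OF continuous_on_ckernel[OF s(1)]]])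
    fix z assume z: "z \<in> cball t0 R"
    have "norm (\<integral>x. A x * ckernel s (z - x) \<partial>lborel) \<le> K * sqrt (2 * R) * (2 * J)"
    proof (rule norm_integral_powr_kernel_le[OF A(2,3) _ J(1) J(2) z z])
      show "0 \<le> sqrt (2 * R)" using assms(1) by simp
      fix x assume x: "x \<in> cball t0 R" "x \<noteq> z"
      have d: "norm (z - x) \<le> 2 * R"
        using x z dist_triangle2[of z x t0] by (simp add: dist_norm norm_minus_commute)
      have "norm (ckernel s (z - x)) \<le> 1 / norm (z - x)"
        using x by (intro norm_ckernel_le s) auto
      also have "1 / norm (z - x) = norm (z - x) powr (1/2 + -3/2)"
        using x by (simp add: powr_minus_divide)
      also have "\<dots> = sqrt (norm (z - x)) * norm (z - x) powr (-3/2)"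
        unfolding powr_add by (simp add: powr_half_sqrt)
      also have "\<dots> \<le> sqrt (2 * R) * (norm (z - x) powr (-3/2) + norm (z - x) powr (-3/2))"
        using d assms by (intro mult_mono) simp_all
      finally show "norm (ckernel s (z - x))
          \<le> sqrt (2 * R) * (norm (z - x) powr (-3/2) + norm (z - x) powr (-3/2))" .
    qed
    also have "\<dots> \<le> K * (sqrt (2 * R) + 2) * (2 * J)"
      using assms J by (intro mult_right_mono mult_left_mono) auto
    finally show "norm (cpot s A z) \<le> M"
      unfolding cpot_def M_def by (rule div)
    fix z' assume z': "z' \<in> cball t0 R"
    have "norm (\<integral>x. A x * (ckernel s (z - x) - ckernel s (z' - x)) \<partial>lborel)
        \<le> K * (2 * sqrt (norm (z - z'))) * (2 * J)"
    proof (rule norm_integral_powr_kernel_le[OF A(2,3) _ J(1) J(2) z z'])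
      show "0 \<le> 2 * sqrt (norm (z - z'))" by simp
      fix x assume x: "x \<noteq> z" "x \<noteq> z'"
      have "norm (ckernel s (z - x) - ckernel s (z' - x)) \<le> norm ((z - x) - (z' - x)) / (norm (z - x) * norm (z' - x))"
        using x by (intro norm_ckernel_diff_le s) auto
      also have "\<dots> \<le> 2 * sqrt (norm ((z - x) - (z' - x))) * (norm (z - x) powr (-3/2) + norm (z' - x) powr (-3/2))"
        using x by (intro norm_diff_divide_le_powr) auto
      finally show "norm (ckernel s (z - x) - ckernel s (z' - x))
          \<le> 2 * sqrt (norm (z - z')) * (norm (z - x) powr (-3/2) + norm (z' - x) powr (-3/2))"
        by simp
    qed
    also have "\<dots> \<le> K * ((sqrt (2 * R) + 2) * sqrt (norm (z - z'))) * (2 * J)"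
      using assms J by (intro mult_right_mono mult_left_mono) auto
    finally have dle: "norm ((\<integral>x. A x * (ckernel s (z - x) - ckernel s (z' - x)) \<partial>lborel) / of_real (cmass s))
       \<le> K * ((sqrt (2 * R) + 2) * sqrt (norm (z - z'))) * (2 * J) * (4 / pi)"
      by (rule div)
    have deq: "(\<integral>x. A x * (ckernel s (z - x) - ckernel s (z' - x)) \<partial>lborel) / of_real (cmass s)
        = cpot s A z - cpot s A z'"
      using int by (simp add: cpot_def right_diff_distrib diff_divide_distrib)
    show "norm (cpot s A z - cpot s A z') \<le> M * sqrt (norm (z - z'))"
      using dle unfolding deq by (simp add: M_def algebra_simps)
  qed
  show ?thesis
    by (rule exI[of _ M], rule conjI[OF M0], intro allI impI, rule main) blast+
qed

text \<open>Only the existence of a continuous derivative and its antilinear part matter later, so the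
  derivative itself is not named.\<close>

lemma cpot_derivative:
  fixes A :: "complex \<Rightarrow> complex"
  assumes A: "A \<in> borel_measurable borel" "\<And>x. norm (A x) \<le> K" "\<And>x. x \<notin> cball t0 R \<Longrightarrow> A x = 0"
    and s: "0 < s" "s \<le> 1"
  shows "\<exists>D. (\<forall>z. (cpot s A has_derivative D z) (at z)) \<and> (\<forall>v. continuous_on UNIV (\<lambda>z. D z v)) \<and>
     (\<forall>z. D z 1 + \<i> * D z \<i> = 2 * ((\<integral>x. A x * of_real (cbump s (z - x)) \<partial>lborel) / of_real (cmass s)))"
proof -
  define k' where "k' x v = cnj v / of_real ((norm x)\<^sup>2 + s\<^sup>2)
           - cnj x * of_real (2 * (x \<bullet> v)) / of_real (((norm x)\<^sup>2 + s\<^sup>2)\<^sup>2)" for x v :: complex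
  have kd: "(ckernel s has_derivative k' x) (at x)" for x
    unfolding k'_def using has_derivative_ckernel[OF s(1)] .
  have pos: "(norm x)\<^sup>2 + s\<^sup>2 \<noteq> 0" for x :: complex using s by (simp add: add_nonneg_eq_0_iff)
  have k'c: "continuous_on UNIV (\<lambda>x. k' x v)" for v
    unfolding k'_def by (intro continuous_intros) (auto simp only: of_real_eq_0_iff power_eq_0_iff pos)
  have Ai: "integrable lborel A"
    by (rule integrable_bounded_compact_support[OF A(1) compact_cball A(3,2)])
  define D where "D z v = (\<integral>x. A x * k' (z - x) v \<partial>lborel) / of_real (cmass s)" for z v
  have int: "integrable lborel (\<lambda>x. A x * k' (z - x) v)" for z v
    by (rule integrable_mult_continuous_compact_support[OF Ai compact_cball A(3) continuous_on_UNIV_reflect[OF k'c]])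
  have mass: "cmass s \<noteq> 0" using cmass_ge[OF s] pi_gt_zero by linarith
  have 1: "(cpot s A has_derivative D z) (at z)" for z
    unfolding cpot_def[abs_def] D_def[abs_def] divide_inverse
    by (rule has_derivative_mult_left[OF has_derivative_convolution[OF Ai compact_cball A(3) kd k'c]])
  have 2: "continuous_on UNIV (\<lambda>z. D z v)" for v
    unfolding D_def using mass
    by (intro continuous_on_divide continuous_on_convolution[OF Ai compact_cball A(3) k'c] continuous_on_const) auto
  have 3: "D z 1 + \<i> * D z \<i> = 2 * ((\<integral>x. A x * of_real (cbump s (z - x)) \<partial>lborel) / of_real (cmass s))" for z
  proof -
    have "D z 1 + \<i> * D z \<i> = ((\<integral>x. A x * k' (z - x) 1 \<partial>lborel) + (\<integral>x. \<i> * (A x * k' (z - x) \<i>) \<partial>lborel)) / of_real (cmass s)"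
      by (simp add: D_def add_divide_distrib)
    also have "(\<integral>x. A x * k' (z - x) 1 \<partial>lborel) + (\<integral>x. \<i> * (A x * k' (z - x) \<i>) \<partial>lborel)
       = (\<integral>x. A x * k' (z - x) 1 + \<i> * (A x * k' (z - x) \<i>) \<partial>lborel)"
      by (rule Bochner_Integration.integral_add[symmetric]) (use int in auto)
    also have "(\<lambda>x. A x * k' (z - x) 1 + \<i> * (A x * k' (z - x) \<i>)) = (\<lambda>x. 2 * (A x * of_real (cbump s (z - x))))"
    proof
      fix x
      have "k' (z - x) 1 + \<i> * k' (z - x) \<i> = of_real (2 * cbump s (z - x))"
        unfolding k'_def by (rule dbar_ckernel[OF s(1)])
      then have "A x * (k' (z - x) 1 + \<i> * k' (z - x) \<i>) = 2 * (A x * of_real (cbump s (z - x)))" by simp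
      then show "A x * k' (z - x) 1 + \<i> * (A x * k' (z - x) \<i>) = 2 * (A x * of_real (cbump s (z - x)))"
        by (simp add: algebra_simps)
    qed
    finally show ?thesis by simp
  qed
  show ?thesis using 1 2 3 by blast
qed

text \<open>Near \<open>z\<close> the density differs from \<open>A z\<close> by at most \<open>\<eta>\<close>; at distance \<open>\<delta>\<close> the bump is at most
  \<open>s\<^sup>2 / \<delta> ^ 4\<close>.\<close>

lemma cbump_average_approx:
  fixes A :: "complex \<Rightarrow> complex"
  assumes A: "A \<in> borel_measurable borel" "\<And>x. norm (A x) \<le> K" "\<And>x. x \<notin> cball t0 R \<Longrightarrow> A x = 0"
    and s: "0 < s" "s \<le> 1" and \<delta>: "0 < \<delta>" "\<delta> \<le> 1"
    and \<eta>: "\<And>x. x \<in> ball z \<delta> \<Longrightarrow> norm (A x - A z) \<le> \<eta>"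
  shows "norm ((\<integral>x. A x * of_real (cbump s (z - x)) \<partial>lborel) / of_real (cmass s) - A z)
     \<le> \<eta> + 4 / pi * (K * (s\<^sup>2 / \<delta> ^ 4) * (measure lborel (cball t0 R) + measure lborel (cball z 1)))"
proof -
  have mass: "cmass s \<ge> pi / 4" "cmass s > 0" using cmass_ge[OF s] pi_gt_zero by linarith+
  have K0: "K \<ge> 0" using A(2)[of 0] norm_ge_zero order_trans by blast
  have \<eta>0: "\<eta> \<ge> 0" using \<eta>[of z] \<delta> by simp
  have ind: "indicator (cball 0 1) (z - x) = (indicator (cball z 1) x :: 'b::zero_neq_one)" for x
    by (simp add: indicator_def dist_norm norm_minus_commute)
  have cb: "continuous_on UNIV (cbump s)" by (rule continuous_on_cbump[OF s(1)])
  have cbm: "cbump s \<in> borel_measurable borel" by (rule borel_measurable_continuous_onI[OF cb])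
  have massz: "cmass s = (\<integral>x. indicator (cball z 1) x * cbump s (z - x) \<partial>lborel)"
    unfolding cmass_def
    by (subst integral_lborel_reflect[of "\<lambda>x. indicator (cball 0 1) x * cbump s x" z, symmetric])
       (use cbm in \<open>auto simp: ind intro!: borel_measurable_times borel_measurable_indicator\<close>)
  have i1: "integrable lborel (\<lambda>x. indicator (cball z 1) x * cbump s (z - x))"
    using borel_integrable_compact[OF compact_cball, of z 1 "\<lambda>x. cbump s (z - x)"]
      continuous_on_subset[OF continuous_on_UNIV_reflect[OF cb, of z]] by simp
  have i2: "integrable lborel (\<lambda>x. A x * of_real (cbump s (z - x)))"
    by (rule integrable_mult_continuous_compact_support[OF
          integrable_bounded_compact_support[OF A(1) compact_cball A(3,2)] compact_cball A(3)
          continuous_on_UNIV_reflect[OF continuous_on_of_real[OF cb]]])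
  have i3: "integrable lborel (\<lambda>x. of_real (indicator (cball z 1) x * cbump s (z - x)) * A z)"
    using i1 by (intro integrable_mult_left integrable_of_real)
  have ic: "integrable lborel (indicator (cball u r) :: complex \<Rightarrow> real)" for u r
    by (intro integrable_real_indicator) (simp, rule emeasure_bounded_finite[OF bounded_cball])
  let ?C = "K * (s\<^sup>2 / \<delta> ^ 4)"
  have C0: "?C \<ge> 0" using K0 \<delta> by simp
  have "of_real (cmass s) * A z = (\<integral>x. of_real (indicator (cball z 1) x * cbump s (z - x)) * A z \<partial>lborel)"
    unfolding massz using i1 by (simp del: of_real_mult)
  then have "(\<integral>x. A x * of_real (cbump s (z - x)) \<partial>lborel) - of_real (cmass s) * A z
     = (\<integral>x. A x * of_real (cbump s (z - x)) - of_real (indicator (cball z 1) x * cbump s (z - x)) * A z \<partial>lborel)"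
    using i2 i3 by simp
  also have "norm \<dots> \<le> (\<integral>x. \<eta> * (indicator (cball z 1) x * cbump s (z - x))
      + ?C * (indicator (cball t0 R) x + indicator (cball z 1) x) \<partial>lborel)"
  proof (rule Bochner_Integration.integral_norm_bound_integral)
    show "integrable lborel (\<lambda>x. A x * of_real (cbump s (z - x)) - of_real (indicator (cball z 1) x * cbump s (z - x)) * A z)"
      using i2 i3 by (rule Bochner_Integration.integrable_diff)
    show "integrable lborel (\<lambda>x. \<eta> * (indicator (cball z 1) x * cbump s (z - x))
      + ?C * (indicator (cball t0 R) x + indicator (cball z 1) x))"
      using i1 ic by (intro Bochner_Integration.integrable_add integrable_mult_right) auto
    fix x
    show "norm (A x * of_real (cbump s (z - x)) - of_real (indicator (cball z 1) x * cbump s (z - x)) * A z)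
      \<le> \<eta> * (indicator (cball z 1) x * cbump s (z - x))
      + ?C * (indicator (cball t0 R) x + indicator (cball z 1) x)"
    proof (cases "x \<in> ball z \<delta>")
      case True
      have "dist z x \<le> 1" using True \<delta>(2) unfolding mem_ball by linarith
      then have xz: "x \<in> cball z 1" by simp
      have "norm (A x * of_real (cbump s (z - x)) - of_real (indicator (cball z 1) x * cbump s (z - x)) * A z)
         = norm (A x - A z) * cbump s (z - x)"
        using xz by (simp add: norm_mult[symmetric] mult.commute[of "complex_of_real _"] left_diff_distrib[symmetric])
           (simp add: norm_mult)
      also have "\<dots> \<le> \<eta> * cbump s (z - x)" by (intro mult_right_mono \<eta> True) simp
      also have "\<dots> = \<eta> * (indicator (cball z 1) x * cbump s (z - x))" using xz by simp
      also have "\<dots> \<le> \<eta> * (indicator (cball z 1) x * cbump s (z - x))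
          + ?C * (indicator (cball t0 R) x + indicator (cball z 1) x)"
        using mult_nonneg_nonneg[OF C0, of "indicator (cball t0 R) x + indicator (cball z 1) x"] by simp
      finally show ?thesis .
    next
      case False
      have b: "cbump s (z - x) \<le> s\<^sup>2 / \<delta> ^ 4"
        by (rule cbump_le) (use False \<delta>(1) in \<open>simp_all add: dist_norm\<close>)
      have 1: "norm (A x * of_real (cbump s (z - x))) \<le> ?C * indicator (cball t0 R) x"
      proof (cases "x \<in> cball t0 R")
        case True
        have "norm (A x) * cbump s (z - x) \<le> K * (s\<^sup>2 / \<delta> ^ 4)"
          using A(2)[of x] b K0 by (intro mult_mono) simp_all
        then show ?thesis using True by (simp add: norm_mult)
      qed (simp add: A(3))
      have 2: "norm (of_real (indicator (cball z 1) x * cbump s (z - x)) * A z) \<le> ?C * indicator (cball z 1) x"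
      proof (cases "x \<in> cball z 1")
        case True
        have "cbump s (z - x) * norm (A z) \<le> (s\<^sup>2 / \<delta> ^ 4) * K"
          using A(2)[of z] b by (intro mult_mono) simp_all
        also have "\<dots> = K * (s\<^sup>2 / \<delta> ^ 4)" by (rule mult.commute)
        finally show ?thesis using True by (simp add: norm_mult)
      qed simp
      have "norm (A x * of_real (cbump s (z - x)) - of_real (indicator (cball z 1) x * cbump s (z - x)) * A z)
         \<le> ?C * indicator (cball t0 R) x + ?C * indicator (cball z 1) x"
        using norm_triangle_ineq4 1 2 by (meson add_mono order_trans)
      also have "\<dots> \<le> \<eta> * (indicator (cball z 1) x * cbump s (z - x))
          + ?C * (indicator (cball t0 R) x + indicator (cball z 1) x)"
        using mult_nonneg_nonneg[OF \<eta>0, of "indicator (cball z 1) x * cbump s (z - x)"]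
        by (simp add: distrib_left)
      finally show ?thesis .
    qed
  qed
  also have "\<dots> = \<eta> * cmass s + ?C * (measure lborel (cball t0 R) + measure lborel (cball z 1))"
    unfolding massz using i1 ic by simp
  finally have *: "norm ((\<integral>x. A x * of_real (cbump s (z - x)) \<partial>lborel) - of_real (cmass s) * A z)
      \<le> \<eta> * cmass s + ?C * (measure lborel (cball t0 R) + measure lborel (cball z 1))" .
  have "(\<integral>x. A x * of_real (cbump s (z - x)) \<partial>lborel) / of_real (cmass s) - A z
     = ((\<integral>x. A x * of_real (cbump s (z - x)) \<partial>lborel) - of_real (cmass s) * A z) / of_real (cmass s)"
    using mass(2) by (simp add: diff_divide_distrib)
  then have "norm ((\<integral>x. A x * of_real (cbump s (z - x)) \<partial>lborel) / of_real (cmass s) - A z)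
     \<le> (\<eta> * cmass s + ?C * (measure lborel (cball t0 R) + measure lborel (cball z 1))) / cmass s"
    using * mass(2) by (simp add: norm_divide divide_right_mono)
  also have "\<dots> = \<eta> + ?C * (measure lborel (cball t0 R) + measure lborel (cball z 1)) / cmass s"
    using mass(2) by (simp add: add_divide_distrib)
  also have "\<dots> \<le> \<eta> + ?C * (measure lborel (cball t0 R) + measure lborel (cball z 1)) / (pi / 4)"
  proof (rule add_left_mono, rule divide_left_mono)
    show "0 \<le> ?C * (measure lborel (cball t0 R) + measure lborel (cball z 1))"
      by (rule mult_nonneg_nonneg[OF C0]) simp
    show "0 < cmass s * (pi / 4)" using mass(2) by simp
  qed (rule mass(1))
  also have "X / (pi / 4) = 4 / pi * X" for X :: real by simp
  finally show ?thesis .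
qed

lemma cbump_average_uniform_approx:
  fixes A :: "complex \<Rightarrow> complex"
  assumes A: "A \<in> borel_measurable borel" "\<And>x. norm (A x) \<le> K" "\<And>x. x \<notin> cball t0 R \<Longrightarrow> A x = 0"
    and \<delta>: "0 < \<delta>" and \<eta>: "\<And>z x. z \<in> E \<Longrightarrow> x \<in> ball z \<delta> \<Longrightarrow> norm (A x - A z) \<le> \<eta>" and e: "e > 0"
  shows "\<exists>s. 0 < s \<and> s \<le> 1 \<and> (\<forall>z\<in>E. norm ((\<integral>x. A x * of_real (cbump s (z - x)) \<partial>lborel) / of_real (cmass s) - A z) \<le> \<eta> + e)"
proof -
  have K0: "K \<ge> 0" using A(2)[of 0] norm_ge_zero order_trans by blast
  define d where "d = min \<delta> 1"
  have d: "0 < d" "d \<le> 1" "d \<le> \<delta>" using \<delta> by (simp_all add: d_def)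
  define X where "X = 4 / pi * (K / d ^ 4 * (measure lborel (cball t0 R) + pi))"
  have X0: "X \<ge> 0" unfolding X_def using K0 d(1) by (intro mult_nonneg_nonneg add_nonneg_nonneg) simp_all
  define s where "s = min 1 (e / (X + 1))"
  have s: "0 < s" "s \<le> 1" using e X0 by (simp_all add: s_def)
  have "norm ((\<integral>x. A x * of_real (cbump s (z - x)) \<partial>lborel) / of_real (cmass s) - A z) \<le> \<eta> + e"
    if z: "z \<in> E" for z
  proof -
    have pi1: "measure lborel (cball z 1) = pi"
      using content_cball[of 1 z] by (simp add: unit_ball_vol_2)
    have "norm ((\<integral>x. A x * of_real (cbump s (z - x)) \<partial>lborel) / of_real (cmass s) - A z)
       \<le> \<eta> + 4 / pi * (K * (s\<^sup>2 / d ^ 4) * (measure lborel (cball t0 R) + measure lborel (cball z 1)))"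
      by (rule cbump_average_approx[OF A s d(1,2)]) (use \<eta>[OF z] d(3) in simp_all)
    also have "4 / pi * (K * (s\<^sup>2 / d ^ 4) * (measure lborel (cball t0 R) + measure lborel (cball z 1))) = X * s\<^sup>2"
      unfolding pi1 X_def by simp
    also have "X * s\<^sup>2 \<le> X * s"
      using X0 s by (intro mult_left_mono) (simp_all add: power2_eq_square mult_left_le)
    also have "X * s \<le> X * (e / (X + 1))" using X0 by (intro mult_left_mono) (simp_all add: s_def)
    also have "\<dots> \<le> e" using X0 e by (simp add: divide_simps)
    finally show ?thesis by simp
  qed
  then show ?thesis using s by blast
qed

section \<open>The similarity principle\<close>
text \<open>A weak form of \<open>\<bar>\<partial>g/\<partial>(cnj t)\<bar> \<le> K * \<bar>g\<bar>\<close> off the zeros of \<open>g\<close>: the smooth functions that satisfy it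
  come arbitrarily close to \<open>g\<close> on compact sets. The antilinear part \<open>D t 1 + \<i> * D t \<i>\<close> is twice the
  Wirtinger derivative, whence the factor \<open>2\<close>.\<close>

definition dbar_approximable :: "real \<Rightarrow> complex set \<Rightarrow> (complex \<Rightarrow> complex) \<Rightarrow> bool" where
  "dbar_approximable K S g \<longleftrightarrow>
     (\<forall>C \<eta>. compact C \<and> C \<subseteq> S \<and> (\<forall>t\<in>C. g t \<noteq> 0) \<and> \<eta> > 0 \<longrightarrow>
        (\<exists>f D N. open N \<and> C \<subseteq> N \<and> (\<forall>t\<in>N. (f has_derivative D t) (at t)) \<and>
           (\<forall>v. continuous_on N (\<lambda>t. D t v)) \<and>
           (\<forall>t\<in>C. norm (f t - g t) \<le> \<eta> \<and> norm (D t 1 + \<i> * D t \<i>) \<le> 2 * K * norm (f t))))"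

lemma norm_exp_diff_le:
  fixes a b :: complex
  assumes "norm a \<le> M" "norm b \<le> M"
  shows "norm (exp a - exp b) \<le> exp M * norm (a - b)"
proof (rule field_differentiable_bound[of "cball 0 M" exp exp])
  show "norm (exp z) \<le> exp M" if "z \<in> cball 0 M" for z :: complex
    using that complex_Re_le_cmod[of z] by simp
qed (use assms in \<open>auto intro!: derivative_eq_intros\<close>)

text \<open>The density \<open>A = (\<partial>f/\<partial>(cnj t)) / f\<close> is cut off to the compact set where \<open>norm (g t) \<ge> e\<close>. The
  set \<open>E\<close> keeps away from the boundary of the disc and of this set, so near \<open>E\<close> the cut-off is not felt,
  \<open>A\<close> is uniformly continuous there, and its averages approximate it.\<close>

lemma dbar_approx_step:
  fixes g :: "complex \<Rightarrow> complex" and n :: nat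
  assumes g: "continuous_on (cball t0 R) g" and ap: "dbar_approximable K (cball t0 R) g" and "K \<ge> 0"
  defines "e \<equiv> 1 / real (Suc n)"
  defines "E \<equiv> {t \<in> cball t0 (R - e). 2 * e \<le> norm (g t)}"
  shows "\<exists>f D N A s. open N \<and> E \<subseteq> N \<and> (\<forall>t\<in>N. (f has_derivative D t) (at t)) \<and>
      (\<forall>v. continuous_on N (\<lambda>t. D t v)) \<and> (\<forall>t\<in>E. norm (f t - g t) \<le> e) \<and>
      A \<in> borel_measurable borel \<and> (\<forall>x. norm (A x) \<le> K) \<and> (\<forall>x. x \<notin> cball t0 R \<longrightarrow> A x = 0) \<and>
      0 < s \<and> s \<le> 1 \<and>
      (\<forall>t\<in>E. norm (D t 1 + \<i> * D t \<i>
          - 2 * ((\<integral>x. A x * of_real (cbump s (t - x)) \<partial>lborel) / of_real (cmass s)) * f t) \<le> 2 * e * norm (f t))"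
proof -
  have e: "e > 0" by (simp add: e_def)
  define C where "C = {t \<in> cball t0 R. e \<le> norm (g t)}"
  have "closed C"
    using continuous_closed_preimage[OF continuous_on_norm[OF g] closed_cball, of "{e..}"]
    by (simp add: C_def vimage_def Int_def)
  then have cC: "compact C"
    unfolding compact_eq_bounded_closed C_def by (auto intro: bounded_subset[OF bounded_cball])
  have EC: "E \<subseteq> C" using e by (auto simp: E_def C_def)
  obtain f D N where N: "open N" "C \<subseteq> N" and D: "\<And>t. t \<in> N \<Longrightarrow> (f has_derivative D t) (at t)"
      and Dc: "\<And>v. continuous_on N (\<lambda>t. D t v)"
      and f: "\<And>t. t \<in> C \<Longrightarrow> norm (f t - g t) \<le> e / 2"
      and Db: "\<And>t. t \<in> C \<Longrightarrow> norm (D t 1 + \<i> * D t \<i>) \<le> 2 * K * norm (f t)"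
  proof -
    have "compact C \<and> C \<subseteq> cball t0 R \<and> (\<forall>t\<in>C. g t \<noteq> 0) \<and> e / 2 > 0"
      using cC e by (auto simp: C_def)
    from ap[unfolded dbar_approximable_def, rule_format, OF this] show ?thesis using that by blast
  qed
  have f0: "f t \<noteq> 0" if "t \<in> C" for t
    using f[OF that] that e by (auto simp: C_def)
  define B where "B t = (D t 1 + \<i> * D t \<i>) / (2 * f t)" for t
  have fc: "continuous_on N f"
    using D by (meson continuous_at_imp_continuous_on has_derivative_continuous)
  have Bc: "continuous_on C B"
    unfolding B_def[abs_def] using f0
    by (intro continuous_intros continuous_on_subset[OF Dc N(2)] continuous_on_subset[OF fc N(2)]) auto
  define A where "A t = (if t \<in> C then B t else 0)" for t
  have Am: "A \<in> borel_measurable borel"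
    unfolding A_def[abs_def] using Bc \<open>closed C\<close>
    by (intro borel_measurable_continuous_on_if continuous_on_const) auto
  have AK: "norm (A t) \<le> K" for t
  proof (cases "t \<in> C")
    case True
    then show ?thesis using Db[OF True] f0[OF True] by (simp add: A_def B_def norm_divide norm_mult divide_simps mult_ac)
  qed (simp add: A_def \<open>K \<ge> 0\<close>)
  have A0: "A t = 0" if "t \<notin> cball t0 R" for t using that by (simp add: A_def C_def)
  obtain \<delta>1 where \<delta>1: "\<delta>1 > 0" "\<And>x y. x \<in> cball t0 R \<Longrightarrow> y \<in> cball t0 R \<Longrightarrow> dist y x < \<delta>1 \<Longrightarrow> dist (g y) (g x) < e"
    using compact_uniformly_continuous[OF g compact_cball] e unfolding uniformly_continuous_on_def by metis
  obtain \<delta>2 where \<delta>2: "\<delta>2 > 0" "\<And>x y. x \<in> C \<Longrightarrow> y \<in> C \<Longrightarrow> dist y x < \<delta>2 \<Longrightarrow> dist (B y) (B x) < e / 2"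
    using compact_uniformly_continuous[OF Bc cC] half_gt_zero[OF e] unfolding uniformly_continuous_on_def by metis
  define \<delta> where "\<delta> = min e (min \<delta>1 \<delta>2)"
  have "norm (A x - A z) \<le> e / 2" if z: "z \<in> E" and x: "x \<in> ball z \<delta>" for z x
  proof -
    have "dist t0 x \<le> R" using z x dist_triangle[of t0 x z] by (simp add: E_def \<delta>_def)
    moreover have "dist t0 z \<le> R" using z e by (simp add: E_def)
    ultimately have "dist (g x) (g z) < e" using x by (intro \<delta>1(2)) (simp_all add: \<delta>_def dist_commute)
    then have "norm (g x) \<ge> e" using z norm_triangle_ineq2[of "g z" "g x"] by (simp add: E_def dist_norm norm_minus_commute)
    then have "x \<in> C" using \<open>dist t0 x \<le> R\<close> by (simp add: C_def)
    moreover have "z \<in> C" using z EC by blast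
    ultimately show ?thesis using \<delta>2(2)[of z x] x by (simp add: A_def \<delta>_def dist_commute dist_norm)
  qed
  then obtain s where s: "0 < s" "s \<le> 1" and sE: "\<And>z. z \<in> E \<Longrightarrow>
      norm ((\<integral>x. A x * of_real (cbump s (z - x)) \<partial>lborel) / of_real (cmass s) - A z) \<le> e / 2 + e / 2"
    using cbump_average_uniform_approx[OF Am AK A0, where ?t0.0 = t0 and R = R and \<delta> = \<delta> and E = E and \<eta> = "e / 2" and e = "e / 2"] e \<delta>1(1) \<delta>2(1) by (auto simp: \<delta>_def)
  have fin: "norm (D t 1 + \<i> * D t \<i>
          - 2 * ((\<integral>x. A x * of_real (cbump s (t - x)) \<partial>lborel) / of_real (cmass s)) * f t) \<le> 2 * e * norm (f t)"
    if t: "t \<in> E" for t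
  proof -
    define I where "I = (\<integral>x. A x * of_real (cbump s (t - x)) \<partial>lborel) / of_real (cmass s)"
    have tC: "t \<in> C" using t EC by blast
    have "D t 1 + \<i> * D t \<i> = 2 * A t * f t" using tC f0[OF tC] by (simp add: A_def B_def)
    then have "D t 1 + \<i> * D t \<i> - 2 * I * f t = 2 * (A t - I) * f t" by (simp add: algebra_simps)
    then have "norm (D t 1 + \<i> * D t \<i> - 2 * I * f t) = 2 * norm (I - A t) * norm (f t)"
      by (simp only: norm_mult norm_minus_commute[of I] norm_numeral)
    also have "\<dots> \<le> 2 * e * norm (f t)"
      using sE[OF t] unfolding I_def by (intro mult_right_mono) simp_all
    finally show ?thesis unfolding I_def .
  qed
  have fe: "norm (f t - g t) \<le> e" if "t \<in> E" for t using f[of t] EC that e by force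
  show ?thesis
    using N(1) subset_trans[OF EC N(2)] D Dc fe Am AK A0 s fin
    by (intro exI[of _ f] exI[of _ D] exI[of _ N] exI[of _ A] exI[of _ s]) blast
qed

text \<open>For approximations \<open>f\<^sub>n\<close> of \<open>g\<close> with potentials \<open>u\<^sub>n\<close> of their logarithmic derivatives, the
  functions \<open>f\<^sub>n * exp (- u\<^sub>n)\<close> are almost holomorphic. The potentials have a uniformly convergent
  subsequence, so the limit \<open>h = g * exp (- U)\<close> has vanishing integrals around triangles off the
  zeros of \<open>g\<close>; Morera's and Rado's theorems finish the argument. The bound \<open>M\<close> on the potentials
  is chosen before \<open>g\<close>.\<close>

theorem similarity_principle:
  fixes R K :: real
  assumes "R > 0" "K \<ge> 0"
  shows "\<exists>M\<ge>0. \<forall>t0 g. continuous_on (cball t0 R) g \<longrightarrow> dbar_approximable K (cball t0 R) g \<longrightarrow>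
     (\<exists>h. h holomorphic_on ball t0 R \<and>
        (\<forall>t\<in>ball t0 R. exp (- M) * norm (g t) \<le> norm (h t) \<and> norm (h t) \<le> exp M * norm (g t)))"
proof -
  obtain M where M0: "M \<ge> 0" and M: "\<And>t0 A s. A \<in> borel_measurable borel \<Longrightarrow> (\<forall>x. norm (A x) \<le> K) \<Longrightarrow>
      (\<forall>x. x \<notin> cball t0 R \<longrightarrow> A x = 0) \<Longrightarrow> 0 < s \<Longrightarrow> s \<le> 1 \<Longrightarrow>
      (\<forall>z\<in>cball t0 R. norm (cpot s A z) \<le> M) \<and>
      (\<forall>z\<in>cball t0 R. \<forall>z'\<in>cball t0 R. norm (cpot s A z - cpot s A z') \<le> M * sqrt (norm (z - z')))"
    using cpot_bounds[of R K] assms by (metis less_imp_le)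
  have "\<exists>h. h holomorphic_on ball t0 R \<and>
        (\<forall>t\<in>ball t0 R. exp (- M) * norm (g t) \<le> norm (h t) \<and> norm (h t) \<le> exp M * norm (g t))"
    if g: "continuous_on (cball t0 R) g" and ap: "dbar_approximable K (cball t0 R) g" for t0 and g :: "complex \<Rightarrow> complex"
  proof -
    \<comment> \<open>\<open>e n\<close> is the accuracy of the \<open>n\<close>-th approximation, and the sets \<open>E n\<close> exhaust the nonzero points of the open disc\<close>
    define e where "e n = 1 / real (Suc n)" for n
    define E where "E n = {t \<in> cball t0 (R - e n). 2 * e n \<le> norm (g t)}" for n
    define step :: "nat \<Rightarrow> (complex \<Rightarrow> complex) \<Rightarrow> (complex \<Rightarrow> complex \<Rightarrow> complex) \<Rightarrow> complex set \<Rightarrow>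
        (complex \<Rightarrow> complex) \<Rightarrow> real \<Rightarrow> bool" where
      "step n f D N A s \<longleftrightarrow> open N \<and> E n \<subseteq> N \<and> (\<forall>t\<in>N. (f has_derivative D t) (at t)) \<and>
      (\<forall>v. continuous_on N (\<lambda>t. D t v)) \<and> (\<forall>t\<in>E n. norm (f t - g t) \<le> e n) \<and>
      A \<in> borel_measurable borel \<and> (\<forall>x. norm (A x) \<le> K) \<and> (\<forall>x. x \<notin> cball t0 R \<longrightarrow> A x = 0) \<and>
      0 < s \<and> s \<le> 1 \<and>
      (\<forall>t\<in>E n. norm (D t 1 + \<i> * D t \<i>
          - 2 * ((\<integral>x. A x * of_real (cbump s (t - x)) \<partial>lborel) / of_real (cmass s)) * f t) \<le> 2 * e n * norm (f t))" for n f D N A s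
    have "\<forall>n. \<exists>f D N A s. step n f D N A s"
      unfolding step_def E_def e_def using dbar_approx_step[OF g ap assms(2)] by blast
    then obtain f D N A s where st: "\<And>n. step n (f n) (D n) (N n) (A n) (s n)"
      by metis
    note * = st[unfolded step_def]
    define u where "u n = cpot (s n) (A n)" for n
    have "\<exists>Du. (\<forall>z. (u n has_derivative Du z) (at z)) \<and> (\<forall>v. continuous_on UNIV (\<lambda>z. Du z v)) \<and>
     (\<forall>z. Du z 1 + \<i> * Du z \<i> = 2 * ((\<integral>x. A n x * of_real (cbump (s n) (z - x)) \<partial>lborel) / of_real (cmass (s n))))" for n
      unfolding u_def by (rule cpot_derivative[of "A n" K t0 R]) (use * in blast)+
    then have "\<forall>n. \<exists>Du. (\<forall>z. (u n has_derivative Du z) (at z)) \<and> (\<forall>v. continuous_on UNIV (\<lambda>z. Du z v)) \<and>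
     (\<forall>z. Du z 1 + \<i> * Du z \<i> = 2 * ((\<integral>x. A n x * of_real (cbump (s n) (z - x)) \<partial>lborel) / of_real (cmass (s n))))" ..
    from choice[OF this] obtain Du where Du: "\<And>n z. (u n has_derivative Du n z) (at z)" "\<And>n v. continuous_on UNIV (\<lambda>z. Du n z v)"
      "\<And>n z. Du n z 1 + \<i> * Du n z \<i> = 2 * ((\<integral>x. A n x * of_real (cbump (s n) (z - x)) \<partial>lborel) / of_real (cmass (s n)))"
      by blast
    have uM: "norm (u n z) \<le> M" if "z \<in> cball t0 R" for n z
      unfolding u_def using M[of "A n" t0 "s n"] * that by blast
    have uH: "norm (u n z - u n z') \<le> M * sqrt (norm (z - z'))" if "z \<in> cball t0 R" "z' \<in> cball t0 R" for n z z'
      unfolding u_def using M[of "A n" t0 "s n"] * that by blast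
    obtain U k where Uc: "continuous_on (cball t0 R) U" and k: "strict_mono (k :: nat \<Rightarrow> nat)"
      and lim: "\<And>\<epsilon>. 0 < \<epsilon> \<Longrightarrow> \<exists>N. \<forall>n x. n \<ge> N \<and> x \<in> cball t0 R \<longrightarrow> norm (u (k n) x - U x) < \<epsilon>"
    proof (rule Arzela_Ascoli[of "cball t0 R" u M])
      fix x \<epsilon> assume x: "x \<in> cball t0 R" and \<epsilon>: "(0::real) < \<epsilon>"
      show "\<exists>d>0. \<forall>n y. y \<in> cball t0 R \<and> norm (x - y) < d \<longrightarrow> norm (u n x - u n y) < \<epsilon>"
      \<comment> \<open>the inverse of the Hoelder modulus \<open>M * sqrt\<close>\<close>
      proof (intro exI[of _ "(\<epsilon> / (M + 1))\<^sup>2"] conjI allI impI)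
        show "0 < (\<epsilon> / (M + 1))\<^sup>2" using \<epsilon> M0 by simp
        fix n y assume y: "y \<in> cball t0 R \<and> norm (x - y) < (\<epsilon> / (M + 1))\<^sup>2"
        have "sqrt (norm (x - y)) < sqrt ((\<epsilon> / (M + 1))\<^sup>2)" using y by (simp only: real_sqrt_less_iff)
        also have "\<dots> = \<epsilon> / (M + 1)" using \<epsilon> M0 by simp
        finally have "M * sqrt (norm (x - y)) \<le> M * (\<epsilon> / (M + 1))" using M0 by (intro mult_left_mono) simp_all
        also have "\<dots> < \<epsilon>" using M0 \<epsilon> by (simp add: divide_simps)
        finally show "norm (u n x - u n y) < \<epsilon>" using uH[OF x, of y n] y by linarith
      qed
    qed (use uM in auto)
    have UM: "norm (U x) \<le> M" if x: "x \<in> cball t0 R" for x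
    proof (rule field_le_epsilon)
      fix \<epsilon> :: real assume "\<epsilon> > 0"
      then obtain N where "norm (u (k N) x - U x) < \<epsilon>" using lim[of \<epsilon>] x by blast
      then show "norm (U x) \<le> M + \<epsilon>" using uM[OF x, of "k N"] norm_triangle_ineq3[of "u (k N) x" "U x"] by linarith
    qed
    define h where "h t = g t * exp (- U t)" for t
    have hc: "continuous_on (cball t0 R) h" unfolding h_def[abs_def] by (intro continuous_intros g Uc)
    define W where "W = {t \<in> ball t0 R. h t \<noteq> 0}"
    have "continuous_on (ball t0 R) h" using hc ball_subset_cball continuous_on_subset by blast
    then have "open {z \<in> ball t0 R. h z \<in> - {0}}"
      using continuous_open_preimage[of "ball t0 R" h "-{0}"]
      by (simp add: vimage_def Int_def open_Compl)
    then have oW: "open W" by (simp add: W_def)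
    obtain G where G: "\<And>t. t \<in> cball t0 R \<Longrightarrow> norm (g t) \<le> G"
      using norm_bounded_on_compact[OF compact_cball g] by blast
    have G0: "G \<ge> 0" using G[of t0] assms(1) norm_ge_zero[of "g t0"] by (simp only: mem_cball dist_self) linarith
    have kn: "e (k n) \<le> e n" for n
      using seq_suble[OF k, of n] by (simp add: e_def frac_le)
    have e0: "e \<longlonglongrightarrow> 0" unfolding e_def[abs_def] by (rule lim_inverse_n'[THEN LIMSEQ_Suc])
    have epos: "e n > 0" for n by (simp add: e_def)
    have e1: "e n \<le> 1" for n by (simp add: e_def)
    have tri: "contour_integral (linepath a b) h + contour_integral (linepath b c) h + contour_integral (linepath c a) h = 0"
      if hull: "convex hull {a, b, c} \<subseteq> W" for a b c
    proof -
      define T where "T = convex hull {a, b, c}"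
      have cT: "compact T" unfolding T_def by (intro compact_convex_hull finite_imp_compact) simp
      have TW: "T \<subseteq> W" using hull by (simp add: T_def)
      have aT: "a \<in> T" by (simp add: T_def hull_inc)
      have TR: "T \<subseteq> cball t0 R" using TW by (auto simp: W_def)
      have gT: "continuous_on T g" using g TR continuous_on_subset by blast
      obtain x1 where x1: "x1 \<in> T" "\<And>x. x \<in> T \<Longrightarrow> norm (g x1) \<le> norm (g x)"
        using continuous_attains_inf[OF cT _ continuous_on_norm[OF gT]] aT by blast
      obtain x2 where x2: "x2 \<in> T" "\<And>x. x \<in> T \<Longrightarrow> dist t0 x \<le> dist t0 x2"
        using continuous_attains_sup[OF cT _ continuous_on_dist[OF continuous_on_const[of T t0] continuous_on_id]] aT by blast
      have "norm (g x1) > 0" using x1(1) TW by (auto simp: W_def h_def)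
      moreover have "R - dist t0 x2 > 0" using x2(1) TW by (auto simp: W_def)
      ultimately have "\<forall>\<^sub>F n in sequentially. e n < min (norm (g x1) / 2) (R - dist t0 x2)"
        by (intro order_tendstoD[OF e0]) simp
      then obtain n0 where n0: "\<And>n. n \<ge> n0 \<Longrightarrow> e n < min (norm (g x1) / 2) (R - dist t0 x2)"
        by (auto simp: eventually_sequentially)
      have TE: "T \<subseteq> E (k n)" if "n \<ge> n0" for n
      proof
        fix x assume x: "x \<in> T"
        show "x \<in> E (k n)"
          using x1(2)[OF x] x2(2)[OF x] n0[OF that] kn[of n] by (simp add: E_def)
      qed
      \<comment> \<open>almost holomorphic on the triangle, and uniformly convergent to \<open>h\<close>\<close>
      define F where "F n t = f (k n) t * exp (- u (k n) t)" for n t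
      define L where "L = (norm (b - a) + norm (c - a)) * norm (c - b)"
      have L0: "L \<ge> 0" by (simp add: L_def)
      have small: "norm (contour_integral (linepath a b) (F n) + contour_integral (linepath b c) (F n)
          + contour_integral (linepath c a) (F n)) \<le> (2 * e n * (G + 1) * exp M) * L" if n: "n \<ge> n0" for n
        unfolding L_def
      proof (rule norm_triangle_contour_le[where N = "N (k n)" and
            D = "\<lambda>t v. f (k n) t * (exp (- u (k n) t) * (- Du (k n) t v)) + D (k n) t v * exp (- u (k n) t)"])
        let ?m = "k n"
        show "convex hull {a, b, c} \<subseteq> N ?m" using TE[OF n] * unfolding T_def by blast
        show "open (N ?m)" using * by blast
        have fd: "(f ?m has_derivative D ?m t) (at t)" if "t \<in> N ?m" for t using * that by blast
        have "((\<lambda>t. exp (- u ?m t)) has_derivative (\<lambda>v. exp (- u ?m t) * (- Du ?m t v))) (at t)" for t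
          using has_derivative_compose[OF has_derivative_minus[OF Du(1)[of ?m t]] DERIV_exp[unfolded has_field_derivative_def]]
          by simp
        then show "(F n has_derivative (\<lambda>v. f ?m t * (exp (- u ?m t) * (- Du ?m t v)) + D ?m t v * exp (- u ?m t))) (at t)"
          if "t \<in> N ?m" for t
          unfolding F_def by (rule has_derivative_mult[OF fd[OF that]])
        have cf: "continuous_on (N ?m) (f ?m)"
          using fd by (meson continuous_at_imp_continuous_on has_derivative_continuous)
        have cu: "continuous_on (N ?m) (u ?m)"
          using Du(1) by (meson continuous_at_imp_continuous_on has_derivative_continuous)
        have cD: "continuous_on (N ?m) (\<lambda>t. D ?m t v)" for v using * by blast
        show "continuous_on (N ?m) (\<lambda>t. f ?m t * (exp (- u ?m t) * (- Du ?m t v)) + D ?m t v * exp (- u ?m t))" for v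
          by (intro continuous_intros cf cu cD continuous_on_subset[OF Du(2)]) simp
        fix t assume "t \<in> convex hull {a, b, c}"
        then have tE: "t \<in> E ?m" and tR: "t \<in> cball t0 R" using TE[OF n] TR by (auto simp: T_def)
        let ?I = "(\<integral>x. A ?m x * of_real (cbump (s ?m) (t - x)) \<partial>lborel) / of_real (cmass (s ?m))"
        have "f ?m t * (exp (- u ?m t) * (- Du ?m t 1)) + D ?m t 1 * exp (- u ?m t)
            + \<i> * (f ?m t * (exp (- u ?m t) * (- Du ?m t \<i>)) + D ?m t \<i> * exp (- u ?m t))
            = exp (- u ?m t) * (D ?m t 1 + \<i> * D ?m t \<i> - (Du ?m t 1 + \<i> * Du ?m t \<i>) * f ?m t)"
          by (simp add: algebra_simps)
        also have "\<dots> = exp (- u ?m t) * (D ?m t 1 + \<i> * D ?m t \<i> - 2 * ?I * f ?m t)"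
          unfolding Du(3) by simp
        also have "norm \<dots> \<le> exp M * (2 * e n * (G + 1))"
          unfolding norm_mult
        proof (rule mult_mono)
          show "norm (exp (- u ?m t)) \<le> exp M"
            using uM[OF tR, of ?m] abs_Re_le_cmod[of "u ?m t"] by simp
          have "norm (f ?m t - g t) \<le> e ?m" using * tE by blast
          then have "norm (f ?m t) \<le> G + 1"
            using norm_triangle_sub[of "f ?m t" "g t"] G[OF tR] e1[of ?m] by linarith
          then have "2 * e ?m * norm (f ?m t) \<le> 2 * e n * (G + 1)"
            using kn[of n] epos[of n] less_imp_le[OF epos[of "k n"]] by (intro mult_mono) simp_all
          moreover have "norm (D ?m t 1 + \<i> * D ?m t \<i> - 2 * ?I * f ?m t) \<le> 2 * e ?m * norm (f ?m t)"
            using * tE by blast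
          ultimately show "norm (D ?m t 1 + \<i> * D ?m t \<i> - 2 * ?I * f ?m t) \<le> 2 * e n * (G + 1)" by linarith
        qed simp_all
        finally show "norm (f ?m t * (exp (- u ?m t) * (- Du ?m t 1)) + D ?m t 1 * exp (- u ?m t)
            + \<i> * (f ?m t * (exp (- u ?m t) * (- Du ?m t \<i>)) + D ?m t \<i> * exp (- u ?m t))) \<le> 2 * e n * (G + 1) * exp M"
          by (simp add: mult_ac)
      qed
      have ul: "uniform_limit T F h sequentially"
      proof (rule uniform_limitI)
        fix \<epsilon> :: real assume \<epsilon>: "\<epsilon> > 0"
        define \<epsilon>' where "\<epsilon>' = \<epsilon> / (2 * exp M * (G + 1))"
        have \<epsilon>': "\<epsilon>' > 0" unfolding \<epsilon>'_def using \<epsilon> G0 by (intro divide_pos_pos mult_pos_pos) simp_all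
        obtain n1 where n1: "\<And>n x. n \<ge> n1 \<Longrightarrow> x \<in> cball t0 R \<Longrightarrow> norm (u (k n) x - U x) < \<epsilon>'"
          using lim[OF \<epsilon>'] by blast
        have "\<forall>\<^sub>F n in sequentially. e n < \<epsilon>'" by (intro order_tendstoD[OF e0] \<epsilon>')
        then obtain n2 where n2: "\<And>n. n \<ge> n2 \<Longrightarrow> e n < \<epsilon>'" by (auto simp: eventually_sequentially)
        have "dist (F n x) (h x) < \<epsilon>" if n: "n \<ge> max n0 (max n1 n2)" and x: "x \<in> T" for n x
        proof -
          have xR: "x \<in> cball t0 R" using x TR by blast
          have xE: "x \<in> E (k n)" using TE[of n] n x by auto
          have 1: "norm ((f (k n) x - g x) * exp (- u (k n) x)) \<le> e n * exp M"
            unfolding norm_mult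
          proof (rule mult_mono)
            have "norm (f (k n) x - g x) \<le> e (k n)" using * xE by blast
            then show "norm (f (k n) x - g x) \<le> e n" using kn[of n] by linarith
            show "norm (exp (- u (k n) x)) \<le> exp M"
              using uM[OF xR, of "k n"] abs_Re_le_cmod[of "u (k n) x"] by simp
          qed (use epos[of n] in simp_all)
          have 2: "norm (g x * (exp (- u (k n) x) - exp (- U x))) \<le> G * (exp M * norm (u (k n) x - U x))"
            unfolding norm_mult
          proof (rule mult_mono)
            have "norm (exp (- u (k n) x) - exp (- U x)) \<le> exp M * norm (- u (k n) x - - U x)"
              by (rule norm_exp_diff_le) (use uM[OF xR] UM[OF xR] in simp_all)
            also have "norm (- u (k n) x - - U x) = norm (u (k n) x - U x)"
              by (metis minus_diff_minus norm_minus_cancel)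
            finally show "norm (exp (- u (k n) x) - exp (- U x)) \<le> exp M * norm (u (k n) x - U x)" .
          qed (use G[OF xR] G0 in simp_all)
          have "F n x - h x = (f (k n) x - g x) * exp (- u (k n) x) + g x * (exp (- u (k n) x) - exp (- U x))"
            by (simp add: F_def h_def algebra_simps)
          then have "dist (F n x) (h x) \<le> e n * exp M + G * (exp M * norm (u (k n) x - U x))"
            unfolding dist_norm using norm_triangle_mono[OF 1 2] by simp
          also have "\<dots> \<le> \<epsilon>' * exp M + G * (exp M * \<epsilon>')"
            using n1[of n x] n2[of n] n xR G0 by (intro add_mono mult_left_mono mult_right_mono) simp_all
          also have "\<dots> = \<epsilon> / 2"
          proof -
            have "exp M * (G + 1) \<noteq> 0" using G0 by simp
            moreover have "\<epsilon>' * exp M + G * (exp M * \<epsilon>') = \<epsilon>' * (exp M * (G + 1))" by (simp add: algebra_simps)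
            moreover have "\<epsilon>' = (\<epsilon> / 2) / (exp M * (G + 1))" by (simp add: \<epsilon>'_def)
            ultimately show ?thesis by simp
          qed
          also have "\<dots> < \<epsilon>" using \<epsilon> by simp
          finally show ?thesis .
        qed
        then show "\<forall>\<^sub>F n in sequentially. \<forall>x\<in>T. dist (F n x) (h x) < \<epsilon>"
          unfolding eventually_sequentially by blast
      qed
      have seg: "closed_segment x y \<subseteq> T" if "x \<in> {a, b, c}" "y \<in> {a, b, c}" for x y
        unfolding T_def using that by (intro closed_segment_subset_convex_hull hull_inc)
      have Fc: "continuous_on T (F n)" if "n \<ge> n0" for n
      proof -
        have "T \<subseteq> N (k n)" using TE[OF that] * by blast
        moreover have "(f (k n) has_derivative D (k n) t) (at t)" if "t \<in> N (k n)" for t using * that by blast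
        ultimately have "continuous_on T (f (k n))"
          by (meson continuous_at_imp_continuous_on has_derivative_continuous subsetD)
        moreover have "continuous_on T (u (k n))"
          using Du(1) by (meson continuous_at_imp_continuous_on has_derivative_continuous)
        ultimately show ?thesis unfolding F_def[abs_def] by (intro continuous_intros)
      qed
      have conv: "(\<lambda>n. contour_integral (linepath x y) (F n)) \<longlonglongrightarrow> contour_integral (linepath x y) h"
        if xy: "x \<in> {a, b, c}" "y \<in> {a, b, c}" for x y
      proof (rule contour_integral_uniform_limit(2))
        show "\<forall>\<^sub>F n in sequentially. F n contour_integrable_on linepath x y"
          unfolding eventually_sequentially
          using Fc seg[OF xy] by (meson contour_integrable_continuous_linepath continuous_on_subset)
        show "uniform_limit (path_image (linepath x y)) F h sequentially"
          using uniform_limit_on_subset[OF ul seg[OF xy]] by simp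
        show "norm (vector_derivative (linepath x y) (at t)) \<le> norm (y - x)" for t by simp
      qed simp_all
      have "(\<lambda>n. contour_integral (linepath a b) (F n) + contour_integral (linepath b c) (F n)
          + contour_integral (linepath c a) (F n)) \<longlonglongrightarrow> 0"
      proof (rule Lim_null_comparison)
        show "\<forall>\<^sub>F n in sequentially. norm (contour_integral (linepath a b) (F n) + contour_integral (linepath b c) (F n)
          + contour_integral (linepath c a) (F n)) \<le> (2 * e n * (G + 1) * exp M) * L"
          unfolding eventually_sequentially using small by blast
        show "(\<lambda>n. (2 * e n * (G + 1) * exp M) * L) \<longlonglongrightarrow> 0"
          using e0 by (auto intro!: tendsto_eq_intros)
      qed
      moreover have "(\<lambda>n. contour_integral (linepath a b) (F n) + contour_integral (linepath b c) (F n)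
          + contour_integral (linepath c a) (F n)) \<longlonglongrightarrow>
          contour_integral (linepath a b) h + contour_integral (linepath b c) h + contour_integral (linepath c a) h"
        by (intro tendsto_add conv) simp_all
      ultimately show ?thesis using LIMSEQ_unique by blast
    qed
    have "h analytic_on W"
      by (rule Morera_triangle[OF _ oW])
         (use tri hc in \<open>auto simp: W_def intro: continuous_on_subset\<close>)
    then have "h holomorphic_on W" by (rule analytic_imp_holomorphic)
    then have "h holomorphic_on ball t0 R"
      using Rado[OF open_ball \<open>continuous_on (ball t0 R) h\<close>] by (simp add: W_def)
    moreover have "exp (- M) * norm (g t) \<le> norm (h t) \<and> norm (h t) \<le> exp M * norm (g t)" if t: "t \<in> ball t0 R" for t
    proof -
      have "\<bar>Re (U t)\<bar> \<le> M" using UM[of t] t abs_Re_le_cmod[of "U t"] by simp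
      then have "exp (- M) \<le> norm (exp (- U t))" "norm (exp (- U t)) \<le> exp M" by simp_all
      then show ?thesis
        unfolding h_def norm_mult
        using mult_right_mono[of "exp (- M)" "norm (exp (- U t))" "norm (g t)"]
          mult_right_mono[of "norm (exp (- U t))" "exp M" "norm (g t)"] by (simp add: mult.commute)
    qed
    ultimately show ?thesis by blast
  qed
  then show ?thesis using M0 by blast
qed

section \<open>Holomorphy along complex lines\<close>

lemma norm_vector_scalar_mult: "norm (c *s (v :: complex ^ 'n)) = norm c * norm v"
  by (simp add: norm_vec_def L2_set_right_distrib norm_mult)

lemma continuous_on_vector_scalar_mult [continuous_intros]:
  fixes c :: "'a::topological_space \<Rightarrow> complex" and v :: "'a \<Rightarrow> complex ^ 'n"
  assumes "continuous_on S c" "continuous_on S v"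
  shows "continuous_on S (\<lambda>x. c x *s v x)"
  unfolding vector_scalar_mult_def using assms by (intro continuous_intros)

text \<open>Together with continuity this is equivalent to holomorphy, and it is what the one-variable
  theorems deliver directly.\<close>

definition holo_along_lines :: "(complex ^ 'n) set \<Rightarrow> (complex ^ 'n \<Rightarrow> complex) \<Rightarrow> bool" where
  "holo_along_lines S G \<longleftrightarrow> (\<forall>z\<in>S. \<forall>v. (\<lambda>t. G (z + t *s v)) field_differentiable (at 0))"

lemma holo_along_linesD:
  assumes "holo_along_lines S G" "z + t *s v \<in> S"
  shows "(\<lambda>t. G (z + t *s v)) field_differentiable (at t)"
proof -
  have "(\<lambda>s. G ((z + t *s v) + s *s v)) field_differentiable (at 0)"
    using assms by (simp add: holo_along_lines_def)
  then obtain D where "((\<lambda>s. G ((z + t *s v) + s *s v)) has_field_derivative D) (at (t + - t))"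
    by (auto simp: field_differentiable_def)
  then have "((\<lambda>s. G ((z + t *s v) + (s + - t) *s v)) has_field_derivative D) (at t)"
    by (subst (asm) DERIV_shift)
  moreover have "(z + t *s v) + (s + - t) *s v = z + s *s v" for s
    by (simp add: vec_eq_iff algebra_simps)
  ultimately show ?thesis by (auto simp: field_differentiable_def)
qed

definition line_deriv :: "(complex ^ 'n \<Rightarrow> complex) \<Rightarrow> complex ^ 'n \<Rightarrow> complex ^ 'n \<Rightarrow> complex" where
  "line_deriv G z v = deriv (\<lambda>t. G (z + t *s v)) 0"

lemma has_line_deriv:
  assumes "holo_along_lines S G" "z + t *s v \<in> S"
  shows "((\<lambda>t. G (z + t *s v)) has_field_derivative line_deriv G (z + t *s v) v) (at t)"
proof -
  have "(\<lambda>s. G ((z + t *s v) + s *s v)) field_differentiable (at (t + - t))"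
    using assms by (simp add: holo_along_lines_def)
  then have "((\<lambda>s. G ((z + t *s v) + s *s v)) has_field_derivative line_deriv G (z + t *s v) v) (at (t + - t))"
    unfolding line_deriv_def by (simp add: DERIV_deriv_iff_field_differentiable)
  then have "((\<lambda>s. G ((z + t *s v) + (s + - t) *s v)) has_field_derivative line_deriv G (z + t *s v) v) (at t)"
    by (subst (asm) DERIV_shift)
  moreover have "(z + t *s v) + (s + - t) *s v = z + s *s v" for s
    by (simp add: vec_eq_iff algebra_simps)
  ultimately show ?thesis by simp
qed

text \<open>Cauchy's inequality bounds the difference of two directional derivatives by the difference of the
  function on two nearby discs.\<close>

lemma continuous_on_line_deriv:
  fixes G :: "complex ^ 'n \<Rightarrow> complex"
  assumes S: "open S" and G: "continuous_on S G" and H: "holo_along_lines S G"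
  shows "continuous_on S (\<lambda>z. line_deriv G z v)"
  unfolding continuous_on_iff
proof (intro ballI allI impI)
  fix z and e :: real assume z: "z \<in> S" and e: "e > 0"
  obtain d where d: "d > 0" "cball z d \<subseteq> S" using S z by (meson open_contains_cball)
  define r where "r = d / (2 * (norm v + 1))"
  have nv: "norm v + 1 > 0" by (simp add: add_nonneg_pos)
  have r0: "r > 0" using d(1) nv by (simp add: r_def)
  have "r * norm v \<le> r * (norm v + 1)" using r0 by (intro mult_left_mono) simp_all
  also have "\<dots> = d / 2" using nv by (simp add: r_def divide_simps)
  finally have r: "r > 0" "r * norm v \<le> d / 2" using r0 by simp_all
  have unif: "uniformly_continuous_on (cball z d) G"
    using G d by (intro compact_uniformly_continuous) (auto intro: continuous_on_subset)
  have "e / 2 * r > 0" using e r by simp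
  then obtain \<delta> where \<delta>: "\<delta> > 0" "\<And>x y. x \<in> cball z d \<Longrightarrow> y \<in> cball z d \<Longrightarrow> dist y x < \<delta> \<Longrightarrow> dist (G y) (G x) < e / 2 * r"
    using unif unfolding uniformly_continuous_on_def by metis
  have "dist (line_deriv G y v) (line_deriv G z v) < e" if y: "dist y z < min \<delta> (d / 2)" for y
  proof -
    have inb: "z + t *s v \<in> cball z d" "y + t *s v \<in> cball z d" if "t \<in> cball 0 r" for t
    proof -
      have "norm (t *s v) \<le> r * norm v" using that by (simp add: norm_vector_scalar_mult mult_right_mono)
      then have n: "norm (t *s v) \<le> d / 2" using r by linarith
      then show "z + t *s v \<in> cball z d" using d(1) by (simp add: dist_norm)
      have "dist z (y + t *s v) \<le> dist z y + norm (t *s v)"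
        using dist_triangle[of z "y + t *s v" y] by (simp add: dist_norm)
      then show "y + t *s v \<in> cball z d" using n y by (simp add: dist_commute)
    qed
    define D where "D t = G (y + t *s v) - G (z + t *s v)" for t
    have Dd: "(D has_field_derivative line_deriv G (y + t *s v) v - line_deriv G (z + t *s v) v) (at t)"
      if "t \<in> cball 0 r" for t
      unfolding D_def[abs_def] using inb[OF that] d(2)
      by (intro DERIV_diff has_line_deriv[OF H]) auto
    have Dh: "D holomorphic_on cball 0 r"
      unfolding holomorphic_on_def field_differentiable_def
      using Dd has_field_derivative_at_within by blast
    have "norm ((deriv ^^ 1) D 0) \<le> fact 1 * (e / 2 * r) / r ^ 1"
    proof (rule Cauchy_inequality)
      show "D holomorphic_on ball 0 r" using Dh ball_subset_cball holomorphic_on_subset by blast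
      show "continuous_on (cball 0 r) D" by (rule holomorphic_on_imp_continuous_on[OF Dh])
      fix t :: complex assume "norm (0 - t) = r"
      then have t: "t \<in> cball 0 r" by simp
      have "dist (G (y + t *s v)) (G (z + t *s v)) < e / 2 * r"
        by (rule \<delta>(2)[OF inb[OF t]]) (use y in \<open>simp add: dist_norm\<close>)
      then show "norm (D t) \<le> e / 2 * r" by (simp add: D_def dist_norm)
    qed (use r in auto)
    moreover have "deriv D 0 = line_deriv G y v - line_deriv G z v"
      using DERIV_imp_deriv[OF Dd[of 0]] r by simp
    ultimately show ?thesis using r e by (simp add: dist_norm)
  qed
  then show "\<exists>d>0. \<forall>x'\<in>S. dist x' z < d \<longrightarrow> dist (line_deriv G x' v) (line_deriv G z v) < e"
    using \<delta>(1) d(1) by (intro exI[of _ "min \<delta> (d / 2)"]) auto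
qed

text \<open>The increment is decomposed into changes of one coordinate at a time; along each of them the
  mean value inequality applies, because the directional derivatives are continuous.\<close>

theorem Osgood:
  fixes G :: "complex ^ 'n \<Rightarrow> complex"
  assumes S: "open S" and G: "continuous_on S G" and H: "holo_along_lines S G" and z: "z \<in> S"
  shows "(G has_derivative (\<lambda>h. \<Sum>j\<in>UNIV. line_deriv G z (axis j 1) * h $ j)) (at z)"
proof -
  define L where "L h = (\<Sum>j\<in>UNIV. line_deriv G z (axis j 1) * h $ j)" for h
  have "linear L"
    unfolding L_def
    by (rule linearI) (simp_all add: distrib_left sum.distrib scaleR_sum_right)
  then have bl: "bounded_linear L" by (simp add: linear_conv_bounded_linear)
  have "\<exists>\<delta>>0. \<forall>y. norm (y - z) < \<delta> \<longrightarrow> norm (G y - G z - L (y - z)) \<le> e * norm (y - z)" if e: "e > 0" for e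
  proof -
    define e' where "e' = e / real CARD('n)"
    have e': "e' > 0" using e by (simp add: e'_def)
    obtain d where d: "d > 0" "ball z d \<subseteq> S" using S z by (meson open_contains_ball)
    have "\<exists>\<delta>>0. \<forall>x\<in>S. dist x z < \<delta> \<longrightarrow> dist (line_deriv G x (axis j 1)) (line_deriv G z (axis j 1)) < e'" for j
      using continuous_on_line_deriv[OF S G H, of "axis j 1"] z e' unfolding continuous_on_iff by blast
    then obtain \<delta>j where \<delta>j: "\<And>j. \<delta>j j > 0"
      "\<And>j x. x \<in> S \<Longrightarrow> dist x z < \<delta>j j \<Longrightarrow> dist (line_deriv G x (axis j 1)) (line_deriv G z (axis j 1)) < e'"
      by metis
    define \<delta> where "\<delta> = min d (Min (range \<delta>j))"
    have \<delta>: "\<delta> > 0" "\<delta> \<le> d" "\<And>j. \<delta> \<le> \<delta>j j"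
      using d(1) \<delta>j(1) by (auto simp: \<delta>_def min.coboundedI2)
    have main: "norm (G (z + h) - G z - L h) \<le> e * norm h" if h: "norm h < \<delta>" for h
    proof -
      \<comment> \<open>the increment with only the coordinates in \<open>J\<close> changed\<close>
      define P where "P J = (\<chi> j. if j \<in> J then h $ j else 0)" for J
      have near: "norm (P J + t *s axis k 1) \<le> norm h" if "k \<notin> J" "norm t \<le> norm (h $ k)" for J and k :: 'n and t :: complex
        unfolding norm_vec_def
      proof (rule L2_set_mono)
        fix i
        show "norm ((P J + t *s axis k 1) $ i) \<le> norm (h $ i)"
          using that by (auto simp: P_def axis_def)
      qed auto
      have "norm (G (z + P J) - G z - (\<Sum>j\<in>J. line_deriv G z (axis j 1) * h $ j)) \<le> (\<Sum>j\<in>J. e' * norm (h $ j))"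
        if "finite J" for J :: "'n set"
        using that
      proof (induction J rule: finite_induct)
        case empty
        have "P {} = 0" by (simp add: P_def vec_eq_iff)
        then show ?case by simp
      next
        case (insert k J)
        define x where "x = z + P J"
        define Q where "Q t = G (x + t *s axis k 1) - line_deriv G z (axis k 1) * t" for t
        have xin: "x + t *s axis k 1 \<in> S" "dist (x + t *s axis k 1) z < \<delta>j k" if "norm t \<le> norm (h $ k)" for t :: complex
        proof -
          have "dist (x + t *s axis k 1) z = norm (P J + t *s axis k 1)" by (simp add: x_def dist_norm algebra_simps)
          then have *: "dist (x + t *s axis k 1) z < \<delta>" using near[OF insert.hyps(2) that] h by linarith
          then have "x + t *s axis k 1 \<in> ball z d" using \<delta>(2) by (simp add: dist_commute)
          then show "x + t *s axis k 1 \<in> S" using d(2) by blast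
          show "dist (x + t *s axis k 1) z < \<delta>j k" using * \<delta>(3)[of k] by linarith
        qed
        have Pk: "z + P (insert k J) = x + (h $ k) *s axis k 1"
          using insert.hyps(2) by (auto simp: x_def P_def vec_eq_iff axis_def)
        have "norm (Q (h $ k) - Q 0) \<le> e' * norm (h $ k - 0)"
        proof (rule field_differentiable_bound[of "cball 0 (norm (h $ k))" Q
              "\<lambda>t. line_deriv G (x + t *s axis k 1) (axis k 1) - line_deriv G z (axis k 1)"])
          fix t :: complex assume "t \<in> cball 0 (norm (h $ k))"
          then have t: "norm t \<le> norm (h $ k)" by simp
          have "(Q has_field_derivative line_deriv G (x + t *s axis k 1) (axis k 1) - line_deriv G z (axis k 1)) (at t)"
            unfolding Q_def[abs_def]
            by (rule DERIV_diff[OF has_line_deriv[OF H xin(1)[OF t]]]) (auto intro!: derivative_eq_intros)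
          then show "(Q has_field_derivative line_deriv G (x + t *s axis k 1) (axis k 1) - line_deriv G z (axis k 1)) (at t within cball 0 (norm (h $ k)))"
            by (rule has_field_derivative_at_within)
          show "norm (line_deriv G (x + t *s axis k 1) (axis k 1) - line_deriv G z (axis k 1)) \<le> e'"
            using \<delta>j(2)[OF xin[OF t]] by (simp add: dist_norm)
        qed auto
        moreover have "Q (h $ k) - Q 0 = G (z + P (insert k J)) - G (z + P J) - line_deriv G z (axis k 1) * h $ k"
          unfolding Pk by (simp add: Q_def x_def)
        ultimately have "norm (G (z + P (insert k J)) - G (z + P J) - line_deriv G z (axis k 1) * h $ k) \<le> e' * norm (h $ k)"
          by simp
        from norm_triangle_mono[OF this insert.IH]
        show ?case using insert.hyps by (simp add: algebra_simps)
      qed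
      from this[of UNIV] have "norm (G (z + P UNIV) - G z - L h) \<le> (\<Sum>j\<in>UNIV. e' * norm (h $ j))"
        by (simp add: L_def)
      also have "\<dots> \<le> (\<Sum>j\<in>(UNIV::'n set). e' * norm h)"
        using e' by (intro sum_mono mult_left_mono Finite_Cartesian_Product.norm_nth_le) auto
      also have "\<dots> = e * norm h" by (simp add: e'_def)
      also have "P UNIV = h" by (simp add: P_def vec_eq_iff)
      finally show ?thesis .
    qed
    show ?thesis
      using main[of "y - z" for y] \<delta>(1) by (intro exI[of _ \<delta>]) auto
  qed
  then show ?thesis
    using bl unfolding has_derivative_at_alt L_def[symmetric] by blast
qed

lemma holomorphic_Cn_if_holo_along_lines:
  fixes G :: "complex ^ 'n \<Rightarrow> complex"
  assumes "open S" "continuous_on S G" "holo_along_lines S G"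
  shows "holomorphic_Cn S G"
  unfolding holomorphic_Cn_def
proof
  fix z assume "z \<in> S"
  then show "\<exists>D. (G has_derivative D) (at z) \<and> (\<forall>c v. D (c *s v) = c * D v)"
    using Osgood[OF assms] by (intro exI conjI) (auto simp: sum_distrib_left mult_ac)
qed

section \<open>A smooth mollifier\<close>

text \<open>The classical smooth function that vanishes to infinite order at the origin, together with its
  products by powers of \<open>1 / x\<close>, which make the family closed under differentiation up to sums.\<close>

definition flat :: "nat \<Rightarrow> real \<Rightarrow> real" where
  "flat j x = (if x \<le> 0 then 0 else exp (- inverse x) * inverse x ^ j)"

lemma flat_nonneg: "flat j x \<ge> 0" by (simp add: flat_def)

lemma flat_tendsto_0: "((flat j) \<longlongrightarrow> 0) (at 0)"
proof -
  have "((\<lambda>y. y ^ j / exp y) \<longlongrightarrow> (0::real)) at_top" by (rule tendsto_power_div_exp_0)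
  then have "((\<lambda>x. inverse x ^ j / exp (inverse x)) \<longlongrightarrow> (0::real)) (at_right 0)"
    by (rule filterlim_compose[OF _ filterlim_inverse_at_top_right])
  then have r: "(flat j \<longlongrightarrow> 0) (at_right 0)"
  proof (rule Lim_transform_eventually)
    show "\<forall>\<^sub>F x in at_right 0. inverse x ^ j / exp (inverse x) = flat j x"
      unfolding eventually_at_filter
      by (intro always_eventually) (auto simp: flat_def exp_minus divide_inverse)
  qed
  have "((\<lambda>x. 0) \<longlongrightarrow> (0::real)) (at_left 0)" by simp
  then have l: "(flat j \<longlongrightarrow> 0) (at_left 0)"
  proof (rule Lim_transform_eventually)
    show "\<forall>\<^sub>F x in at_left 0. 0 = flat j x"
      unfolding eventually_at_filter by (intro always_eventually) (auto simp: flat_def)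
  qed
  show ?thesis using l r by (simp add: filterlim_split_at)
qed

lemma flat_has_derivative:
  "(flat j has_real_derivative flat (j + 2) x - real j * flat (j + 1) x) (at x)"
proof -
  consider "x < 0" | "x = 0" | "x > 0" by linarith
  then show ?thesis
  proof cases
    case 1
    have "((\<lambda>_. 0) has_real_derivative 0) (at x)" by simp
    then have "(flat j has_real_derivative 0) (at x)"
      by (rule DERIV_cong_ev[THEN iffD1, rotated 3, OF _ refl _ refl])
         (use 1 in \<open>auto simp: flat_def eventually_nhds intro!: exI[of _ "{..<0}"]\<close>)
    then show ?thesis using 1 by (simp add: flat_def)
  next
    case 2
    have "((\<lambda>h. (flat j (0 + h) - flat j 0) / h) \<longlongrightarrow> 0) (at 0)"
    proof (rule Lim_transform_eventually[OF flat_tendsto_0[of "j + 1"]])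
      show "\<forall>\<^sub>F h in at 0. flat (j + 1) h = (flat j (0 + h) - flat j 0) / h"
        by (intro always_eventually allI) (simp add: flat_def divide_inverse mult_ac)
    qed
    then show ?thesis using 2 by (simp add: DERIV_def flat_def)
  next
    case 3
    have "((\<lambda>x. exp (- inverse x) * inverse x ^ j) has_real_derivative
        exp (- inverse x) * (inverse x)\<^sup>2 * inverse x ^ j
        + exp (- inverse x) * (real j * inverse x ^ (j - 1) * (- (inverse x)\<^sup>2))) (at x)"
      using 3 by (auto intro!: derivative_eq_intros simp: power2_eq_square)
    moreover have jeq: "real j * inverse x ^ (j - 1) * (- (inverse x)\<^sup>2) = - (real j * inverse x ^ (j + 1))"
      by (cases j) (simp_all add: power2_eq_square)
    have "exp (- inverse x) * (inverse x)\<^sup>2 * inverse x ^ j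
        + exp (- inverse x) * (real j * inverse x ^ (j - 1) * (- (inverse x)\<^sup>2))
        = exp (- inverse x) * inverse x ^ (j + 2) - real j * (exp (- inverse x) * inverse x ^ (j + 1))"
      unfolding jeq power_add by simp
    ultimately have "((\<lambda>x. exp (- inverse x) * inverse x ^ j) has_real_derivative
        exp (- inverse x) * inverse x ^ (j + 2) - real j * (exp (- inverse x) * inverse x ^ (j + 1))) (at x)"
      by (rule DERIV_cong)
    then have "(flat j has_real_derivative
        exp (- inverse x) * inverse x ^ (j + 2) - real j * (exp (- inverse x) * inverse x ^ (j + 1))) (at x)"
      by (rule DERIV_cong_ev[THEN iffD1, rotated 3, OF _ refl _ refl])
         (use 3 in \<open>auto simp: flat_def eventually_nhds intro!: exI[of _ "{0<..}"]\<close>)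
    then show ?thesis using 3 by (simp add: flat_def)
  qed
qed

text \<open>A class of functions that contains the mollifier and is closed under directional derivatives, so
  that all of its members have all derivatives.\<close>

inductive bumpy :: "'a::euclidean_space \<Rightarrow> real \<Rightarrow> ('a \<Rightarrow> complex) \<Rightarrow> bool" for z r where
  base: "bumpy z r (\<lambda>x. of_real (flat j (r - (x - z) \<bullet> (x - z))))"
| inner: "bumpy z r f \<Longrightarrow> bumpy z r (\<lambda>x. of_real ((x - z) \<bullet> v) * f x)"
| scale: "bumpy z r f \<Longrightarrow> bumpy z r (\<lambda>x. of_real c * f x)"
| add: "bumpy z r f \<Longrightarrow> bumpy z r g \<Longrightarrow> bumpy z r (\<lambda>x. f x + g x)"

lemma bumpy_derivative:
  "bumpy z r f \<Longrightarrow> \<exists>f'. (\<forall>x. (f has_derivative f' x) (at x)) \<and> (\<forall>v. bumpy z r (\<lambda>x. f' x v))"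
proof (induction rule: bumpy.induct)
  case (base j)
  define N where "N x = r - (x - z) \<bullet> (x - z)" for x
  define f' where "f' x v = complex_of_real ((flat (j + 2) (N x) - real j * flat (j + 1) (N x)) * (- (2 * ((x - z) \<bullet> v))))" for x v
  have "((\<lambda>x. complex_of_real (flat j (N x))) has_derivative f' x) (at x)" for x
  proof -
    have "(N has_derivative (\<lambda>v. - (2 * ((x - z) \<bullet> v)))) (at x)"
      unfolding N_def[abs_def] by (auto intro!: derivative_eq_intros simp: inner_commute)
    from has_derivative_compose[OF this flat_has_derivative[of j "N x", unfolded has_field_derivative_def]]
    show ?thesis unfolding f'_def by (intro has_derivative_of_real)
  qed
  moreover have "bumpy z r (\<lambda>x. f' x v)" for v
  proof -
    have "(\<lambda>x. f' x v) = (\<lambda>x. of_real (-2) * (of_real ((x - z) \<bullet> v) * of_real (flat (j + 2) (r - (x - z) \<bullet> (x - z))))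
        + of_real (2 * real j) * (of_real ((x - z) \<bullet> v) * of_real (flat (j + 1) (r - (x - z) \<bullet> (x - z)))))"
      by (simp add: fun_eq_iff f'_def N_def algebra_simps)
    then show ?thesis by (simp only:) (intro bumpy.intros)
  qed
  ultimately show ?case unfolding N_def by blast
next
  case (inner f v)
  then obtain f' where f': "\<And>x. (f has_derivative f' x) (at x)" "\<And>v. bumpy z r (\<lambda>x. f' x v)" by blast
  have "((\<lambda>x. of_real ((x - z) \<bullet> v) * f x) has_derivative
      (\<lambda>w. of_real ((x - z) \<bullet> v) * f' x w + of_real (w \<bullet> v) * f x)) (at x)" for x
    by (rule has_derivative_mult[OF has_derivative_of_real f'(1)]) (auto intro!: derivative_eq_intros)
  moreover have "bumpy z r (\<lambda>x. of_real ((x - z) \<bullet> v) * f' x w + of_real (w \<bullet> v) * f x)" for w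
    by (intro bumpy.intros f' inner.hyps)
  ultimately show ?case
    by (intro exI[of _ "\<lambda>x w. of_real ((x - z) \<bullet> v) * f' x w + of_real (w \<bullet> v) * f x"]) simp
next
  case (scale f c)
  then obtain f' where f': "\<And>x. (f has_derivative f' x) (at x)" "\<And>v. bumpy z r (\<lambda>x. f' x v)" by blast
  have "((\<lambda>x. of_real c * f x) has_derivative (\<lambda>w. of_real c * f' x w)) (at x)" for x
    by (rule has_derivative_mult_right[OF f'(1)])
  moreover have "bumpy z r (\<lambda>x. of_real c * f' x w)" for w by (intro bumpy.intros f')
  ultimately show ?case by (intro exI[of _ "\<lambda>x w. of_real c * f' x w"]) simp
next
  case (add f g)
  then obtain f' g' where f': "\<And>x. (f has_derivative f' x) (at x)" "\<And>v. bumpy z r (\<lambda>x. f' x v)"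
    and g': "\<And>x. (g has_derivative g' x) (at x)" "\<And>v. bumpy z r (\<lambda>x. g' x v)" by blast
  have "((\<lambda>x. f x + g x) has_derivative (\<lambda>w. f' x w + g' x w)) (at x)" for x
    by (rule has_derivative_add[OF f'(1) g'(1)])
  moreover have "bumpy z r (\<lambda>x. f' x w + g' x w)" for w by (intro bumpy.intros f' g')
  ultimately show ?case by (intro exI[of _ "\<lambda>x w. f' x w + g' x w"]) simp
qed

lemma bumpy_C_k: "bumpy z r f \<Longrightarrow> C_k k UNIV f"
proof (induction k arbitrary: f)
  case 0
  obtain f' where "\<And>x. (f has_derivative f' x) (at x)" using bumpy_derivative[OF 0] by blast
  then show ?case
    by (metis C_k.simps(1) continuous_at_imp_continuous_on has_derivative_continuous)
next
  case (Suc k)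
  obtain f' where f': "\<And>x. (f has_derivative f' x) (at x)" "\<And>v. bumpy z r (\<lambda>x. f' x v)"
    using bumpy_derivative[OF Suc.prems] by blast
  have "frechet_derivative f (at x) = f' x" for x using frechet_derivative_at[OF f'(1)] by simp
  then show ?case using f' Suc.IH by (auto simp: differentiable_def)
qed

definition moll :: "real \<Rightarrow> 'a::euclidean_space \<Rightarrow> real" where
  "moll \<epsilon> x = flat 0 (\<epsilon>\<^sup>2 - x \<bullet> x)"

lemma moll_nonneg: "moll \<epsilon> x \<ge> 0" by (simp add: moll_def flat_nonneg)

lemma moll_zero: "norm x \<ge> \<epsilon> \<Longrightarrow> \<epsilon> > 0 \<Longrightarrow> moll \<epsilon> x = 0"
  by (simp add: moll_def flat_def power2_norm_eq_inner[symmetric] power_mono)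

lemma moll_pos: "norm x < \<epsilon> \<Longrightarrow> moll \<epsilon> x > 0"
proof -
  assume "norm x < \<epsilon>"
  then have "(norm x)\<^sup>2 < \<epsilon>\<^sup>2" by (intro power_strict_mono) auto
  then show ?thesis by (simp add: moll_def flat_def power2_norm_eq_inner)
qed

lemma moll_derivative:
  fixes \<epsilon> :: real
  shows "\<exists>m'. (\<forall>x::'a::euclidean_space. ((\<lambda>x. complex_of_real (moll \<epsilon> x)) has_derivative m' x) (at x)) \<and>
     (\<forall>v. continuous_on UNIV (\<lambda>x. m' x v))"
proof -
  have b: "bumpy (0::'a) (\<epsilon>\<^sup>2) (\<lambda>x. complex_of_real (moll \<epsilon> x))"
    using bumpy.base[of 0 "\<epsilon>\<^sup>2" 0] by (simp add: moll_def)
  obtain m' where m': "\<And>x::'a. ((\<lambda>x. complex_of_real (moll \<epsilon> x)) has_derivative m' x) (at x)" "\<And>v. bumpy 0 (\<epsilon>\<^sup>2) (\<lambda>x. m' x v)"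
    using bumpy_derivative[OF b] by blast
  have "continuous_on UNIV (\<lambda>x. m' x v)" for v
    using bumpy_C_k[OF m'(2)[of v], of 0] by simp
  then show ?thesis using m'(1) by blast
qed

lemma moll_continuous: "continuous_on S (moll \<epsilon>)"
proof -
  obtain m' where "\<And>x::'a. ((\<lambda>x. complex_of_real (moll \<epsilon> x)) has_derivative m' x) (at x)"
    using moll_derivative by blast
  then have "continuous_on S (\<lambda>x. complex_of_real (moll \<epsilon> x))"
    by (meson continuous_at_imp_continuous_on has_derivative_continuous)
  then show ?thesis by (simp add: continuous_on_of_real_o_iff o_def)
qed

lemma moll_integral_pos:
  assumes "\<epsilon> > 0"
  shows "integrable lborel (moll \<epsilon> :: 'a::euclidean_space \<Rightarrow> real)" "(\<integral>x. moll \<epsilon> (x::'a) \<partial>lborel) > 0"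
proof -
  have eq: "indicator (cball 0 \<epsilon>) x *\<^sub>R moll \<epsilon> x = moll \<epsilon> x" for x :: 'a
    using moll_zero[of \<epsilon> x] assms by (cases "x \<in> cball 0 \<epsilon>") auto
  show i: "integrable lborel (moll \<epsilon> :: 'a \<Rightarrow> real)"
    using borel_integrable_compact[OF compact_cball moll_continuous[of "cball (0::'a) \<epsilon>" \<epsilon>]]
    by (rule Bochner_Integration.integrable_cong[THEN iffD1, OF refl eq])
  have "(\<integral>x. moll \<epsilon> (x::'a) \<partial>lborel) \<noteq> 0"
  proof
    assume "(\<integral>x. moll \<epsilon> (x::'a) \<partial>lborel) = 0"
    then have "AE x in lborel. moll \<epsilon> (x::'a) = 0"
      using integral_nonneg_eq_0_iff_AE[OF i AE_I2] moll_nonneg by metis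
    then have "AE x in lborel. (x::'a) \<notin> ball 0 \<epsilon>"
      by eventually_elim (use moll_pos in force)
    moreover have seteq: "{x \<in> space lborel. \<not> x \<notin> ball (0::'a) \<epsilon>} = ball 0 \<epsilon>" by auto
    ultimately have "emeasure lborel (ball (0::'a) \<epsilon>) = 0"
      using AE_iff_measurable[OF _ seteq] by (metis borel_open open_ball sets_lborel)
    moreover have "emeasure lborel (ball (0::'a) \<epsilon>) > 0"
      using assms content_ball_pos[of \<epsilon> "0::'a"] emeasure_eq_ennreal_measure[of lborel "ball (0::'a) \<epsilon>"]
        emeasure_lborel_ball_finite[of "0::'a" \<epsilon>] by (simp add: less_top)
    ultimately show False by simp
  qed
  moreover have "(\<integral>x. moll \<epsilon> (x::'a) \<partial>lborel) \<ge> 0" by (intro integral_nonneg_AE AE_I2 moll_nonneg)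
  ultimately show "(\<integral>x. moll \<epsilon> (x::'a) \<partial>lborel) > 0" by linarith
qed

lemma test_function_moll:
  fixes z :: "complex ^ 'n"
  assumes "\<epsilon> > 0" "cball z \<epsilon> \<subseteq> U"
  shows "test_function U (\<lambda>x. complex_of_real (moll \<epsilon> (z - x)))"
  unfolding test_function_def
proof (intro conjI allI)
  have eq: "(\<lambda>x. complex_of_real (moll \<epsilon> (z - x))) = (\<lambda>x. of_real (flat 0 (\<epsilon>\<^sup>2 - (x - z) \<bullet> (x - z))))"
    by (simp add: moll_def fun_eq_iff power2_norm_eq_inner[symmetric] norm_minus_commute)
  show "C_k k UNIV (\<lambda>x. complex_of_real (moll \<epsilon> (z - x)))" for k
    unfolding eq by (rule bumpy_C_k[OF bumpy.base])
  have "{x. complex_of_real (moll \<epsilon> (z - x)) \<noteq> 0} \<subseteq> cball z \<epsilon>"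
    using moll_zero[of \<epsilon>] assms(1) by (force simp: dist_norm)
  then have cl: "closure {x. complex_of_real (moll \<epsilon> (z - x)) \<noteq> 0} \<subseteq> cball z \<epsilon>"
    by (rule closure_minimal) simp
  then show "compact (closure {x. complex_of_real (moll \<epsilon> (z - x)) \<noteq> 0})"
    by (meson bounded_cball bounded_subset closed_closure compact_eq_bounded_closed)
  show "closure {x. complex_of_real (moll \<epsilon> (z - x)) \<noteq> 0} \<subseteq> U" using cl assms(2) by blast
qed

section \<open>Mollification and restriction to holomorphic curves\<close>

lemma linear_axis_decompose:
  fixes D :: "complex ^ 'n \<Rightarrow> complex"
  assumes "linear D"
  shows "D v = (\<Sum>j\<in>UNIV. of_real (Re (v $ j)) * D (axis j 1) + of_real (Im (v $ j)) * D (axis j \<i>))"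
proof -
  have "v = (\<Sum>j\<in>UNIV. Re (v $ j) *\<^sub>R axis j 1 + Im (v $ j) *\<^sub>R axis j \<i>)"
  proof (subst vec_eq_iff, rule allI)
    fix i
    have "(Re (v $ j) *\<^sub>R axis j 1 + Im (v $ j) *\<^sub>R axis j \<i>) $ i = (if j = i then v $ i else 0)" for j
      by (auto simp: axis_def complex_eq_iff)
    then have "(\<Sum>j\<in>UNIV. Re (v $ j) *\<^sub>R axis j 1 + Im (v $ j) *\<^sub>R axis j \<i>) $ i
        = (\<Sum>j\<in>UNIV. if j = i then v $ i else 0)"
      by (simp only: sum_component)
    then show "v $ i = (\<Sum>j\<in>UNIV. Re (v $ j) *\<^sub>R axis j 1 + Im (v $ j) *\<^sub>R axis j \<i>) $ i" by simp
  qed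
  then have "D v = D (\<Sum>j\<in>UNIV. Re (v $ j) *\<^sub>R axis j 1 + Im (v $ j) *\<^sub>R axis j \<i>)" by simp
  also have "\<dots> = (\<Sum>j\<in>UNIV. Re (v $ j) *\<^sub>R D (axis j 1) + Im (v $ j) *\<^sub>R D (axis j \<i>))"
    by (simp only: linear_sum[OF assms] linear_add[OF assms] linear_scale[OF assms])
  finally show ?thesis by (simp add: scaleR_conv_of_real)
qed

lemma norm_sum_mult_vec_le:
  fixes v w :: "complex ^ 'n"
  shows "norm (\<Sum>j\<in>UNIV. v $ j * w $ j) \<le> norm v * norm w"
proof -
  have "norm (\<Sum>j\<in>UNIV. v $ j * w $ j) \<le> (\<Sum>j\<in>UNIV. \<bar>norm (v $ j)\<bar> * \<bar>norm (w $ j)\<bar>)"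
    by (rule order_trans[OF norm_sum]) (simp add: norm_mult)
  also have "\<dots> \<le> L2_set (\<lambda>j. norm (v $ j)) UNIV * L2_set (\<lambda>j. norm (w $ j)) UNIV"
    by (rule L2_set_mult_ineq)
  finally show ?thesis by (simp add: norm_vec_def)
qed

text \<open>The translated mollifier is a test function, so the coefficients of the left-hand side are
  the components of the vector \<open>- \<integral> f * \<phi> *s A\<close>, whose norm is bounded by the integral of norms.\<close>

lemma weak_dbar_mollified_bound:
  fixes f :: "complex ^ 'n \<Rightarrow> complex"
  assumes U: "open U" and f: "continuous_on U f" and d: "dbar_le U f K" and K: "K \<ge> 0"
    and \<epsilon>: "\<epsilon> > 0" and z: "cball z \<epsilon> \<subseteq> U" and S: "\<And>x. x \<in> cball z \<epsilon> \<Longrightarrow> norm (f x) \<le> S"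
  shows "norm (\<Sum>j\<in>UNIV. (LINT x|lebesgue_on U. f x * dbar j (\<lambda>x. of_real (moll \<epsilon> (z - x))) x) * w $ j)
         \<le> K * S * (\<integral>x. moll \<epsilon> (x :: complex ^ 'n) \<partial>lborel) * norm w"
proof -
  define \<phi> where "\<phi> x = moll \<epsilon> (z - x)" for x
  have \<phi>0: "\<phi> x = 0" if "x \<notin> cball z \<epsilon>" for x
    unfolding \<phi>_def using that \<epsilon> by (intro moll_zero) (auto simp: dist_norm)
  have \<phi>nn: "\<phi> x \<ge> 0" for x unfolding \<phi>_def by (rule moll_nonneg)
  have \<phi>c: "continuous_on T \<phi>" for T
    unfolding \<phi>_def by (rule continuous_on_compose2[OF moll_continuous[of UNIV]]) (auto intro!: continuous_intros)
  have S0: "S \<ge> 0" using S[of z] \<epsilon> norm_ge_zero[of "f z"] by (simp only: mem_cball dist_self) linarith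
  obtain A where A: "A \<in> borel_measurable (lebesgue_on U)" "AE x in lebesgue_on U. norm (A x) \<le> K"
    "weak_dbar U f (\<lambda>x. f x *s A x)"
    using d unfolding dbar_le_def by blast
  have tf: "test_function U (\<lambda>x. complex_of_real (\<phi> x))"
    unfolding \<phi>_def by (rule test_function_moll[OF \<epsilon> z])
  have Um: "U \<in> sets lebesgue" using U by simp
  have eq: "(LINT x|lebesgue_on U. f x * dbar j (\<lambda>x. of_real (\<phi> x)) x) = - (LINT x|lebesgue_on U. (f x *s A x) $ j * of_real (\<phi> x))" for j
    using A(3) tf unfolding weak_dbar_def by blast
  define W where "W x = (f x * of_real (\<phi> x)) *s A x" for x
  have \<phi>i: "integrable lborel \<phi>" "(\<integral>x. \<phi> x \<partial>lborel) = (\<integral>x. moll \<epsilon> (x :: complex ^ 'n) \<partial>lborel)"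
  proof -
    have eq: "indicator (cball z \<epsilon>) x *\<^sub>R \<phi> x = \<phi> x" for x
      using \<phi>0[of x] by (cases "x \<in> cball z \<epsilon>") auto
    show "integrable lborel \<phi>"
      using borel_integrable_compact[OF compact_cball \<phi>c[of "cball z \<epsilon>"]]
      by (rule Bochner_Integration.integrable_cong[THEN iffD1, OF refl eq])
    show "(\<integral>x. \<phi> x \<partial>lborel) = (\<integral>x. moll \<epsilon> (x :: complex ^ 'n) \<partial>lborel)"
      unfolding \<phi>_def
      by (rule integral_lborel_reflect) (rule borel_measurable_continuous_onI[OF moll_continuous])
  qed
  have \<phi>leb: "integrable lebesgue \<phi>" using \<phi>i(1) by (simp add: integrable_completion)
  have \<phi>U: "integrable (lebesgue_on U) \<phi>" "(LINT x|lebesgue_on U. \<phi> x) = (\<integral>x. \<phi> x \<partial>lborel)"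
  proof -
    have ind: "(\<lambda>x. indicator U x *\<^sub>R \<phi> x) = \<phi>"
      using \<phi>0 z by (fastforce simp: indicator_def)
    then have ind': "(\<lambda>x. indicator U x * \<phi> x) = \<phi>" by simp
    show "integrable (lebesgue_on U) \<phi>"
      using \<phi>leb Um by (simp add: integrable_restrict_space ind')
    show "(LINT x|lebesgue_on U. \<phi> x) = (\<integral>x. \<phi> x \<partial>lborel)"
      using Um \<phi>i(1) by (simp add: integral_restrict_space ind' integral_completion)
  qed
  have Wb: "AE x in lebesgue_on U. norm (W x) \<le> K * S * \<phi> x"
    using A(2)
  proof eventually_elim
    case (elim x)
    show ?case
    proof (cases "x \<in> cball z \<epsilon>")
      case True
      have "norm (W x) = (norm (f x) * \<phi> x) * norm (A x)"
        using \<phi>nn[of x] by (simp add: W_def norm_vector_scalar_mult norm_mult)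
      also have "\<dots> \<le> (S * \<phi> x) * K"
        using S[OF True] elim \<phi>nn[of x] S0 by (intro mult_mono mult_right_mono) simp_all
      finally show ?thesis by (simp add: mult_ac)
    qed (simp add: W_def \<phi>0)
  qed
  have fm: "f \<in> borel_measurable (lebesgue_on U)"
    using f Um by (intro continuous_imp_measurable_on_sets_lebesgue)
  have Wm: "W \<in> borel_measurable (lebesgue_on U)"
  proof -
    have "(\<lambda>x. W x $ j) \<in> borel_measurable (lebesgue_on U)" for j
    proof -
      have "(\<lambda>x. A x $ j) \<in> borel_measurable (lebesgue_on U)"
        by (rule borel_measurable_continuous_on[OF _ A(1)]) (intro continuous_intros)
      moreover have "(\<lambda>x. complex_of_real (\<phi> x)) \<in> borel_measurable (lebesgue_on U)"
        using borel_measurable_integrable[OF \<phi>U(1)] by simp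
      ultimately show ?thesis unfolding W_def using fm by simp
    qed
    then have "(\<lambda>x. W x \<bullet> axis j b) \<in> borel_measurable (lebesgue_on U)" for j and b :: complex
      unfolding inner_axis by simp
    then show ?thesis by (subst borel_measurable_euclidean_space) (auto simp: Basis_vec_def)
  qed
  have Wi: "integrable (lebesgue_on U) W"
    by (rule Bochner_Integration.integrable_bound[OF _ Wm, of "\<lambda>x. K * S * \<phi> x"])
       (use \<phi>U(1) Wb \<phi>nn K S0 in simp_all)
  define V where "V = (LINT x|lebesgue_on U. W x)"
  have Vj: "V $ j = (LINT x|lebesgue_on U. (f x *s A x) $ j * of_real (\<phi> x))" for j
  proof -
    have "V $ j = (LINT x|lebesgue_on U. W x $ j)"
      unfolding V_def by (rule integral_bounded_linear[OF bounded_linear_vec_nth Wi, symmetric])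
    also have "\<dots> = (LINT x|lebesgue_on U. (f x *s A x) $ j * of_real (\<phi> x))"
      by (rule Bochner_Integration.integral_cong) (simp_all add: W_def)
    finally show ?thesis .
  qed
  have "norm V \<le> (LINT x|lebesgue_on U. norm (W x))"
    unfolding V_def by (rule integral_norm_bound)
  also have "\<dots> \<le> (LINT x|lebesgue_on U. K * S * \<phi> x)"
    using Wi \<phi>U(1) Wb by (intro integral_mono_AE) simp_all
  also have "\<dots> = K * S * (\<integral>x. moll \<epsilon> (x :: complex ^ 'n) \<partial>lborel)"
    using \<phi>U \<phi>i by simp
  finally have nV: "norm V \<le> K * S * (\<integral>x. moll \<epsilon> (x :: complex ^ 'n) \<partial>lborel)" .
  have "(\<Sum>j\<in>UNIV. (LINT x|lebesgue_on U. f x * dbar j (\<lambda>x. of_real (\<phi> x)) x) * w $ j) = - (\<Sum>j\<in>UNIV. V $ j * w $ j)"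
    unfolding eq Vj[symmetric] by (simp add: sum_negf)
  then have "norm (\<Sum>j\<in>UNIV. (LINT x|lebesgue_on U. f x * dbar j (\<lambda>x. of_real (\<phi> x)) x) * w $ j) \<le> norm V * norm w"
    using norm_sum_mult_vec_le[of V w] by simp
  also have "\<dots> \<le> K * S * (\<integral>x. moll \<epsilon> (x :: complex ^ 'n) \<partial>lborel) * norm w"
    using nV by (rule mult_right_mono) simp
  finally show ?thesis unfolding \<phi>_def .
qed

lemma continuous_nonzero_on_compact_bounded_below:
  fixes f :: "'a::metric_space \<Rightarrow> 'b::real_normed_vector"
  assumes "compact C" "continuous_on C f" "\<And>z. z \<in> C \<Longrightarrow> f z \<noteq> 0"
  shows "\<exists>\<mu>>0. \<forall>z\<in>C. \<mu> \<le> norm (f z)"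
proof (cases "C = {}")
  case False
  obtain x where "x \<in> C" "\<And>y. y \<in> C \<Longrightarrow> norm (f x) \<le> norm (f y)"
    using continuous_attains_inf[OF assms(1) False continuous_on_norm[OF assms(2)]] by blast
  then show ?thesis using assms(3)[of x] by (intro exI[of _ "norm (f x)"]) auto
qed (intro exI[of _ 1]; simp)

text \<open>The mollified function has antilinear derivative \<open>- 2 / c\<close> times the pairing of \<open>f\<close> with the
  \<open>dbar\<close> of the translated mollifier. As \<open>f\<close> does not vanish on \<open>C\<close> and is uniformly continuous
  near it, its values on a small ball are comparable to the value of the mollification at the centre.
  The vector \<open>w\<close> expresses the Hermitian norm of the form by duality, ready for the chain rule.\<close>

lemma mollify_dbar:
  fixes f :: "complex ^ 'n \<Rightarrow> complex"
  assumes U: "open U" and f: "continuous_on U f" and d: "dbar_le U f K" and K: "K \<ge> 0"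
    and C: "compact C" "C \<subseteq> U" "\<And>z. z \<in> C \<Longrightarrow> f z \<noteq> 0" and \<eta>: "\<eta> > 0"
  shows "\<exists>g D. (\<forall>z. (g has_derivative D z) (at z)) \<and> (\<forall>v. continuous_on UNIV (\<lambda>z. D z v)) \<and>
     (\<forall>z\<in>C. norm (g z - f z) \<le> \<eta> \<and>
        (\<forall>w. norm (\<Sum>j\<in>UNIV. (D z (axis j 1) + \<i> * D z (axis j \<i>)) * w $ j) \<le> 4 * K * norm (g z) * norm w))"
proof -
  obtain r where r: "r > 0" and rU: "(\<Union>x\<in>C. cball x r) \<subseteq> U"
    using compact_subset_open_imp_cball_epsilon_subset[OF C(1) U C(2)] by blast
  define C1 where "C1 = {x + y | x y. x \<in> C \<and> y \<in> cball 0 r}"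
  have C1c: "compact C1" unfolding C1_def by (rule compact_sums[OF C(1) compact_cball])
  have C1I: "cball z r \<subseteq> C1" if "z \<in> C" for z
  proof
    fix x assume "x \<in> cball z r"
    then have "x = z + (x - z) \<and> z \<in> C \<and> x - z \<in> cball 0 r" using that by (simp add: dist_norm norm_minus_commute)
    then show "x \<in> C1" unfolding C1_def by blast
  qed
  have C1U: "C1 \<subseteq> U"
  proof
    fix x assume "x \<in> C1"
    then obtain a b where "x = a + b" "a \<in> C" "b \<in> cball 0 r" by (auto simp: C1_def)
    then have "x \<in> cball a r" by (simp add: dist_norm)
    then show "x \<in> U" using rU \<open>a \<in> C\<close> by blast
  qed
  have fC1: "continuous_on C1 f" using f C1U continuous_on_subset by blast
  obtain \<mu> where \<mu>: "\<mu> > 0" "\<And>z. z \<in> C \<Longrightarrow> \<mu> \<le> norm (f z)"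
    using continuous_nonzero_on_compact_bounded_below[OF C(1) continuous_on_subset[OF f C(2)] C(3)] by blast
  \<comment> \<open>an oscillation of \<open>\<mu> / 4\<close> costs a factor \<open>2\<close> between the values of \<open>f\<close> on a ball and the mollification\<close>
  define osc where "osc = min \<eta> (\<mu> / 4)"
  have osc: "osc > 0" "osc \<le> \<eta>" "osc \<le> \<mu> / 4" using \<eta> \<mu> by (simp_all add: osc_def)
  obtain \<delta> where \<delta>: "\<delta> > 0" "\<And>x y. x \<in> C1 \<Longrightarrow> y \<in> C1 \<Longrightarrow> dist y x < \<delta> \<Longrightarrow> dist (f y) (f x) < osc"
    using compact_uniformly_continuous[OF fC1 C1c] osc(1) unfolding uniformly_continuous_on_def by metis
  define \<epsilon> where "\<epsilon> = min r (\<delta> / 2)"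
  have \<epsilon>: "\<epsilon> > 0" "\<epsilon> \<le> r" "\<epsilon> < \<delta>" using r \<delta>(1) by (simp_all add: \<epsilon>_def)
  have near: "norm (f x - f z) \<le> osc" "x \<in> C1" if "z \<in> C" "x \<in> cball z \<epsilon>" for x z
  proof -
    have 1: "x \<in> C1" "z \<in> C1" using C1I[OF that(1)] that \<epsilon> r by auto
    have "dist x z < \<delta>" using that(2) \<epsilon> by (simp add: dist_commute)
    then show "norm (f x - f z) \<le> osc" "x \<in> C1" using \<delta>(2)[OF 1(2,1)] 1 by (simp_all add: dist_norm)
  qed
  define F where "F x = indicator C1 x *\<^sub>R f x" for x
  have Fi: "integrable lborel F" unfolding F_def by (rule borel_integrable_compact[OF C1c fC1])
  have F0: "F x = 0" if "x \<notin> C1" for x using that by (simp add: F_def)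
  obtain m' where m': "\<And>x::complex ^ 'n. ((\<lambda>x. complex_of_real (moll \<epsilon> x)) has_derivative m' x) (at x)"
      and m'c: "\<And>v. continuous_on UNIV (\<lambda>x. m' x v)"
    using moll_derivative[where 'a = "complex ^ 'n"] by blast
  define c where "c = (\<integral>x. moll \<epsilon> (x :: complex ^ 'n) \<partial>lborel)"
  have c: "c > 0" unfolding c_def by (rule moll_integral_pos[OF \<epsilon>(1)])
  define g where "g z = (\<integral>x. F x * of_real (moll \<epsilon> (z - x)) \<partial>lborel) * inverse (of_real c)" for z
  define D where "D z v = (\<integral>x. F x * m' (z - x) v \<partial>lborel) * inverse (of_real c)" for z v
  have gD: "(g has_derivative D z) (at z)" for z
    unfolding g_def[abs_def] D_def[abs_def]
    by (rule has_derivative_mult_left[OF has_derivative_convolution[OF Fi C1c F0 m' m'c]])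
  have Dc: "continuous_on UNIV (\<lambda>z. D z v)" for v
    unfolding D_def
    by (intro continuous_on_mult continuous_on_convolution[OF Fi C1c F0 m'c] continuous_on_const)
  have int': "integrable lborel (\<lambda>x. F x * m' (z - x) v)" for z v
    by (rule integrable_mult_continuous_compact_support[OF Fi C1c F0 continuous_on_UNIV_reflect[OF m'c]])
  have mc: "continuous_on UNIV (\<lambda>x. complex_of_real (moll \<epsilon> x))" by (intro continuous_intros moll_continuous)
  have int: "integrable lborel (\<lambda>x. F x * of_real (moll \<epsilon> (z - x)))" for z
    by (rule integrable_mult_continuous_compact_support[OF Fi C1c F0 continuous_on_UNIV_reflect[OF mc]])
  have m'0: "m' y v = 0" if "norm y > \<epsilon>" for y v
  proof -
    have "((\<lambda>_. 0) has_derivative m' y) (at y)"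
    proof (rule has_derivative_transform_within_open[OF m'[of y]])
      show "open {y :: complex ^ 'n. \<epsilon> < norm y}" by (intro open_Collect_less continuous_intros)
      show "complex_of_real (moll \<epsilon> x) = 0" if "x \<in> {y. \<epsilon> < norm y}" for x :: "complex ^ 'n"
        using that \<epsilon>(1) by (simp add: moll_zero)
    qed (use that in simp)
    then have "m' y = (\<lambda>_. 0)" by (rule has_derivative_unique) (rule has_derivative_const)
    then show ?thesis by simp
  qed
  have close: "norm (g z - f z) \<le> osc" if z: "z \<in> C" for z
  proof -
    have ri: "integrable lborel (\<lambda>x. moll \<epsilon> (z - x))" and rc: "(\<integral>x. moll \<epsilon> (z - x) \<partial>lborel) = c"
    proof -
      have eq: "indicator (cball z \<epsilon>) x *\<^sub>R moll \<epsilon> (z - x) = moll \<epsilon> (z - x)" for x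
        using moll_zero[of \<epsilon> "z - x"] \<epsilon>(1) by (cases "x \<in> cball z \<epsilon>") (auto simp: dist_norm)
      have "continuous_on (cball z \<epsilon>) (\<lambda>x. moll \<epsilon> (z - x))"
        by (rule continuous_on_compose2[OF moll_continuous[of UNIV]]) (auto intro!: continuous_intros)
      from borel_integrable_compact[OF compact_cball this]
      show "integrable lborel (\<lambda>x. moll \<epsilon> (z - x))"
        by (rule Bochner_Integration.integrable_cong[THEN iffD1, OF refl eq])
      show "(\<integral>x. moll \<epsilon> (z - x) \<partial>lborel) = c"
        unfolding c_def by (rule integral_lborel_reflect) (rule borel_measurable_continuous_onI[OF moll_continuous])
    qed
    have ri': "integrable lborel (\<lambda>x. f z * complex_of_real (moll \<epsilon> (z - x)))" using ri by simp
    have "f z = (\<integral>x. f z * of_real (moll \<epsilon> (z - x)) \<partial>lborel) * inverse (of_real c)"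
      using ri rc c by simp
    then have "g z - f z = (\<integral>x. F x * of_real (moll \<epsilon> (z - x)) - f z * of_real (moll \<epsilon> (z - x)) \<partial>lborel) * inverse (of_real c)"
      unfolding g_def using int ri' by (simp add: left_diff_distrib)
    also have "norm \<dots> = norm (\<integral>x. F x * of_real (moll \<epsilon> (z - x)) - f z * of_real (moll \<epsilon> (z - x)) \<partial>lborel) * inverse c"
      using c by (simp add: norm_mult norm_inverse)
    also have "\<dots> \<le> (\<integral>x. osc * moll \<epsilon> (z - x) \<partial>lborel) * inverse c"
    proof (rule mult_right_mono, rule Bochner_Integration.integral_norm_bound_integral)
      show "integrable lborel (\<lambda>x. F x * of_real (moll \<epsilon> (z - x)) - f z * of_real (moll \<epsilon> (z - x)))"
        using int ri' by (rule Bochner_Integration.integrable_diff)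
      show "integrable lborel (\<lambda>x. osc * moll \<epsilon> (z - x))" using ri by simp
      show "norm (F x * of_real (moll \<epsilon> (z - x)) - f z * of_real (moll \<epsilon> (z - x))) \<le> osc * moll \<epsilon> (z - x)" for x
      proof (cases "x \<in> cball z \<epsilon>")
        case True
        have "F x * of_real (moll \<epsilon> (z - x)) - f z * of_real (moll \<epsilon> (z - x)) = (f x - f z) * of_real (moll \<epsilon> (z - x))"
          using near(2)[OF z True] by (simp add: F_def left_diff_distrib)
        then show ?thesis using near(1)[OF z True] moll_nonneg[of \<epsilon> "z - x"] by (simp add: norm_mult mult_right_mono)
      next
        case False
        then have "moll \<epsilon> (z - x) = 0" using \<epsilon>(1) by (intro moll_zero) (auto simp: dist_norm)
        then show ?thesis by simp
      qed
    qed (use c in simp)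
    also have "\<dots> = osc" using rc c by simp
    finally show ?thesis .
  qed
  have dbarz: "norm (\<Sum>j\<in>UNIV. (D z (axis j 1) + \<i> * D z (axis j \<i>)) * w $ j) \<le> 4 * K * norm (g z) * norm w"
    if z: "z \<in> C" for z w
  proof -
    define \<phi> where "\<phi> x = complex_of_real (moll \<epsilon> (z - x))" for x
    have \<phi>d: "(\<phi> has_derivative (\<lambda>v. - m' (z - x) v)) (at x)" for x
    proof -
      have "((\<lambda>x. z - x) has_derivative (\<lambda>v. - v)) (at x)" by (auto intro!: derivative_eq_intros)
      from has_derivative_compose[OF this m'[of "z - x"]]
      have "(\<phi> has_derivative (\<lambda>v. m' (z - x) (- v))) (at x)" unfolding \<phi>_def .
      moreover have "linear (m' (z - x))" using m' has_derivative_linear by blast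
      ultimately show ?thesis by (simp add: linear_neg)
    qed
    have db: "m' (z - x) (axis j 1) + \<i> * m' (z - x) (axis j \<i>) = - 2 * dbar j \<phi> x" for j x
      unfolding dbar_def frechet_derivative_at[OF \<phi>d, symmetric] by simp
    have Um: "U \<in> sets lebesgue" using U by simp
    have Dj: "D z (axis j 1) + \<i> * D z (axis j \<i>) = - (2 / of_real c) * (LINT x|lebesgue_on U. f x * dbar j \<phi> x)" for j
    proof -
      have "D z (axis j 1) + \<i> * D z (axis j \<i>)
        = (\<integral>x. F x * m' (z - x) (axis j 1) + \<i> * (F x * m' (z - x) (axis j \<i>)) \<partial>lborel) * inverse (of_real c)"
        unfolding D_def using int' by (simp add: algebra_simps)
      also have "(\<lambda>x. F x * m' (z - x) (axis j 1) + \<i> * (F x * m' (z - x) (axis j \<i>))) = (\<lambda>x. - 2 * (F x * dbar j \<phi> x))"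
      proof
        fix x
        have "F x * m' (z - x) (axis j 1) + \<i> * (F x * m' (z - x) (axis j \<i>))
            = F x * (m' (z - x) (axis j 1) + \<i> * m' (z - x) (axis j \<i>))" by (simp add: algebra_simps)
        then show "F x * m' (z - x) (axis j 1) + \<i> * (F x * m' (z - x) (axis j \<i>)) = - 2 * (F x * dbar j \<phi> x)"
          unfolding db by simp
      qed
      also have "(\<integral>x. - 2 * (F x * dbar j \<phi> x) \<partial>lborel) = - 2 * (\<integral>x. F x * dbar j \<phi> x \<partial>lborel)" by simp
      also have "(\<integral>x. F x * dbar j \<phi> x \<partial>lborel) = (LINT x|lebesgue_on U. f x * dbar j \<phi> x)"
      proof -
        have dbe: "dbar j \<phi> x = - (m' (z - x) (axis j 1) + \<i> * m' (z - x) (axis j \<i>)) / 2" for x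
          unfolding db by simp
        have "(\<lambda>x. F x * dbar j \<phi> x) \<in> borel_measurable lborel"
          unfolding dbe using borel_measurable_integrable[OF Fi]
            borel_measurable_continuous_onI[OF continuous_on_UNIV_reflect[OF m'c[of "axis j 1"], of z]]
            borel_measurable_continuous_onI[OF continuous_on_UNIV_reflect[OF m'c[of "axis j \<i>"], of z]]
          by simp
        then have e1: "(\<integral>x. F x * dbar j \<phi> x \<partial>lborel) = (\<integral>x. F x * dbar j \<phi> x \<partial>lebesgue)"
          by (simp add: integral_completion)
        have eqF: "(\<lambda>x. F x * dbar j \<phi> x) = (\<lambda>x. indicator U x *\<^sub>R (f x * dbar j \<phi> x))"
        proof
          fix x
          show "F x * dbar j \<phi> x = indicator U x *\<^sub>R (f x * dbar j \<phi> x)"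
          proof (cases "x \<in> C1")
            case True
            then show ?thesis using C1U by (auto simp: F_def)
          next
            case False
            then have "x \<notin> cball z r" using C1I[OF z] by blast
            then have "norm (z - x) > \<epsilon>" using \<epsilon>(2) by (simp add: dist_norm)
            then show ?thesis by (simp add: dbe m'0)
          qed
        qed
        have e2: "(\<integral>x. F x * dbar j \<phi> x \<partial>lebesgue) = (LINT x|lebesgue_on U. f x * dbar j \<phi> x)"
          unfolding eqF using Um by (simp add: integral_restrict_space)
        show ?thesis by (rule trans[OF e1 e2])
      qed
      finally show ?thesis by (simp add: divide_inverse)
    qed
    have fz: "\<mu> \<le> norm (f z)" using \<mu>(2)[OF z] .
    define S where "S = norm (f z) + osc"
    have "cball z \<epsilon> \<subseteq> U" using near(2)[OF z] C1U by blast
    moreover have "norm (f x) \<le> S" if "x \<in> cball z \<epsilon>" for x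
      using near(1)[OF z that] norm_triangle_sub[of "f x" "f z"] by (simp add: S_def)
    ultimately have b1: "norm (\<Sum>j\<in>UNIV. (LINT x|lebesgue_on U. f x * dbar j \<phi> x) * w $ j) \<le> K * S * c * norm w"
      unfolding \<phi>_def c_def by (intro weak_dbar_mollified_bound[OF U f d K \<epsilon>(1)])
    have b2: "(\<Sum>j\<in>UNIV. (D z (axis j 1) + \<i> * D z (axis j \<i>)) * w $ j)
       = - (2 / of_real c) * (\<Sum>j\<in>UNIV. (LINT x|lebesgue_on U. f x * dbar j \<phi> x) * w $ j)"
      unfolding Dj sum_distrib_left by (simp add: mult.assoc)
    have "norm (- (2 / complex_of_real c)) = 2 / c" using c by (simp add: norm_divide)
    then have "norm (\<Sum>j\<in>UNIV. (D z (axis j 1) + \<i> * D z (axis j \<i>)) * w $ j)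
        = (2 / c) * norm (\<Sum>j\<in>UNIV. (LINT x|lebesgue_on U. f x * dbar j \<phi> x) * w $ j)"
      unfolding b2 norm_mult by simp
    also have "\<dots> \<le> (2 / c) * (K * S * c * norm w)"
      using c by (intro mult_left_mono b1) simp
    also have "\<dots> = K * (2 * S) * norm w" using c by simp
    also have "\<dots> \<le> K * (4 * norm (g z)) * norm w"
    proof (intro mult_right_mono mult_left_mono K norm_ge_zero)
      have "norm (f z) \<le> norm (g z) + osc" using close[OF z] norm_triangle_sub[of "f z" "g z"] by (simp add: norm_minus_commute)
      moreover have "4 * osc \<le> norm (f z)" using fz osc(3) by simp
      moreover have "0 \<le> norm (f z)" by simp
      ultimately show "2 * S \<le> 4 * norm (g z)" unfolding S_def by argo
    qed
    finally show ?thesis by (simp add: mult_ac)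
  qed
  show ?thesis
    by (rule exI[of _ g], rule exI[of _ D]) (use gD Dc dbarz close osc(2) order_trans in blast)
qed

definition holo_curve :: "complex set \<Rightarrow> (complex \<Rightarrow> complex ^ 'n) \<Rightarrow> (complex \<Rightarrow> complex ^ 'n) \<Rightarrow> bool" where
  "holo_curve V \<gamma> \<gamma>' \<longleftrightarrow> open V \<and> continuous_on V \<gamma>' \<and>
     (\<forall>t\<in>V. \<forall>j. ((\<lambda>t. \<gamma> t $ j) has_field_derivative \<gamma>' t $ j) (at t))"

lemma holo_curve_has_derivative:
  fixes \<gamma> :: "complex \<Rightarrow> complex ^ 'n"
  assumes "holo_curve V \<gamma> \<gamma>'" "t \<in> V"
  shows "(\<gamma> has_derivative (\<lambda>h. \<chi> j. \<gamma>' t $ j * h)) (at t)"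
proof (subst has_derivative_componentwise_within, rule ballI)
  fix i :: "complex ^ 'n" assume "i \<in> Basis"
  then obtain j b where i: "i = axis j b" by (auto simp: Basis_vec_def)
  have "((\<lambda>t. \<gamma> t $ j) has_derivative (\<lambda>h. \<gamma>' t $ j * h)) (at t)"
    using assms by (simp add: holo_curve_def has_field_derivative_def)
  then show "((\<lambda>x. \<gamma> x \<bullet> i) has_derivative (\<lambda>x. (\<chi> j. \<gamma>' t $ j * x) \<bullet> i)) (at t)"
    unfolding i inner_axis by (auto intro!: has_derivative_inner_left)
qed

lemma holo_curve_continuous:
  assumes "holo_curve V \<gamma> \<gamma>'" "S \<subseteq> V"
  shows "continuous_on S \<gamma>"
  using holo_curve_has_derivative[OF assms(1)] assms(2)
  by (meson continuous_at_imp_continuous_on has_derivative_continuous subsetD)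

text \<open>By the chain rule, the antilinear derivative of \<open>g \<circ> \<gamma>\<close> is the pairing of that of \<open>g\<close> with the
  conjugate of \<open>\<gamma>'\<close>.\<close>

lemma dbar_approximable_compose:
  fixes f :: "complex ^ 'n \<Rightarrow> complex"
  assumes \<Omega>: "open \<Omega>" and f: "continuous_on \<Omega> f" and d: "dbar_le (\<Omega> - f -` {0}) f K" and K: "K \<ge> 0"
    and \<gamma>: "holo_curve V \<gamma> \<gamma>'" and S: "S \<subseteq> V" "\<gamma> ` S \<subseteq> \<Omega>" and L: "\<And>t. t \<in> S \<Longrightarrow> norm (\<gamma>' t) \<le> L"
  shows "dbar_approximable (2 * K * L) S (\<lambda>t. f (\<gamma> t))"
  unfolding dbar_approximable_def
proof (intro allI impI)
  fix C :: "complex set" and \<eta> :: real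
  assume C: "compact C \<and> C \<subseteq> S \<and> (\<forall>t\<in>C. f (\<gamma> t) \<noteq> 0) \<and> \<eta> > 0"
  have "open {z \<in> \<Omega>. f z \<in> - {0}}"
    using continuous_open_preimage[OF f \<Omega>, of "- {0}"] by (simp add: vimage_def Int_def open_Compl)
  moreover have "{z \<in> \<Omega>. f z \<in> - {0}} = \<Omega> - f -` {0}" by auto
  ultimately have U: "open (\<Omega> - f -` {0})" by simp
  have CV: "C \<subseteq> V" using C S by blast
  have "compact (\<gamma> ` C)" using C holo_curve_continuous[OF \<gamma> CV] compact_continuous_image by blast
  moreover have "\<gamma> ` C \<subseteq> \<Omega> - f -` {0}" using C S by auto
  moreover have "f z \<noteq> 0" if "z \<in> \<gamma> ` C" for z using that C by blast
  moreover have "continuous_on (\<Omega> - f -` {0}) f" by (rule continuous_on_subset[OF f]) blast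
  moreover have "\<eta> > 0" using C by blast
  ultimately have "\<exists>g D. (\<forall>z. (g has_derivative D z) (at z)) \<and> (\<forall>v. continuous_on UNIV (\<lambda>z. D z v)) \<and>
     (\<forall>z\<in>\<gamma> ` C. norm (g z - f z) \<le> \<eta> \<and>
        (\<forall>w. norm (\<Sum>j\<in>UNIV. (D z (axis j 1) + \<i> * D z (axis j \<i>)) * w $ j) \<le> 4 * K * norm (g z) * norm w))"
    by (intro mollify_dbar[OF U _ d K])
  then obtain g D where g: "\<And>z. (g has_derivative D z) (at z)" "\<And>v. continuous_on UNIV (\<lambda>z. D z v)"
    and close: "\<And>z. z \<in> \<gamma> ` C \<Longrightarrow> norm (g z - f z) \<le> \<eta>"
    and db: "\<And>z w. z \<in> \<gamma> ` C \<Longrightarrow>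
        norm (\<Sum>j\<in>UNIV. (D z (axis j 1) + \<i> * D z (axis j \<i>)) * w $ j) \<le> 4 * K * norm (g z) * norm w"
    by blast
  define D' where "D' t v = D (\<gamma> t) (\<chi> j. \<gamma>' t $ j * v)" for t v
  have lin: "linear (D z)" for z using g(1) has_derivative_linear by blast
  have 1: "((\<lambda>t. g (\<gamma> t)) has_derivative D' t) (at t)" if "t \<in> V" for t
    unfolding D'_def by (rule has_derivative_compose[OF holo_curve_has_derivative[OF \<gamma> that] g(1)])
  have 2: "continuous_on V (\<lambda>t. D' t v)" for v
    unfolding D'_def linear_axis_decompose[OF lin, of _ "\<chi> j. _ j"]
    using \<gamma> holo_curve_continuous[OF \<gamma> subset_refl]
    by (intro continuous_intros continuous_on_compose2[OF g(2)]) (auto simp: holo_curve_def intro!: continuous_intros)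
  have 3: "norm (D' t 1 + \<i> * D' t \<i>) \<le> 2 * (2 * K * L) * norm (g (\<gamma> t))" if t: "t \<in> C" for t
  proof -
    have tS: "t \<in> S" using t C by blast
    \<comment> \<open>the components of \<open>\<gamma>\<close> are holomorphic, so only the derivatives of \<open>g\<close> in the conjugate variables survive\<close>
    define w where "w = (\<chi> j. cnj (\<gamma>' t $ j))"
    have "D' t 1 + \<i> * D' t \<i> = (\<Sum>j\<in>UNIV. (D (\<gamma> t) (axis j 1) + \<i> * D (\<gamma> t) (axis j \<i>)) * w $ j)"
      unfolding D'_def linear_axis_decompose[OF lin, of _ "\<chi> j. _ j"] sum_distrib_left sum.distrib[symmetric]
    proof (rule sum.cong[OF refl])
      fix j
      have weq: "w $ j = of_real (Re (\<gamma>' t $ j)) - \<i> * of_real (Im (\<gamma>' t $ j))" by (simp add: w_def complex_eq_iff)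
      show "of_real (Re ((\<chi> j. \<gamma>' t $ j * 1) $ j)) * D (\<gamma> t) (axis j 1) +
         of_real (Im ((\<chi> j. \<gamma>' t $ j * 1) $ j)) * D (\<gamma> t) (axis j \<i>) +
         \<i> * (of_real (Re ((\<chi> j. \<gamma>' t $ j * \<i>) $ j)) * D (\<gamma> t) (axis j 1) +
              of_real (Im ((\<chi> j. \<gamma>' t $ j * \<i>) $ j)) * D (\<gamma> t) (axis j \<i>)) =
         (D (\<gamma> t) (axis j 1) + \<i> * D (\<gamma> t) (axis j \<i>)) * w $ j"
        unfolding weq by (simp add: algebra_simps)
    qed
    also have "norm \<dots> \<le> 4 * K * norm (g (\<gamma> t)) * norm w" by (rule db) (use t in blast)
    also have "norm w = norm (\<gamma>' t)" by (simp add: w_def norm_vec_def)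
    also have "4 * K * norm (g (\<gamma> t)) * norm (\<gamma>' t) \<le> 4 * K * norm (g (\<gamma> t)) * L"
      using L[OF tS] K by (intro mult_left_mono) simp_all
    finally show ?thesis by (simp add: mult_ac)
  qed
  show "\<exists>f' D N. open N \<and> C \<subseteq> N \<and> (\<forall>t\<in>N. (f' has_derivative D t) (at t)) \<and>
         (\<forall>v. continuous_on N (\<lambda>t. D t v)) \<and>
         (\<forall>t\<in>C. norm (f' t - f (\<gamma> t)) \<le> \<eta> \<and> norm (D t 1 + \<i> * D t \<i>) \<le> 2 * (2 * K * L) * norm (f' t))"
    using 1 2 3 close CV \<gamma>
    by (intro exI[of _ "\<lambda>t. g (\<gamma> t)"] exI[of _ D'] exI[of _ V]) (auto simp: holo_curve_def)
qed

section \<open>Functions comparable to holomorphic functions\<close>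

definition holo_comparable :: "real \<Rightarrow> complex set \<Rightarrow> (complex \<Rightarrow> complex) \<Rightarrow> bool" where
  "holo_comparable M S g \<longleftrightarrow> (\<exists>h. h holomorphic_on S \<and>
      (\<forall>t\<in>S. exp (- M) * norm (g t) \<le> norm (h t) \<and> norm (h t) \<le> exp M * norm (g t)))"

text \<open>The constant \<open>M\<close> may depend on the radius of the disc and on the speed of the curve, but not on the
  curve. This uniformity lets zeros of \<open>f\<close> be followed through families of curves.\<close>

definition curve_comparable :: "(complex ^ 'n) set \<Rightarrow> (complex ^ 'n \<Rightarrow> complex) \<Rightarrow> bool" where
  "curve_comparable \<Omega> f \<longleftrightarrow> (\<forall>R L. R > 0 \<longrightarrow> L \<ge> 0 \<longrightarrow> (\<exists>M\<ge>0. \<forall>t0 V \<gamma> \<gamma>'.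
      holo_curve V \<gamma> \<gamma>' \<longrightarrow> cball t0 R \<subseteq> V \<longrightarrow> \<gamma> ` cball t0 R \<subseteq> \<Omega> \<longrightarrow>
      (\<forall>t\<in>cball t0 R. norm (\<gamma>' t) \<le> L) \<longrightarrow> holo_comparable M (ball t0 R) (\<lambda>t. f (\<gamma> t))))"

theorem dbar_le_imp_curve_comparable:
  fixes f :: "complex ^ 'n \<Rightarrow> complex"
  assumes "open \<Omega>" "continuous_on \<Omega> f" "dbar_le (\<Omega> - f -` {0}) f K" "K \<ge> 0"
  shows "curve_comparable \<Omega> f"
  unfolding curve_comparable_def
proof (intro allI impI)
  fix R L :: real assume "R > 0" "L \<ge> 0"
  then obtain M where M: "M \<ge> 0" "\<And>t0 g. continuous_on (cball t0 R) g \<Longrightarrow> dbar_approximable (2 * K * L) (cball t0 R) g \<Longrightarrow>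
      holo_comparable M (ball t0 R) g"
    using similarity_principle[of R "2 * K * L"] assms(4) unfolding holo_comparable_def by fastforce
  have "holo_comparable M (ball t0 R) (\<lambda>t. f (\<gamma> t))"
    if "holo_curve V \<gamma> \<gamma>'" "cball t0 R \<subseteq> V" "\<gamma> ` cball t0 R \<subseteq> \<Omega>" "\<forall>t\<in>cball t0 R. norm (\<gamma>' t) \<le> L"
    for t0 V and \<gamma> :: "complex \<Rightarrow> complex ^ 'n" and \<gamma>'
  proof (rule M(2))
    show "continuous_on (cball t0 R) (\<lambda>t. f (\<gamma> t))"
      using continuous_on_compose2[OF assms(2) holo_curve_continuous[OF that(1,2)] that(3)] .
    show "dbar_approximable (2 * K * L) (cball t0 R) (\<lambda>t. f (\<gamma> t))"
      by (rule dbar_approximable_compose[OF assms that(1-3)]) (use that(4) in blast)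
  qed
  then show "\<exists>M\<ge>0. \<forall>t0 V \<gamma> \<gamma>'.
      holo_curve V \<gamma> \<gamma>' \<longrightarrow> cball t0 R \<subseteq> V \<longrightarrow> \<gamma> ` cball t0 R \<subseteq> \<Omega> \<longrightarrow>
      (\<forall>t\<in>cball t0 R. norm (\<gamma>' t) \<le> L) \<longrightarrow> holo_comparable M (ball t0 R) (\<lambda>t. f (\<gamma> t))"
    using M(1) by blast
qed

lemma holo_comparable_zero_iff:
  assumes "exp (- M) * norm g \<le> norm h \<and> norm h \<le> exp M * norm (g::complex)"
  shows "h = (0::complex) \<longleftrightarrow> g = 0"
  using assms by (auto simp: mult_le_0_iff)

text \<open>Hurwitz's theorem in a quantitative form: if there were no zero, the minimum principle for the
  comparable holomorphic function would bound it from below at the centre. The threshold involves \<open>M\<close>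
  only, so the statement applies to perturbations within a family of uniformly comparable functions.\<close>

lemma holo_comparable_zero_in_ball:
  assumes cmp: "holo_comparable M (ball t0 R) g" and r: "0 < r" "r < R"
    and m: "\<And>t. t \<in> sphere t0 r \<Longrightarrow> m \<le> norm (g t)" and small: "norm (g t0) < exp (- 2 * M) * m"
  shows "\<exists>t\<in>ball t0 r. g t = 0"
proof (rule ccontr)
  assume nz: "\<not> ?thesis"
  obtain h where h: "h holomorphic_on ball t0 R"
      "\<And>t. t \<in> ball t0 R \<Longrightarrow> exp (- M) * norm (g t) \<le> norm (h t) \<and> norm (h t) \<le> exp M * norm (g t)"
    using cmp unfolding holo_comparable_def by blast
  have cb: "cball t0 r \<subseteq> ball t0 R" using r by auto
  have m0: "m > 0" using small norm_ge_zero[of "g t0"] by (smt (verit) exp_gt_zero mult_nonneg_nonpos)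
  have gnz: "g t \<noteq> 0" if "t \<in> cball t0 r" for t
  proof (cases "t \<in> sphere t0 r")
    case True
    then show ?thesis using m[OF True] m0 by auto
  next
    case False
    then show ?thesis using that nz by auto
  qed
  have hnz: "h t \<noteq> 0" if "t \<in> cball t0 r" for t
    using holo_comparable_zero_iff[OF h(2)[of t]] gnz[OF that] that cb by blast
  have "norm (inverse (h t0)) \<le> inverse (exp (- M) * m)"
  proof (rule maximum_modulus_frontier[of "\<lambda>t. inverse (h t)" "cball t0 r"])
    show "(\<lambda>t. inverse (h t)) holomorphic_on interior (cball t0 r)"
      using hnz by (intro holomorphic_intros holomorphic_on_subset[OF h(1)]) (use cb in auto)
    show "continuous_on (closure (cball t0 r)) (\<lambda>t. inverse (h t))"
      using hnz by (intro continuous_intros continuous_on_subset[OF holomorphic_on_imp_continuous_on[OF h(1)]]) (use cb in auto)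
    fix t assume "t \<in> frontier (cball t0 r)"
    then have t: "t \<in> sphere t0 r" by simp
    then have tb: "t \<in> ball t0 R" using cb sphere_cball by blast
    have "exp (- M) * m \<le> exp (- M) * norm (g t)" using m[OF t] by simp
    also have "\<dots> \<le> norm (h t)" using h(2)[OF tb] by blast
    finally show "norm (inverse (h t)) \<le> inverse (exp (- M) * m)"
      unfolding norm_inverse by (rule le_imp_inverse_le) (use m0 in simp)
  qed (use r in auto)
  moreover have t0: "t0 \<in> ball t0 R" "t0 \<in> cball t0 r" using r by auto
  ultimately have "inverse (norm (h t0)) \<le> inverse (exp (- M) * m)"
    unfolding norm_inverse by blast
  then have "exp (- M) * m \<le> norm (h t0)"
    by (rule inverse_le_imp_le) (use hnz[OF t0(2)] in simp)
  also have "\<dots> \<le> exp M * norm (g t0)" using h(2)[OF t0(1)] by blast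
  also have "\<dots> < exp M * (exp (- 2 * M) * m)" using small by simp
  also have "\<dots> = exp (- M) * m"
  proof -
    have "exp M * exp (- 2 * M) = exp (- M)" unfolding exp_add[symmetric] by simp
    then show ?thesis by (metis mult.assoc)
  qed
  finally show False by simp
qed

lemma holo_comparable_isolated_zero:
  assumes cmp: "holo_comparable M (ball t0 R) g" and z: "t0' \<in> ball t0 R" "g t0' = 0"
    and nz: "t1 \<in> ball t0 R" "g t1 \<noteq> 0"
  shows "\<exists>r>0. ball t0' r \<subseteq> ball t0 R \<and> (\<forall>t\<in>ball t0' r - {t0'}. g t \<noteq> 0)"
proof -
  obtain h where h: "h holomorphic_on ball t0 R"
      "\<And>t. t \<in> ball t0 R \<Longrightarrow> exp (- M) * norm (g t) \<le> norm (h t) \<and> norm (h t) \<le> exp M * norm (g t)"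
    using cmp unfolding holo_comparable_def by blast
  have iff: "h t = 0 \<longleftrightarrow> g t = 0" if "t \<in> ball t0 R" for t
    by (rule holo_comparable_zero_iff[OF h(2)[OF that]])
  obtain r where r: "r > 0" "ball t0' r \<subseteq> ball t0 R" "\<And>t. t \<in> ball t0' r - {t0'} \<Longrightarrow> h t \<noteq> 0"
    using isolated_zeros[OF h(1) open_ball connected_ball z(1) _ nz(1)] iff z nz by metis
  have "g t \<noteq> 0" if "t \<in> ball t0' r - {t0'}" for t
    using iff[of t] r(3)[OF that] r(2) that by blast
  then show ?thesis using r by blast
qed

lemma holomorphic_factor_finite_zeros:
  assumes "finite A" "open S" "h holomorphic_on S" "A \<subseteq> S" "\<And>a. a \<in> A \<Longrightarrow> h a = 0"
  shows "\<exists>k. k holomorphic_on S \<and> (\<forall>z\<in>S. h z = (\<Prod>a\<in>A. z - a) * k z)"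
  using assms
proof (induction A rule: finite_induct)
  case empty
  then show ?case by auto
next
  case (insert a A)
  then obtain k where k: "k holomorphic_on S" "\<And>z. z \<in> S \<Longrightarrow> h z = (\<Prod>a\<in>A. z - a) * k z" by auto
  have aS: "a \<in> S" using insert by auto
  have "(\<Prod>a'\<in>A. a - a') \<noteq> 0" using insert by auto
  then have ka: "k a = 0" using k(2)[OF aS] insert.prems(4)[of a] by simp
  \<comment> \<open>the difference quotient, continued to \<open>a\<close>\<close>
  define k' where "k' z = (if z = a then deriv k a else (k z - k a) / (z - a))" for z
  have "k' holomorphic_on S"
    unfolding k'_def using pole_lemma[OF k(1), of a] aS \<open>open S\<close> by (simp add: interior_open)
  moreover have "h z = (\<Prod>a\<in>insert a A. z - a) * k' z" if "z \<in> S" for z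
    using k(2)[OF that] insert.hyps ka by (simp add: k'_def)
  ultimately show ?case by blast
qed

text \<open>Jensen's bound: dividing the zeros out of the comparable function, the maximum principle on the
  circle of radius \<open>3 * r\<close> gains a factor \<open>2\<close> for every zero, since there \<open>norm (z - a) \<ge> 2 * r\<close>, while
  \<open>norm (x0 - a) \<le> r\<close> at the centre.\<close>

lemma holo_comparable_card_zeros:
  assumes cmp: "holo_comparable M (ball x0 R) g" and r: "0 < r" "3 * r < R"
    and G: "\<And>x. x \<in> ball x0 R \<Longrightarrow> norm (g x) \<le> G"
    and A: "finite A" "A \<subseteq> ball x0 r" "\<And>a. a \<in> A \<Longrightarrow> g a = 0"
  shows "2 ^ card A * norm (g x0) \<le> exp (2 * M) * G"
proof -
  obtain h where h: "h holomorphic_on ball x0 R"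
      "\<And>t. t \<in> ball x0 R \<Longrightarrow> exp (- M) * norm (g t) \<le> norm (h t) \<and> norm (h t) \<le> exp M * norm (g t)"
    using cmp unfolding holo_comparable_def by blast
  have AR: "A \<subseteq> ball x0 R" using A r by auto
  have "h a = 0" if "a \<in> A" for a
    using holo_comparable_zero_iff[OF h(2)[of a]] A(3)[OF that] AR that by blast
  then obtain k where k: "k holomorphic_on ball x0 R" "\<And>z. z \<in> ball x0 R \<Longrightarrow> h z = (\<Prod>a\<in>A. z - a) * k z"
    using holomorphic_factor_finite_zeros[OF A(1) open_ball h(1) AR] by blast
  have cb: "cball x0 (3 * r) \<subseteq> ball x0 R" using r by auto
  have x0: "x0 \<in> ball x0 R" using r by auto
  have kb: "norm (k x0) \<le> exp M * G / (2 * r) ^ card A"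
  proof (rule maximum_modulus_frontier[of k "cball x0 (3 * r)"])
    show "k holomorphic_on interior (cball x0 (3 * r))"
      by (rule holomorphic_on_subset[OF k(1)]) (use cb in auto)
    show "continuous_on (closure (cball x0 (3 * r))) k"
      using cb by (intro continuous_on_subset[OF holomorphic_on_imp_continuous_on[OF k(1)]]) auto
    fix z assume "z \<in> frontier (cball x0 (3 * r))"
    then have z: "dist x0 z = 3 * r" using r by simp
    then have zR: "z \<in> ball x0 R" using r by simp
    have "(2 * r) ^ card A = (\<Prod>a\<in>A. 2 * r)" by simp
    also have "\<dots> \<le> (\<Prod>a\<in>A. norm (z - a))"
    proof (rule prod_mono)
      fix a assume "a \<in> A"
      then have "dist x0 a < r" using A(2) by auto
      then show "0 \<le> 2 * r \<and> 2 * r \<le> norm (z - a)"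
        using z dist_triangle[of x0 z a] r by (simp add: dist_norm norm_minus_commute)
    qed
    finally have "(2 * r) ^ card A * norm (k z) \<le> norm (h z)"
      unfolding k(2)[OF zR] by (simp add: norm_mult prod_norm mult_right_mono)
    also have "\<dots> \<le> exp M * norm (g z)" using h(2)[OF zR] by blast
    also have "\<dots> \<le> exp M * G" using G[OF zR] by simp
    finally show "norm (k z) \<le> exp M * G / (2 * r) ^ card A"
      using r by (simp add: pos_le_divide_eq mult.commute)
  qed (use r in auto)
  have "norm (\<Prod>a\<in>A. x0 - a) \<le> r ^ card A"
  proof -
    have "norm (\<Prod>a\<in>A. x0 - a) = (\<Prod>a\<in>A. norm (x0 - a))" by (simp add: prod_norm)
    also have "\<dots> \<le> (\<Prod>a\<in>A. r)"
      by (rule prod_mono) (use A(2) in \<open>auto simp: dist_norm subset_iff intro: less_imp_le\<close>)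
    finally show ?thesis by simp
  qed
  then have "norm (h x0) \<le> r ^ card A * (exp M * G / (2 * r) ^ card A)"
    unfolding k(2)[OF x0] norm_mult using kb r by (intro mult_mono) auto
  also have "\<dots> = exp M * G / 2 ^ card A" using r by (simp add: power_mult_distrib)
  finally have "exp (- M) * norm (g x0) \<le> exp M * G / 2 ^ card A" using h(2)[OF x0] by linarith
  then have "2 ^ card A * (exp (- M) * norm (g x0)) \<le> exp M * G" by (simp add: pos_le_divide_eq mult.commute)
  then have "exp M * (2 ^ card A * (exp (- M) * norm (g x0))) \<le> exp M * (exp M * G)" by simp
  moreover have "exp M * (2 ^ card A * (exp (- M) * norm (g x0))) = 2 ^ card A * norm (g x0)"
    by (simp add: exp_minus field_simps)
  moreover have "exp M * (exp M * G) = exp (2 * M) * G" by (simp add: exp_double power2_eq_square)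
  ultimately show ?thesis by simp
qed

section \<open>Holomorphy of an isolated sheet of zeros\<close>

lemma holo_curve_line: "holo_curve UNIV (\<lambda>w. z + w *s b) (\<lambda>_. b)"
  unfolding holo_curve_def by (auto intro!: derivative_eq_intros)

lemma holo_curve_graph:
  assumes "open V" "q holomorphic_on V"
  shows "holo_curve V (\<lambda>t. a + t *s e + q t *s b) (\<lambda>t. e + deriv q t *s b)"
  unfolding holo_curve_def
proof (intro conjI ballI allI)
  show "continuous_on V (\<lambda>t. e + deriv q t *s b)"
    using assms by (intro continuous_intros holomorphic_on_imp_continuous_on holomorphic_deriv)
  fix t j assume "t \<in> V"
  then have "(q has_field_derivative deriv q t) (at t)"
    using assms holomorphic_derivI by blast
  then show "((\<lambda>t. (a + t *s e + q t *s b) $ j) has_field_derivative (e + deriv q t *s b) $ j) (at t)"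
    by (auto intro!: derivative_eq_intros)
qed (rule assms(1))

text \<open>The zero set of \<open>f\<close> in the tube is the graph of \<open>c\<close>. If \<open>v = \<alpha> * c + \<beta>\<close> violated the maximum principle
  in its real part, \<open>Re v\<close> would attain an interior maximum at a point with value \<open>s\<close>. The graphs of
  \<open>q x = (s + x - \<beta>) / \<alpha>\<close> are holomorphic curves, and \<open>f\<close> has a zero on such a curve over \<open>t\<close>
  exactly if \<open>v t = s + x\<close>. For \<open>x = 0\<close> there is such a zero, so by Hurwitz's theorem there is one for small
  positive \<open>x\<close>, contrary to the maximality.\<close>

theorem single_sheet_holomorphic:
  fixes f :: "complex ^ 'n \<Rightarrow> complex" and c :: "complex \<Rightarrow> complex"
  assumes f: "continuous_on \<Omega> f" and cmp: "curve_comparable \<Omega> f"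
    and \<tau>: "\<tau> > 0" and cc: "continuous_on (cball x0 \<tau>) c"
    and dom: "\<And>t w. t \<in> cball x0 \<tau> \<Longrightarrow> w \<in> ball w0 \<epsilon> \<Longrightarrow> a + t *s e + w *s b \<in> \<Omega>"
    and cin: "\<And>t. t \<in> cball x0 \<tau> \<Longrightarrow> c t \<in> ball w0 \<epsilon>"
    and zero: "\<And>t w. t \<in> cball x0 \<tau> \<Longrightarrow> w \<in> ball w0 \<epsilon> \<Longrightarrow> f (a + t *s e + w *s b) = 0 \<longleftrightarrow> w = c t"
  shows "c holomorphic_on ball x0 \<tau>"
proof -
  have "\<exists>F. F holomorphic_on ball x0 \<tau> \<and> (\<forall>z\<in>ball x0 \<tau>. c z = F z)"
  proof (rule holomorphic_of_affine_maximum_principle[OF \<tau> cc open_ball subset_refl])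
    show "ball x0 \<tau> \<noteq> {}" using \<tau> by auto
    fix t1 \<tau>1 N \<alpha> \<beta> M t
    assume \<tau>1: "(\<tau>1::real) > 0" and sub: "cball t1 \<tau>1 \<subseteq> cball x0 \<tau>" and N: "open N" "cball t1 \<tau>1 \<subseteq> N"
      and \<alpha>: "\<alpha> holomorphic_on N" "\<And>x. x \<in> N \<Longrightarrow> \<alpha> x \<noteq> 0" and \<beta>: "\<beta> holomorphic_on N"
      and sph: "\<And>x. x \<in> sphere t1 \<tau>1 \<Longrightarrow> Re (\<alpha> x * c x + \<beta> x) \<le> M" and t: "t \<in> ball t1 \<tau>1"
    define v where "v x = \<alpha> x * c x + \<beta> x" for x
    have vc: "continuous_on (cball t1 \<tau>1) v"
      unfolding v_def[abs_def]
      by (intro continuous_intros continuous_on_subset[OF cc sub]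
            continuous_on_subset[OF holomorphic_on_imp_continuous_on N(2)] \<alpha> \<beta>)
    show "Re (\<alpha> t * c t + \<beta> t) \<le> M"
    proof (rule ccontr)
      assume "\<not> ?thesis"
      then have vt: "Re (v t) > M" by (simp add: v_def)
      have "continuous_on (cball t1 \<tau>1) (\<lambda>x. Re (v x))" by (intro continuous_intros vc)
      moreover have "cball t1 \<tau>1 \<noteq> {}" using \<tau>1 by simp
      ultimately obtain ts where ts: "ts \<in> cball t1 \<tau>1" "\<And>x. x \<in> cball t1 \<tau>1 \<Longrightarrow> Re (v x) \<le> Re (v ts)"
        using continuous_attains_sup[OF compact_cball, of t1 \<tau>1 "\<lambda>x. Re (v x)"] by blast
      define s where "s = v ts"
      have sM: "Re s > M" using ts(2)[of t] t vt by (force simp: s_def)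
      define E where "E = {x \<in> cball t1 \<tau>1. v x = s}"
      have "closed E"
        using continuous_closed_preimage[OF vc closed_cball, of "{s}"] by (simp add: E_def vimage_def Int_def)
      then have cE: "compact E"
        unfolding compact_eq_bounded_closed E_def by (auto intro: bounded_subset[OF bounded_cball])
      have neE: "E \<noteq> {}" using ts(1) by (auto simp: E_def s_def)
      \<comment> \<open>a point of the level set farthest from the centre, so that the level set contains no neighbourhood of it\<close>
      obtain t2 where t2: "t2 \<in> E" "\<And>x. x \<in> E \<Longrightarrow> dist t1 x \<le> dist t1 t2"
        using continuous_attains_sup[OF cE neE continuous_on_dist[OF continuous_on_const continuous_on_id], of t1] by blast
      have t2v: "v t2 = s" using t2(1) by (simp add: E_def)
      have t2b: "t2 \<in> ball t1 \<tau>1"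
      proof -
        have "t2 \<notin> sphere t1 \<tau>1" using sph[of t2] t2v sM by (auto simp: v_def)
        then show ?thesis using t2(1) by (auto simp: E_def)
      qed
      have t2N: "t2 \<in> N" and t2x: "t2 \<in> cball x0 \<tau>" using t2b N(2) sub ball_subset_cball by blast+
      \<comment> \<open>the level sets of the affine expression, as graphs\<close>
      define q where "q x t = (s + of_real x - \<beta> t) / \<alpha> t" for x :: real and t
      have qh: "q x holomorphic_on N" for x
        unfolding q_def[abs_def] by (intro holomorphic_intros \<alpha> \<beta>)
      have qv: "q x u = c u \<longleftrightarrow> v u = s + of_real x" if "u \<in> N" for x u
        using \<alpha>(2)[OF that] by (auto simp: q_def v_def field_simps)
      have q0t2: "q 0 t2 = c t2" using qv[OF t2N, of 0] t2v by simp
      have "open {u \<in> N. q 0 u \<in> ball w0 \<epsilon>}"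
        using continuous_open_preimage[OF holomorphic_on_imp_continuous_on[OF qh] N(1) open_ball, of 0 w0 \<epsilon>]
        by (simp add: vimage_def Int_def)
      then have "open ({u \<in> N. q 0 u \<in> ball w0 \<epsilon>} \<inter> ball t1 \<tau>1)" by (intro open_Int open_ball)
      moreover have "t2 \<in> {u \<in> N. q 0 u \<in> ball w0 \<epsilon>} \<inter> ball t1 \<tau>1"
        using t2N t2b q0t2 cin[OF t2x] by simp
      ultimately obtain R where R: "R > 0" "cball t2 R \<subseteq> {u \<in> N. q 0 u \<in> ball w0 \<epsilon>} \<inter> ball t1 \<tau>1"
        by (meson open_contains_cball)
      have RN: "cball t2 R \<subseteq> N" and R1: "cball t2 R \<subseteq> ball t1 \<tau>1" and Rq: "\<And>u. u \<in> cball t2 R \<Longrightarrow> q 0 u \<in> ball w0 \<epsilon>"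
        using R(2) by auto
      have R\<tau>: "cball t2 R \<subseteq> cball x0 \<tau>" using R1 sub ball_subset_cball by blast
      have cont_q0: "continuous_on (cball t2 R) (q 0)"
        by (rule continuous_on_subset[OF holomorphic_on_imp_continuous_on[OF qh] RN])
      obtain u0 where u0: "u0 \<in> cball t2 R" "\<And>u. u \<in> cball t2 R \<Longrightarrow> dist w0 (q 0 u) \<le> dist w0 (q 0 u0)"
        using continuous_attains_sup[OF compact_cball _ continuous_on_dist[OF continuous_on_const cont_q0], of w0] R(1)
        by (metis cball_eq_empty not_less_iff_gr_or_eq)
      define gap where "gap = \<epsilon> - dist w0 (q 0 u0)"
      have gap: "gap > 0" using Rq[OF u0(1)] by (simp add: gap_def)
      define ia where "ia u = inverse (\<alpha> u)" for u
      have iah: "ia holomorphic_on N" unfolding ia_def[abs_def] by (intro holomorphic_intros \<alpha>)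
      have qx: "q x u = q 0 u + of_real x * ia u" for x u
        by (simp add: q_def ia_def divide_inverse algebra_simps)
      have iac: "continuous_on (cball t2 R) ia"
        by (rule continuous_on_subset[OF holomorphic_on_imp_continuous_on[OF iah] RN])
      obtain A where A: "\<And>u. u \<in> cball t2 R \<Longrightarrow> norm (ia u) \<le> A"
        using norm_bounded_on_compact[OF compact_cball iac] by blast
      have A0: "A \<ge> 0" using A[of t2] R(1) norm_ge_zero[of "ia t2"] by (simp only: mem_cball dist_self) linarith
      obtain A1 where A1: "\<And>u. u \<in> cball t2 R \<Longrightarrow> norm (deriv ia u) \<le> A1"
        using norm_bounded_on_compact[OF compact_cball continuous_on_subset[OF
              holomorphic_on_imp_continuous_on[OF holomorphic_deriv[OF iah N(1)]] RN]] by blast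
      obtain A2 where A2: "\<And>u. u \<in> cball t2 R \<Longrightarrow> norm (deriv (q 0) u) \<le> A2"
        using norm_bounded_on_compact[OF compact_cball continuous_on_subset[OF
              holomorphic_on_imp_continuous_on[OF holomorphic_deriv[OF qh N(1)]] RN]] by blast
      have A12: "A1 \<ge> 0" "A2 \<ge> 0"
        using A1[of t2] A2[of t2] R(1) norm_ge_zero[of "deriv ia t2"] norm_ge_zero[of "deriv (q 0) t2"]
        by (simp_all only: mem_cball dist_self) linarith+
      \<comment> \<open>for \<open>x\<close> up to \<open>x1\<close> the curves stay in the tube\<close>
      define x1 where "x1 = min 1 (gap / (2 * (A + 1)))"
      have x1: "x1 > 0" "x1 \<le> 1" using gap A0 by (simp_all add: x1_def)
      have x1A: "x1 * A < gap"
      proof -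
        have "x1 * A \<le> gap / (2 * (A + 1)) * A" using A0 by (intro mult_right_mono) (simp_all add: x1_def)
        also have "\<dots> < gap" using gap A0 by (simp add: divide_simps)
        finally show ?thesis .
      qed
      have qin: "q x u \<in> ball w0 \<epsilon>" if "x \<in> {0..x1}" "u \<in> cball t2 R" for x u
      proof -
        have "norm (of_real x * ia u) \<le> x1 * A"
          unfolding norm_mult using that A[OF that(2)] by (intro mult_mono) auto
        moreover have "dist w0 (q x u) \<le> dist w0 (q 0 u) + norm (of_real x * ia u)"
          using dist_triangle[of w0 "q x u" "q 0 u"] by (simp add: qx[of x] dist_norm)
        ultimately show ?thesis using u0(2)[OF that(2)] x1A by (simp add: gap_def)
      qed
      define \<gamma> where "\<gamma> x u = a + u *s e + q x u *s b" for x u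
      have \<gamma>\<Omega>: "\<gamma> x u \<in> \<Omega>" if "x \<in> {0..x1}" "u \<in> cball t2 R" for x u
        unfolding \<gamma>_def using that R\<tau> by (intro dom qin) auto
      have \<gamma>0: "f (\<gamma> x u) = 0 \<longleftrightarrow> v u = s + of_real x" if "x \<in> {0..x1}" "u \<in> cball t2 R" for x u
        unfolding \<gamma>_def using that R\<tau> RN qv[of u x] by (subst zero[OF _ qin]) auto
      define L where "L = norm e + (A2 + A1) * norm b"
      have L0: "L \<ge> 0" using A12 by (simp add: L_def)
      obtain M' where M': "\<And>t0 V \<gamma> \<gamma>'.
        holo_curve V \<gamma> \<gamma>' \<Longrightarrow> cball t0 R \<subseteq> V \<Longrightarrow> \<gamma> ` cball t0 R \<subseteq> \<Omega> \<Longrightarrow>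
        (\<forall>t\<in>cball t0 R. norm (\<gamma>' t) \<le> L) \<Longrightarrow> holo_comparable M' (ball t0 R) (\<lambda>t. f (\<gamma> t))"
        using cmp R(1) L0 unfolding curve_comparable_def by meson
      have cmpx: "holo_comparable M' (ball t2 R) (\<lambda>u. f (\<gamma> x u))" if x: "x \<in> {0..x1}" for x
      proof (rule M'[OF _ RN])
        show "holo_curve N (\<gamma> x) (\<lambda>t. e + deriv (q x) t *s b)"
          unfolding \<gamma>_def[abs_def] by (rule holo_curve_graph[OF N(1) qh])
        show "\<gamma> x ` cball t2 R \<subseteq> \<Omega>" using \<gamma>\<Omega>[OF x] by blast
        show "\<forall>u\<in>cball t2 R. norm (e + deriv (q x) u *s b) \<le> L"
        proof
          fix u assume u: "u \<in> cball t2 R"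
          have qxf: "q x = (\<lambda>u. q 0 u + of_real x * ia u)" by (rule ext) (rule qx)
          have uN: "u \<in> N" using u RN by blast
          have "(q 0 has_field_derivative deriv (q 0) u) (at u)" "(ia has_field_derivative deriv ia u) (at u)"
            using qh iah N(1) uN holomorphic_derivI by blast+
          then have "((\<lambda>u. q 0 u + of_real x * ia u) has_field_derivative deriv (q 0) u + of_real x * deriv ia u) (at u)"
            by (auto intro!: derivative_eq_intros)
          then have "deriv (q x) u = deriv (q 0) u + of_real x * deriv ia u"
            unfolding qxf[symmetric] by (rule DERIV_imp_deriv)
          moreover have "norm (of_real x * deriv ia u) \<le> 1 * A1"
            unfolding norm_mult using A1[OF u] x x1(2) by (intro mult_mono) auto
          ultimately have "norm (deriv (q x) u) \<le> A2 + A1"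
            using norm_triangle_ineq[of "deriv (q 0) u" "of_real x * deriv ia u"] A2[OF u] by simp
          then have "norm (deriv (q x) u *s b) \<le> (A2 + A1) * norm b"
            unfolding norm_vector_scalar_mult by (rule mult_right_mono) simp
          then show "norm (e + deriv (q x) u *s b) \<le> L"
            unfolding L_def using norm_triangle_ineq[of e "deriv (q x) u *s b"] by linarith
        qed
      qed
      \<comment> \<open>hence \<open>f\<close> is not identically zero on the curve for \<open>x = 0\<close>, and its zeros there are isolated\<close>
      have "\<exists>t3\<in>ball t2 R. t3 \<notin> E"
      proof (cases "t2 = t1")
        case True
        then have "t1 + of_real (R / 2) \<notin> E" using t2(2)[of "t1 + of_real (R / 2)"] R(1) by (auto simp: dist_norm)
        then show ?thesis using True R(1) by (intro bexI[of _ "t1 + of_real (R / 2)"]) (auto simp: dist_norm)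
      next
        case False
        define d where "d = of_real (R / (2 * norm (t2 - t1))) * (t2 - t1)"
        have nd: "norm d = R / 2" unfolding d_def norm_mult norm_of_real using False R(1) by simp
        have "dist t1 (t2 + d) = norm (of_real (1 + R / (2 * norm (t2 - t1))) * (t2 - t1))"
          unfolding d_def dist_norm by (subst norm_minus_commute) (simp add: algebra_simps)
        also have "\<dots> = norm (t2 - t1) + R / 2"
          unfolding norm_mult norm_of_real using False R(1) by (simp add: algebra_simps add_nonneg_nonneg)
        finally have "dist t1 (t2 + d) > dist t1 t2" using R(1) by (simp add: dist_norm norm_minus_commute)
        then have "t2 + d \<notin> E" using t2(2) by fastforce
        then show ?thesis using nd R(1) by (intro bexI[of _ "t2 + d"]) (auto simp: dist_norm)
      qed
      then obtain t3 where t3: "t3 \<in> ball t2 R" "t3 \<notin> E" by blast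
      have z0: "0 \<in> {0..x1}" using x1 by simp
      have t3R: "t3 \<in> cball t2 R" using t3(1) by simp
      then have "t3 \<in> cball t1 \<tau>1" using R1 ball_subset_cball by blast
      then have g3: "f (\<gamma> 0 t3) \<noteq> 0"
        using \<gamma>0[OF z0 t3R] t3(2) by (simp add: E_def)
      have g2: "f (\<gamma> 0 t2) = 0" using \<gamma>0[OF z0, of t2] t2v R(1) by simp
      obtain r0 where r0: "r0 > 0" "ball t2 r0 \<subseteq> ball t2 R" "\<forall>t\<in>ball t2 r0 - {t2}. f (\<gamma> 0 t) \<noteq> 0"
        using holo_comparable_isolated_zero[OF cmpx[OF z0] _ g2 t3(1) g3] R(1) by auto
      define r where "r = min r0 R / 2"
      have r: "r > 0" "r < r0" "r < R" using r0(1) R(1) by (auto simp: r_def)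
      have rR: "cball t2 r \<subseteq> cball t2 R" using r by auto
      have contF: "continuous_on ({0..x1} \<times> cball t2 r) (\<lambda>p. f (\<gamma> (fst p) (snd p)))"
      proof (rule continuous_on_compose2[OF f])
        have "continuous_on ({0..x1} \<times> cball t2 r) (\<lambda>p. q 0 (snd p))" "continuous_on ({0..x1} \<times> cball t2 r) (\<lambda>p. ia (snd p))"
          using rR by (auto intro!: continuous_on_compose2[OF cont_q0] continuous_on_compose2[OF iac] continuous_intros)
        then have "continuous_on ({0..x1} \<times> cball t2 r) (\<lambda>p. q 0 (snd p) + of_real (fst p) * ia (snd p))"
          by (intro continuous_intros)
        then have "continuous_on ({0..x1} \<times> cball t2 r) (\<lambda>p. q (fst p) (snd p))"
          by (simp only: qx[symmetric])
        then show "continuous_on ({0..x1} \<times> cball t2 r) (\<lambda>p. \<gamma> (fst p) (snd p))"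
          unfolding \<gamma>_def by (intro continuous_intros)
      qed (use \<gamma>\<Omega> rR in auto)
      have "continuous_on (sphere t2 r) (\<lambda>u. f (\<gamma> 0 u))"
      proof -
        have cp: "continuous_on (sphere t2 r) (\<lambda>u. (0::real, u))"
          by (rule continuous_on_Pair[OF continuous_on_const continuous_on_id])
        have "(\<lambda>u. (0::real, u)) ` sphere t2 r \<subseteq> {0..x1} \<times> cball t2 r" using x1 by auto
        from continuous_on_compose2[OF contF cp this] show ?thesis by simp
      qed
      moreover have "f (\<gamma> 0 u) \<noteq> 0" if "u \<in> sphere t2 r" for u using r0(3) that r by auto
      ultimately obtain \<mu> where \<mu>: "\<mu> > 0" "\<And>u. u \<in> sphere t2 r \<Longrightarrow> \<mu> \<le> norm (f (\<gamma> 0 u))"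
        using continuous_nonzero_on_compact_bounded_below[OF compact_sphere, of t2 r "\<lambda>u. f (\<gamma> 0 u)"] by blast
      have "uniformly_continuous_on ({0..x1} \<times> cball t2 r) (\<lambda>p. f (\<gamma> (fst p) (snd p)))"
        by (intro compact_uniformly_continuous contF compact_Times) auto
      moreover define \<eta> where "\<eta> = min (\<mu> / 2) (exp (- 2 * M') * (\<mu> / 2))"
      have \<eta>: "\<eta> > 0" using \<mu>(1) by (simp add: \<eta>_def)
      ultimately obtain \<delta> where \<delta>: "\<delta> > 0" "\<And>p p'. p \<in> {0..x1} \<times> cball t2 r \<Longrightarrow> p' \<in> {0..x1} \<times> cball t2 r \<Longrightarrow>
          dist p' p < \<delta> \<Longrightarrow> dist (f (\<gamma> (fst p') (snd p'))) (f (\<gamma> (fst p) (snd p))) < \<eta>"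
        unfolding uniformly_continuous_on_def by metis
      define x where "x = min x1 (\<delta> / 2)"
      have x: "x > 0" "x \<in> {0..x1}" "x < \<delta>" using x1 \<delta>(1) by (auto simp: x_def)
      have close: "norm (f (\<gamma> x u) - f (\<gamma> 0 u)) < \<eta>" if "u \<in> cball t2 r" for u
        using \<delta>(2)[of "(0, u)" "(x, u)"] that x z0 by (simp add: dist_Pair_Pair dist_norm)
      have "\<exists>u\<in>ball t2 r. f (\<gamma> x u) = 0"
      proof (rule holo_comparable_zero_in_ball[OF cmpx[OF x(2)] r(1,3)])
        fix u assume u: "u \<in> sphere t2 r"
        then have "norm (f (\<gamma> x u) - f (\<gamma> 0 u)) < \<mu> / 2" using close[of u] by (auto simp: \<eta>_def)
        then show "\<mu> / 2 \<le> norm (f (\<gamma> x u))"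
          using \<mu>(2)[OF u] norm_triangle_ineq2[of "f (\<gamma> 0 u)" "f (\<gamma> x u)"] by (simp add: norm_minus_commute)
      next
        show "norm (f (\<gamma> x t2)) < exp (- 2 * M') * (\<mu> / 2)"
          using close[of t2] r(1) g2 by (simp add: \<eta>_def)
      qed
      then obtain u where u: "u \<in> ball t2 r" "f (\<gamma> x u) = 0" by blast
      have uR: "u \<in> cball t2 R" using u(1) r by auto
      have "v u = s + of_real x" using \<gamma>0[OF x(2) uR] u(2) by simp
      then have "Re (v u) > Re (v ts)" using x(1) by (simp add: s_def)
      moreover have "u \<in> cball t1 \<tau>1" using uR R1 ball_subset_cball by blast
      ultimately show False using ts(2)[of u] by simp
    qed
  qed
  then obtain F where F: "F holomorphic_on ball x0 \<tau>" "\<And>z. z \<in> ball x0 \<tau> \<Longrightarrow> c z = F z" by blast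
  show ?thesis by (rule holomorphic_transform[OF F(1)]) (use F(2) in simp)
qed

section \<open>Zeros in parallel slices\<close>

text \<open>For all base points \<open>z\<close> in a ball, the zeros of \<open>f\<close> in the slice \<open>w \<mapsto> z + w *s b\<close> stay away from the
  boundary of a fixed disc and are bounded in number. The radius is at most \<open>1 / 2\<close> so that the zeros
  and their differences have norm at most \<open>1\<close> and can be dropped from products in upper bounds.\<close>

locale zero_slices =
  fixes \<Omega> :: "(complex ^ 'n) set" and f :: "complex ^ 'n \<Rightarrow> complex"
    and p b :: "complex ^ 'n" and \<delta> r :: real and bound :: nat
  assumes contf: "continuous_on \<Omega> f" and cmp: "curve_comparable \<Omega> f"
    and \<delta>: "\<delta> > 0" and r: "r > 0" "r \<le> 1 / 2"
    and dom: "\<And>z w. z \<in> ball p \<delta> \<Longrightarrow> w \<in> cball 0 r \<Longrightarrow> z + w *s b \<in> \<Omega>"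
    and bdry: "\<And>z w. z \<in> ball p \<delta> \<Longrightarrow> w \<in> sphere 0 r \<Longrightarrow> f (z + w *s b) \<noteq> 0"
    and fin: "\<And>z. z \<in> ball p \<delta> \<Longrightarrow> finite {w \<in> ball 0 r. f (z + w *s b) = 0}"
    and card_bound: "\<And>z. z \<in> ball p \<delta> \<Longrightarrow> card {w \<in> ball 0 r. f (z + w *s b) = 0} \<le> bound"
begin

definition slice_zeros :: "complex ^ 'n \<Rightarrow> complex set" where
  "slice_zeros z = {w \<in> ball 0 r. f (z + w *s b) = 0}"

lemma finite_slice_zeros: "z \<in> ball p \<delta> \<Longrightarrow> finite (slice_zeros z)"
  using fin by (simp add: slice_zeros_def)

lemma slice_zeros_ball: "w \<in> slice_zeros z \<Longrightarrow> norm w < r"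
  by (simp add: slice_zeros_def)

lemma slice_uniform:
  assumes z0: "z0 \<in> ball p \<delta>" and e: "e > 0"
  shows "\<exists>d>0. \<forall>z\<in>ball z0 d. z \<in> ball p \<delta> \<and> (\<forall>w\<in>cball 0 r. norm (f (z + w *s b) - f (z0 + w *s b)) < e)"
proof -
  obtain d1 where d1: "d1 > 0" "cball z0 d1 \<subseteq> ball p \<delta>"
    using z0 by (meson open_ball open_contains_cball)
  have "continuous_on (cball z0 d1 \<times> cball 0 r) (\<lambda>x. f (fst x + snd x *s b))"
    by (rule continuous_on_compose2[OF contf]) (use dom d1 in \<open>auto intro!: continuous_intros\<close>)
  then have "uniformly_continuous_on (cball z0 d1 \<times> cball 0 r) (\<lambda>x. f (fst x + snd x *s b))"
    by (intro compact_uniformly_continuous compact_Times compact_cball)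
  then obtain d where d: "d > 0" "\<And>x y. x \<in> cball z0 d1 \<times> cball 0 r \<Longrightarrow> y \<in> cball z0 d1 \<times> cball 0 r \<Longrightarrow> dist y x < d \<Longrightarrow>
      dist (f (fst y + snd y *s b)) (f (fst x + snd x *s b)) < e"
    using e unfolding uniformly_continuous_on_def by metis
  have "z \<in> ball p \<delta> \<and> (\<forall>w\<in>cball 0 r. norm (f (z + w *s b) - f (z0 + w *s b)) < e)" if z: "z \<in> ball z0 (min d d1)" for z
  proof (intro conjI ballI)
    have z1: "z \<in> cball z0 d1" using z by simp
    then show "z \<in> ball p \<delta>" using d1(2) by blast
    fix w :: complex assume w: "w \<in> cball 0 r"
    have "dist (z, w) (z0, w) < d" using z by (simp add: dist_Pair_Pair dist_commute)
    then show "norm (f (z + w *s b) - f (z0 + w *s b)) < e"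
      using d(2)[of "(z0, w)" "(z, w)"] z1 w d1(1) by (simp add: dist_norm)
  qed
  then show ?thesis using d(1) d1(1) by (intro exI[of _ "min d d1"]) auto
qed

text \<open>Hurwitz's theorem on a small disc around \<open>w0\<close> that contains no other zero of the slice.\<close>

lemma zero_persists:
  assumes z0: "z0 \<in> ball p \<delta>" and w0: "w0 \<in> slice_zeros z0" and e: "e > 0"
  shows "\<exists>d>0. \<forall>z\<in>ball z0 d. z \<in> ball p \<delta> \<and> (\<exists>w\<in>slice_zeros z. dist w0 w < e)"
proof -
  have w0r: "w0 \<in> ball 0 r" "f (z0 + w0 *s b) = 0" using w0 by (auto simp: slice_zeros_def)
  obtain \<rho>1 where \<rho>1: "\<rho>1 > 0" "cball w0 \<rho>1 \<subseteq> ball 0 r" using w0r by (meson open_ball open_contains_cball)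
  obtain \<rho>2 where \<rho>2: "\<rho>2 > 0" "\<And>w. w \<in> slice_zeros z0 \<Longrightarrow> w \<noteq> w0 \<Longrightarrow> \<rho>2 \<le> dist w0 w"
    using finite_set_avoid[OF finite_slice_zeros[OF z0]] by metis
  define \<rho> where "\<rho> = min (min \<rho>1 \<rho>2) e / 2"
  have \<rho>: "\<rho> > 0" "\<rho> < \<rho>1" "\<rho> < \<rho>2" "\<rho> < e" using \<rho>1 \<rho>2 e by (auto simp: \<rho>_def)
  have sub: "cball w0 \<rho>1 \<subseteq> cball 0 r" using \<rho>1(2) by auto
  have sph: "sphere w0 \<rho> \<subseteq> cball w0 \<rho>1" using \<rho> by auto
  have "f (z0 + w *s b) \<noteq> 0" if w: "w \<in> sphere w0 \<rho>" for w
  proof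
    assume "f (z0 + w *s b) = 0"
    moreover have "w \<in> ball 0 r" using w sph \<rho>1(2) by blast
    ultimately have "w \<in> slice_zeros z0" by (simp add: slice_zeros_def)
    moreover have "w \<noteq> w0" using w \<rho> by auto
    ultimately have "\<rho>2 \<le> dist w0 w" by (rule \<rho>2(2))
    then show False using w \<rho> by simp
  qed
  moreover have "continuous_on (sphere w0 \<rho>) (\<lambda>w. f (z0 + w *s b))"
    by (rule continuous_on_compose2[OF contf]) (use dom[OF z0] sph sub in \<open>auto intro!: continuous_intros\<close>)
  ultimately obtain \<mu> where \<mu>: "\<mu> > 0" "\<And>w. w \<in> sphere w0 \<rho> \<Longrightarrow> \<mu> \<le> norm (f (z0 + w *s b))"
    using continuous_nonzero_on_compact_bounded_below[OF compact_sphere, of w0 \<rho> "\<lambda>w. f (z0 + w *s b)"] by blast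
  obtain M where M: "\<And>t0 V \<gamma> \<gamma>'.
        holo_curve V \<gamma> \<gamma>' \<Longrightarrow> cball t0 \<rho>1 \<subseteq> V \<Longrightarrow> \<gamma> ` cball t0 \<rho>1 \<subseteq> \<Omega> \<Longrightarrow>
        (\<forall>t\<in>cball t0 \<rho>1. norm (\<gamma>' t) \<le> norm b) \<Longrightarrow> holo_comparable M (ball t0 \<rho>1) (\<lambda>t. f (\<gamma> t))"
    using cmp \<rho>1(1) norm_ge_zero[of b] unfolding curve_comparable_def by meson
  define \<eta> where "\<eta> = min (\<mu> / 2) (exp (- 2 * M) * (\<mu> / 2))"
  have \<eta>: "\<eta> > 0" using \<mu>(1) by (simp add: \<eta>_def)
  obtain d where d: "d > 0" "\<And>z. z \<in> ball z0 d \<Longrightarrow> z \<in> ball p \<delta>"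
     "\<And>z w. z \<in> ball z0 d \<Longrightarrow> w \<in> cball 0 r \<Longrightarrow> norm (f (z + w *s b) - f (z0 + w *s b)) < \<eta>"
    using slice_uniform[OF z0 \<eta>] by blast
  have "\<exists>w\<in>slice_zeros z. dist w0 w < e" if z: "z \<in> ball z0 d" for z
  proof -
    have "\<exists>w\<in>ball w0 \<rho>. f (z + w *s b) = 0"
    proof (rule holo_comparable_zero_in_ball[OF _ \<rho>(1,2)])
      show "holo_comparable M (ball w0 \<rho>1) (\<lambda>w. f (z + w *s b))"
        by (rule M[OF holo_curve_line]) (use dom[OF d(2)[OF z]] sub in auto)
      show "\<mu> / 2 \<le> norm (f (z + w *s b))" if w: "w \<in> sphere w0 \<rho>" for w
      proof -
        have "norm (f (z + w *s b) - f (z0 + w *s b)) < \<mu> / 2"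
          using d(3)[OF z, of w] w sph sub by (force simp: \<eta>_def)
        then show ?thesis
          using \<mu>(2)[OF w] norm_triangle_ineq2[of "f (z0 + w *s b)" "f (z + w *s b)"] by (simp add: norm_minus_commute)
      qed
      show "norm (f (z + w0 *s b)) < exp (- 2 * M) * (\<mu> / 2)"
        using d(3)[OF z, of w0] w0r by (simp add: \<eta>_def)
    qed
    then obtain w where w: "w \<in> ball w0 \<rho>" "f (z + w *s b) = 0" by blast
    have "w \<in> cball w0 \<rho>1" using w(1) \<rho>(2) by simp
    then have "w \<in> slice_zeros z" using \<rho>1(2) w(2) by (auto simp: slice_zeros_def)
    then show ?thesis using w(1) \<rho>(4) by (intro bexI[of _ w]) auto
  qed
  then show ?thesis using d(1,2) by blast
qed

text \<open>Away from the zeros of the slice through \<open>z0\<close>, the function is bounded below on a compact set.\<close>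

lemma zeros_near:
  assumes z0: "z0 \<in> ball p \<delta>" and e: "e > 0"
  shows "\<exists>d>0. \<forall>z\<in>ball z0 d. z \<in> ball p \<delta> \<and> (\<forall>w\<in>slice_zeros z. \<exists>w0\<in>slice_zeros z0. dist w0 w < e)"
proof -
  define C where "C = cball 0 r - (\<Union>w0\<in>slice_zeros z0. ball w0 e)"
  have C: "compact C" unfolding C_def by (intro compact_diff compact_cball open_UN ballI open_ball)
  have "f (z0 + w *s b) \<noteq> 0" if w: "w \<in> C" for w
  proof (cases "w \<in> sphere 0 r")
    case True
    then show ?thesis using bdry[OF z0] by blast
  next
    case False
    have "w \<notin> slice_zeros z0" using w e by (auto simp: C_def)
    then show ?thesis using False w by (auto simp: slice_zeros_def C_def)
  qed
  moreover have "continuous_on C (\<lambda>w. f (z0 + w *s b))"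
    by (rule continuous_on_compose2[OF contf]) (use dom[OF z0] in \<open>auto intro!: continuous_intros simp: C_def\<close>)
  ultimately obtain \<mu> where \<mu>: "\<mu> > 0" "\<And>w. w \<in> C \<Longrightarrow> \<mu> \<le> norm (f (z0 + w *s b))"
    using continuous_nonzero_on_compact_bounded_below[OF C, of "\<lambda>w. f (z0 + w *s b)"] by blast
  obtain d where d: "d > 0" "\<And>z. z \<in> ball z0 d \<Longrightarrow> z \<in> ball p \<delta>"
     "\<And>z w. z \<in> ball z0 d \<Longrightarrow> w \<in> cball 0 r \<Longrightarrow> norm (f (z + w *s b) - f (z0 + w *s b)) < \<mu>"
    using slice_uniform[OF z0 \<mu>(1)] by blast
  have "\<exists>w0\<in>slice_zeros z0. dist w0 w < e" if z: "z \<in> ball z0 d" and w: "w \<in> slice_zeros z" for z w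
  proof (rule ccontr)
    assume "\<not> ?thesis"
    then have wC: "w \<in> C" using w by (auto simp: C_def slice_zeros_def)
    have "w \<in> cball 0 r" using w by (simp add: slice_zeros_def)
    from d(3)[OF z this] \<mu>(2)[OF wC] w show False by (simp add: slice_zeros_def)
  qed
  then show ?thesis using d(1,2) by blast
qed

definition max_card :: nat where "max_card = Max ((\<lambda>z. card (slice_zeros z)) ` ball p \<delta>)"

text \<open>The generic base points. The number of distinct zeros is lower semicontinuous by \<open>zero_persists\<close>,
  so near a point where it is maximal no zero can split, and the zeros are functions of \<open>z\<close>.\<close>

definition V :: "(complex ^ 'n) set" where "V = {z \<in> ball p \<delta>. card (slice_zeros z) = max_card}"

lemma finite_cards: "finite ((\<lambda>z. card (slice_zeros z)) ` ball p \<delta>)"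
  by (rule finite_subset[of _ "{..bound}"]) (use card_bound in \<open>auto simp: slice_zeros_def\<close>)

lemma card_le_max_card: "z \<in> ball p \<delta> \<Longrightarrow> card (slice_zeros z) \<le> max_card"
  unfolding max_card_def by (intro Max_ge finite_cards imageI)

lemma V_nonempty: "V \<noteq> {}"
proof -
  have "max_card \<in> (\<lambda>z. card (slice_zeros z)) ` ball p \<delta>"
    unfolding max_card_def by (rule Max_in[OF finite_cards]) (use \<delta> in auto)
  then show ?thesis by (auto simp: V_def)
qed

lemma V_subset: "V \<subseteq> ball p \<delta>" by (auto simp: V_def)

text \<open>The functions \<open>c w\<close>, indexed by the zeros \<open>w\<close> of the slice through \<open>z0\<close>, parametrise the zeros of
  the slices through the points of \<open>ball z0 d\<close>.\<close>

definition sheets :: "complex ^ 'n \<Rightarrow> real \<Rightarrow> real \<Rightarrow> (complex \<Rightarrow> complex ^ 'n \<Rightarrow> complex) \<Rightarrow> bool" where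
  "sheets z0 d e c \<longleftrightarrow> d > 0 \<and> e > 0 \<and> ball z0 d \<subseteq> V \<and>
    (\<forall>w\<in>slice_zeros z0. ball w e \<subseteq> ball 0 r) \<and>
    (\<forall>z\<in>ball z0 d. inj_on (\<lambda>w. c w z) (slice_zeros z0) \<and> slice_zeros z = (\<lambda>w. c w z) ` slice_zeros z0) \<and>
    (\<forall>w0\<in>slice_zeros z0. \<forall>z\<in>ball z0 d. c w0 z \<in> ball w0 e \<and>
      (\<forall>w\<in>ball w0 e. f (z + w *s b) = 0 \<longleftrightarrow> w = c w0 z))"

lemma sheetsD:
  assumes "sheets z0 d e c"
  shows "d > 0" "e > 0" "ball z0 d \<subseteq> V"
    "w \<in> slice_zeros z0 \<Longrightarrow> ball w e \<subseteq> ball 0 r"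
    "z \<in> ball z0 d \<Longrightarrow> inj_on (\<lambda>w. c w z) (slice_zeros z0)"
    "z \<in> ball z0 d \<Longrightarrow> slice_zeros z = (\<lambda>w. c w z) ` slice_zeros z0"
    "w0 \<in> slice_zeros z0 \<Longrightarrow> z \<in> ball z0 d \<Longrightarrow> c w0 z \<in> ball w0 e"
    "w0 \<in> slice_zeros z0 \<Longrightarrow> z \<in> ball z0 d \<Longrightarrow> w \<in> ball w0 e \<Longrightarrow> f (z + w *s b) = 0 \<longleftrightarrow> w = c w0 z"
proof -
  note A = assms[unfolded sheets_def]
  note A3 = A[THEN conjunct2, THEN conjunct2] and A5 = A[THEN conjunct2, THEN conjunct2, THEN conjunct2, THEN conjunct2]
  show "d > 0" by (rule A[THEN conjunct1])
  show "e > 0" by (rule A[THEN conjunct2, THEN conjunct1])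
  show "ball z0 d \<subseteq> V" by (rule A3[THEN conjunct1])
  show "w \<in> slice_zeros z0 \<Longrightarrow> ball w e \<subseteq> ball 0 r" by (rule bspec[OF A3[THEN conjunct2, THEN conjunct1]])
  show "z \<in> ball z0 d \<Longrightarrow> inj_on (\<lambda>w. c w z) (slice_zeros z0)"
    by (rule bspec[OF A5[THEN conjunct1], THEN conjunct1])
  show "z \<in> ball z0 d \<Longrightarrow> slice_zeros z = (\<lambda>w. c w z) ` slice_zeros z0"
    by (rule bspec[OF A5[THEN conjunct1], THEN conjunct2])
  assume w0: "w0 \<in> slice_zeros z0" and z: "z \<in> ball z0 d"
  note B = bspec[OF bspec[OF A5[THEN conjunct2] w0] z]
  show "c w0 z \<in> ball w0 e" by (rule B[THEN conjunct1])
  show "w \<in> ball w0 e \<Longrightarrow> f (z + w *s b) = 0 \<longleftrightarrow> w = c w0 z" by (rule bspec[OF B[THEN conjunct2]])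
qed

lemma local_sheets:
  assumes z0: "z0 \<in> V"
  shows "\<exists>d e c. sheets z0 d e c"
proof -
  have z0B: "z0 \<in> ball p \<delta>" and cardz0: "card (slice_zeros z0) = max_card" using z0 by (auto simp: V_def)
  have F: "finite (slice_zeros z0)" by (rule finite_slice_zeros[OF z0B])
  have "\<exists>e>0. ball w e \<subseteq> ball 0 r \<and> (\<forall>w'\<in>slice_zeros z0. w' \<noteq> w \<longrightarrow> 2 * e \<le> dist w w')" if w: "w \<in> slice_zeros z0" for w
  proof -
    obtain e1 where e1: "e1 > 0" "ball w e1 \<subseteq> ball 0 r"
      using w unfolding slice_zeros_def by (metis (no_types, lifting) mem_Collect_eq open_ball open_contains_ball)
    obtain e2 where e2: "e2 > 0" "\<And>w'. w' \<in> slice_zeros z0 \<Longrightarrow> w' \<noteq> w \<Longrightarrow> e2 \<le> dist w w'"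
      using finite_set_avoid[OF F] by metis
    \<comment> \<open>half of the distance, to make the discs around different zeros disjoint\<close>
    show ?thesis
      using e1 e2 by (intro exI[of _ "min e1 (e2 / 2)"]) force
  qed
  then obtain ee where ee: "\<And>w. w \<in> slice_zeros z0 \<Longrightarrow> ee w > 0" "\<And>w. w \<in> slice_zeros z0 \<Longrightarrow> ball w (ee w) \<subseteq> ball 0 r"
      "\<And>w w'. w \<in> slice_zeros z0 \<Longrightarrow> w' \<in> slice_zeros z0 \<Longrightarrow> w' \<noteq> w \<Longrightarrow> 2 * ee w \<le> dist w w'"
    by metis
  define e where "e = Min (insert 1 (ee ` slice_zeros z0))"
  have e: "e > 0" "\<And>w. w \<in> slice_zeros z0 \<Longrightarrow> e \<le> ee w" using F ee(1) by (auto simp: e_def)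
  have ball_r: "ball w e \<subseteq> ball 0 r" if "w \<in> slice_zeros z0" for w
    using ee(2)[OF that] e(2)[OF that] by (meson order_trans subset_ball)
  have sep: "2 * e \<le> dist w w'" if "w \<in> slice_zeros z0" "w' \<in> slice_zeros z0" "w' \<noteq> w" for w w'
    using ee(3)[OF that] e(2)[OF that(1)] by linarith
  have "\<exists>d>0. \<forall>z\<in>ball z0 d. z \<in> ball p \<delta> \<and> (\<exists>w'\<in>slice_zeros z. dist w w' < e)" if "w \<in> slice_zeros z0" for w
    by (rule zero_persists[OF z0B that e(1)])
  then obtain dd where dd: "\<And>w. w \<in> slice_zeros z0 \<Longrightarrow> dd w > 0"
      "\<And>w z. w \<in> slice_zeros z0 \<Longrightarrow> z \<in> ball z0 (dd w) \<Longrightarrow> \<exists>w'\<in>slice_zeros z. dist w w' < e"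
    by metis
  obtain d0 where d0: "d0 > 0" "ball z0 d0 \<subseteq> ball p \<delta>" using z0B by (meson open_ball open_contains_ball)
  define d where "d = Min (insert d0 (dd ` slice_zeros z0))"
  have d: "d > 0" "d \<le> d0" "\<And>w. w \<in> slice_zeros z0 \<Longrightarrow> d \<le> dd w" using F dd(1) d0(1) by (auto simp: d_def)
  define c where "c w z = (SOME w'. w' \<in> slice_zeros z \<and> dist w w' < e)" for w z
  have c: "c w z \<in> slice_zeros z \<and> dist w (c w z) < e" if "w \<in> slice_zeros z0" "z \<in> ball z0 d" for w z
  proof -
    have "z \<in> ball z0 (dd w)" using that(2) d(3)[OF that(1)] by simp
    then show ?thesis unfolding c_def using dd(2)[OF that(1)] by (metis (mono_tags, lifting) someI_ex)
  qed
  have zB: "z \<in> ball p \<delta>" if "z \<in> ball z0 d" for z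
  proof -
    have "z \<in> ball z0 d0" using that d(2) by simp
    then show ?thesis using d0(2) by blast
  qed
  have inj: "inj_on (\<lambda>w. c w z) (slice_zeros z0)" if z: "z \<in> ball z0 d" for z
  proof (rule inj_onI, rule ccontr)
    fix w w' assume w: "w \<in> slice_zeros z0" "w' \<in> slice_zeros z0" "c w z = c w' z" "w \<noteq> w'"
    have "dist w w' \<le> dist w (c w z) + dist w' (c w z)" using dist_triangle2 by blast
    also have "\<dots> < 2 * e" using c[OF w(1) z] c[OF w(2) z] w(3) by simp
    finally show False using sep[OF w(1,2)] w(4) by simp
  qed
  have im: "slice_zeros z = (\<lambda>w. c w z) ` slice_zeros z0" and cz: "card (slice_zeros z) = max_card" if z: "z \<in> ball z0 d" for z
  proof -
    have sub: "(\<lambda>w. c w z) ` slice_zeros z0 \<subseteq> slice_zeros z" using c z by blast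
    have card: "card ((\<lambda>w. c w z) ` slice_zeros z0) = max_card" using card_image[OF inj[OF z]] cardz0 by simp
    have "card (slice_zeros z) \<le> card ((\<lambda>w. c w z) ` slice_zeros z0)" using card card_le_max_card[OF zB[OF z]] by simp
    then show eq: "slice_zeros z = (\<lambda>w. c w z) ` slice_zeros z0"
      using card_seteq[OF finite_slice_zeros[OF zB[OF z]] sub] by simp
    show "card (slice_zeros z) = max_card" using eq card by simp
  qed
  have uniq: "f (z + w *s b) = 0 \<longleftrightarrow> w = c w0 z" if w0: "w0 \<in> slice_zeros z0" and z: "z \<in> ball z0 d" and w: "w \<in> ball w0 e" for w0 z w
  proof
    assume "f (z + w *s b) = 0"
    then have "w \<in> slice_zeros z" using w ball_r[OF w0] by (auto simp: slice_zeros_def)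
    then obtain w1 where w1: "w1 \<in> slice_zeros z0" "w = c w1 z" using im[OF z] by blast
    have "w1 = w0"
    proof (rule ccontr)
      assume "w1 \<noteq> w0"
      then have "2 * e \<le> dist w0 w1" using sep[OF w0 w1(1)] by simp
      moreover have "dist w0 w1 \<le> dist w0 w + dist w1 w" using dist_triangle2 by blast
      moreover have "dist w1 w < e" using c[OF w1(1) z] w1(2) by simp
      ultimately show False using w by simp
    qed
    then show "w = c w0 z" using w1 by simp
  qed (use c[OF w0 z] in \<open>auto simp: slice_zeros_def\<close>)
  have dV: "ball z0 d \<subseteq> V" using zB cz by (auto simp: V_def)
  have cball: "c w0 z \<in> ball w0 e" if "w0 \<in> slice_zeros z0" "z \<in> ball z0 d" for w0 z
    using c[OF that] by simp
  have "sheets z0 d e c"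
    unfolding sheets_def using d(1) e(1) dV ball_r inj im uniq cball by (intro conjI ballI)
  then show ?thesis by blast
qed

lemma open_V: "open V"
  unfolding open_contains_ball
proof
  fix z0 assume "z0 \<in> V"
  then obtain d e c where "sheets z0 d e c" using local_sheets by blast
  then have "d > 0" "ball z0 d \<subseteq> V" by (simp_all add: sheets_def)
  then show "\<exists>d>0. ball z0 d \<subseteq> V" by blast
qed

lemma prod_continuous_holo:
  assumes "finite I" "\<And>i. i \<in> I \<Longrightarrow> continuous_on S (g i)" "\<And>i. i \<in> I \<Longrightarrow> holo_along_lines S (g i)"
  shows "continuous_on S (\<lambda>z. \<Prod>i\<in>I. g i z)" "holo_along_lines S (\<lambda>z. \<Prod>i\<in>I. g i z)"
proof -
  show "continuous_on S (\<lambda>z. \<Prod>i\<in>I. g i z)" using assms(2) by (intro continuous_intros)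
  show "holo_along_lines S (\<lambda>z. \<Prod>i\<in>I. g i z)"
    using assms(1,3)
    by (induction I rule: finite_induct) (auto simp: holo_along_lines_def intro!: derivative_intros)
qed

text \<open>Up to sign the constant coefficient of the monic polynomial whose zeros are the zeros of the
  slice; it vanishes if and only if \<open>w = 0\<close> is among them.\<close>

definition G :: "complex ^ 'n \<Rightarrow> complex" where "G z = (\<Prod>w\<in>slice_zeros z. w)"

text \<open>Up to sign the discriminant of the monic polynomial with the same simple zeros.\<close>

definition discr :: "complex ^ 'n \<Rightarrow> complex" where "discr z = (\<Prod>w\<in>slice_zeros z. \<Prod>w'\<in>slice_zeros z - {w}. w - w')"

text \<open>On each complex line through the base points, a sheet satisfies the hypotheses of
  \<open>single_sheet_holomorphic\<close>; its continuity follows from the persistence of zeros and uniqueness.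
  The two products are then products over a fixed index set.\<close>

lemma local_holo:
  assumes z0: "z0 \<in> V"
  shows "\<exists>d>0. ball z0 d \<subseteq> V \<and> continuous_on (ball z0 d) G \<and> holo_along_lines (ball z0 d) G \<and>
    continuous_on (ball z0 d) discr \<and> holo_along_lines (ball z0 d) discr"
proof -
  obtain d e c where sh: "sheets z0 d e c" using local_sheets[OF z0] by blast
  have d: "d > 0" and e: "e > 0" and dV: "ball z0 d \<subseteq> V" using sheetsD(1,2,3)[OF sh] by auto
  have er: "ball w e \<subseteq> ball 0 r" if "w \<in> slice_zeros z0" for w
    by (rule sheetsD(4)[OF sh that])
  have inj: "inj_on (\<lambda>w. c w z) (slice_zeros z0)" and im: "slice_zeros z = (\<lambda>w. c w z) ` slice_zeros z0" if "z \<in> ball z0 d" for z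
    by (rule sheetsD(5,6)[OF sh that])+
  have uniq: "f (z + w *s b) = 0 \<longleftrightarrow> w = c w0 z" if "w0 \<in> slice_zeros z0" "z \<in> ball z0 d" "w \<in> ball w0 e" for w0 z w
    by (rule sheetsD(8)[OF sh that])
  have cin: "c w0 z \<in> ball w0 e" if "w0 \<in> slice_zeros z0" "z \<in> ball z0 d" for w0 z
    by (rule sheetsD(7)[OF sh that])
  have F: "finite (slice_zeros z0)" using finite_slice_zeros z0 V_subset by blast
  have cc: "continuous_on (ball z0 d) (c w0)" if w0: "w0 \<in> slice_zeros z0" for w0
    unfolding continuous_on_iff
  proof (intro ballI allI impI)
    fix z and e1 :: real assume z: "z \<in> ball z0 d" and e1: "e1 > 0"
    obtain e2 where e2: "e2 > 0" "ball (c w0 z) e2 \<subseteq> ball w0 e"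
      using cin[OF w0 z] by (meson open_ball open_contains_ball)
    have "c w0 z \<in> slice_zeros z" using im[OF z] w0 by blast
    moreover have "z \<in> ball p \<delta>" using z dV V_subset by blast
    ultimately obtain d1 where d1: "d1 > 0" "\<And>z'. z' \<in> ball z d1 \<Longrightarrow> \<exists>w\<in>slice_zeros z'. dist (c w0 z) w < min e1 e2"
      using zero_persists[of z "c w0 z" "min e1 e2"] e1 e2(1) by auto
    have "dist (c w0 z') (c w0 z) < e1" if z': "z' \<in> ball z0 d" "dist z' z < d1" for z'
    proof -
      obtain w where w: "w \<in> slice_zeros z'" "dist (c w0 z) w < min e1 e2"
        using d1(2)[of z'] z'(2) by (auto simp: dist_commute)
      have "w \<in> ball w0 e" using w(2) e2(2) by auto
      then have "w = c w0 z'" using uniq[OF w0 z'(1)] w(1) by (simp add: slice_zeros_def)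
      then show ?thesis using w(2) by (simp add: dist_commute)
    qed
    then show "\<exists>d1>0. \<forall>x'\<in>ball z0 d. dist x' z < d1 \<longrightarrow> dist (c w0 x') (c w0 z) < e1"
      using d1(1) by blast
  qed
  have ch: "holo_along_lines (ball z0 d) (c w0)" if w0: "w0 \<in> slice_zeros z0" for w0
    unfolding holo_along_lines_def
  proof (intro ballI allI)
    fix z v :: "complex ^ 'n" assume z: "z \<in> ball z0 d"
    obtain d1 where d1: "d1 > 0" "ball z d1 \<subseteq> ball z0 d" using z by (meson open_ball open_contains_ball)
    define \<tau> where "\<tau> = d1 / (2 * (norm v + 1))"
    have nv: "norm v + 1 > 0" by (simp add: add_nonneg_pos)
    have \<tau>: "\<tau> > 0" using d1(1) nv by (simp add: \<tau>_def)
    have inb: "z + t *s v \<in> ball z0 d" if t: "t \<in> cball 0 \<tau>" for t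
    proof -
      have "norm (t *s v) \<le> \<tau> * (norm v + 1)"
        unfolding norm_vector_scalar_mult using t \<tau> by (intro mult_mono) auto
      also have "\<dots> = d1 / 2" using nv by (simp add: \<tau>_def divide_simps)
      finally have "z + t *s v \<in> ball z d1" using d1(1) by (simp add: dist_norm)
      then show ?thesis using d1(2) by blast
    qed
    have "(\<lambda>t. c w0 (z + t *s v)) holomorphic_on ball 0 \<tau>"
    proof (rule single_sheet_holomorphic[OF contf cmp \<tau>, of 0 _ w0 e z v b])
      show "continuous_on (cball 0 \<tau>) (\<lambda>t. c w0 (z + t *s v))"
        by (rule continuous_on_compose2[OF cc[OF w0]]) (use inb in \<open>auto intro!: continuous_intros\<close>)
      fix t :: complex assume t: "t \<in> cball 0 \<tau>"
      show "c w0 (z + t *s v) \<in> ball w0 e" by (rule cin[OF w0 inb[OF t]])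
      fix w :: complex assume w: "w \<in> ball w0 e"
      show "z + t *s v + w *s b \<in> \<Omega>"
      proof (rule dom)
        show "z + t *s v \<in> ball p \<delta>" using inb[OF t] dV V_subset by blast
        show "w \<in> cball 0 r" using w er[OF w0] by auto
      qed
      show "f (z + t *s v + w *s b) = 0 \<longleftrightarrow> w = c w0 (z + t *s v)" by (rule uniq[OF w0 inb[OF t] w])
    qed
    then show "(\<lambda>t. c w0 (z + t *s v)) field_differentiable (at 0)"
      using \<tau> by (intro holomorphic_on_imp_differentiable_at[of _ "ball 0 \<tau>"]) auto
  qed
  have Geq: "G z = (\<Prod>w0\<in>slice_zeros z0. c w0 z)" if "z \<in> ball z0 d" for z
    unfolding G_def im[OF that] by (subst prod.reindex[OF inj[OF that]]) simp
  have Deq: "discr z = (\<Prod>w0\<in>slice_zeros z0. \<Prod>w1\<in>slice_zeros z0 - {w0}. c w0 z - c w1 z)" if z: "z \<in> ball z0 d" for z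
  proof -
    have "discr z = (\<Prod>w0\<in>slice_zeros z0. \<Prod>w'\<in>slice_zeros z - {c w0 z}. c w0 z - w')"
      unfolding discr_def by (subst (1) im[OF z], subst prod.reindex[OF inj[OF z]]) simp
    also have "\<dots> = (\<Prod>w0\<in>slice_zeros z0. \<Prod>w1\<in>slice_zeros z0 - {w0}. c w0 z - c w1 z)"
    proof (rule prod.cong[OF refl])
      fix w0 assume w0: "w0 \<in> slice_zeros z0"
      have "slice_zeros z - {c w0 z} = (\<lambda>w. c w z) ` (slice_zeros z0 - {w0})"
        using inj[OF z] w0 unfolding im[OF z] inj_on_def by auto
      moreover have "inj_on (\<lambda>w. c w z) (slice_zeros z0 - {w0})" using inj[OF z] by (rule inj_on_subset) blast
      ultimately show "(\<Prod>w'\<in>slice_zeros z - {c w0 z}. c w0 z - w') = (\<Prod>w1\<in>slice_zeros z0 - {w0}. c w0 z - c w1 z)"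
        by (simp add: prod.reindex)
    qed
    finally show ?thesis .
  qed
  have transfer: "continuous_on (ball z0 d) h" "holo_along_lines (ball z0 d) h"
    if "continuous_on (ball z0 d) g" "holo_along_lines (ball z0 d) g" "\<And>z. z \<in> ball z0 d \<Longrightarrow> h z = g z" for g h :: "complex ^ 'n \<Rightarrow> complex"
  proof -
    show "continuous_on (ball z0 d) h" using that(1,3) by (metis (no_types, lifting) continuous_on_cong)
    show "holo_along_lines (ball z0 d) h"
      unfolding holo_along_lines_def
    proof (intro ballI allI)
      fix z v :: "complex ^ 'n" assume z: "z \<in> ball z0 d"
      have "open ((\<lambda>t. z + t *s v) -` ball z0 d)" by (intro open_vimage open_ball continuous_intros)
      then show "(\<lambda>t. h (z + t *s v)) field_differentiable (at 0)"
        unfolding field_differentiable_def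
        using has_field_derivative_transform_within_open[of "\<lambda>t. g (z + t *s v)" _ 0 "(\<lambda>t. z + t *s v) -` ball z0 d" "\<lambda>t. h (z + t *s v)"]
          that(2,3) z unfolding holo_along_lines_def field_differentiable_def by (metis (no_types, lifting) add.right_neutral vector_smult_lzero vimageE vimageI)
    qed
  qed
  have diffs: "continuous_on (ball z0 d) (\<lambda>z. c w0 z - c w1 z)" "holo_along_lines (ball z0 d) (\<lambda>z. c w0 z - c w1 z)"
    if "w0 \<in> slice_zeros z0" "w1 \<in> slice_zeros z0" for w0 w1
    using cc[OF that(1)] cc[OF that(2)] ch[OF that(1)] ch[OF that(2)]
    by (auto simp: holo_along_lines_def intro!: continuous_intros derivative_intros)
  have inner: "continuous_on (ball z0 d) (\<lambda>z. \<Prod>w1\<in>slice_zeros z0 - {w0}. c w0 z - c w1 z)"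
       "holo_along_lines (ball z0 d) (\<lambda>z. \<Prod>w1\<in>slice_zeros z0 - {w0}. c w0 z - c w1 z)" if "w0 \<in> slice_zeros z0" for w0
    using F diffs that by (intro prod_continuous_holo; simp)+
  show ?thesis
    using d dV transfer[OF prod_continuous_holo[of "slice_zeros z0" "ball z0 d" c, OF F cc ch] Geq]
      transfer[OF prod_continuous_holo[of "slice_zeros z0" "ball z0 d" "\<lambda>w0 z. \<Prod>w1\<in>slice_zeros z0 - {w0}. c w0 z - c w1 z", OF F inner] Deq]
    by blast
qed

end

lemma convex_line_in_ball: "convex {t. z + t *s e \<in> ball (p :: complex ^ 'n) \<delta>}"
proof (rule convexI)
  fix x y :: complex and u v :: real
  assume *: "x \<in> {t. z + t *s e \<in> ball p \<delta>}" "y \<in> {t. z + t *s e \<in> ball p \<delta>}" "u \<ge> 0" "v \<ge> 0" "u + v = 1"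
  have "z = u *\<^sub>R z + v *\<^sub>R z" using *(5) by (simp add: scaleR_left_distrib[symmetric])
  then have "z + (u *\<^sub>R x + v *\<^sub>R y) *s e = u *\<^sub>R z + v *\<^sub>R z + (u *\<^sub>R x + v *\<^sub>R y) *s e" by simp
  also have "\<dots> = u *\<^sub>R (z + x *s e) + v *\<^sub>R (z + y *s e)"
    by (simp add: vec_eq_iff algebra_simps)
  also have "\<dots> \<in> ball p \<delta>" using * by (intro convexD[OF convex_ball]) auto
  finally show "u *\<^sub>R x + v *\<^sub>R y \<in> {t. z + t *s e \<in> ball p \<delta>}" by simp
qed

lemma holo_along_lines_imp_holomorphic_on:
  assumes "holo_along_lines S g" "\<And>t. t \<in> T \<Longrightarrow> z + t *s v \<in> S"
  shows "(\<lambda>t. g (z + t *s v)) holomorphic_on T"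
  unfolding holomorphic_on_def using holo_along_linesD[OF assms(1)] assms(2) field_differentiable_at_within by blast

lemma open_line_preimage:
  assumes "open S"
  shows "open {t :: complex. z + t *s (v :: complex ^ 'n) \<in> S}"
proof -
  have "continuous_on UNIV (\<lambda>t :: complex. z + t *s v)" by (intro continuous_intros)
  from open_vimage[OF assms this] show ?thesis by (simp add: vimage_def)
qed

lemma line_compact_nearby:
  fixes p e :: "complex ^ 'n"
  assumes C: "compact C" and W: "open W" and CW: "\<And>t. t \<in> C \<Longrightarrow> p + t *s e \<in> W"
  shows "\<exists>d>0. \<forall>z\<in>ball p d. \<forall>t\<in>C. z + t *s e \<in> W"
proof -
  have "compact ((\<lambda>t. p + t *s e) ` C)" by (intro compact_continuous_image continuous_intros C)
  moreover have "(\<lambda>t. p + t *s e) ` C \<subseteq> W" using CW by blast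
  ultimately obtain d where d: "d > 0" "(\<Union>x\<in>(\<lambda>t. p + t *s e) ` C. ball x d) \<subseteq> W"
    using compact_subset_open_imp_ball_epsilon_subset[OF _ W] by metis
  have "z + t *s e \<in> W" if "z \<in> ball p d" "t \<in> C" for z t
  proof -
    have "z + t *s e \<in> ball (p + t *s e) d" using that(1) by (simp add: dist_norm)
    then show ?thesis using d(2) that(2) by blast
  qed
  then show ?thesis using d(1) by blast
qed

lemma norm_prod_le_factor:
  fixes g :: "'a \<Rightarrow> complex"
  assumes "finite I" "i \<in> I" "\<And>j. j \<in> I \<Longrightarrow> norm (g j) \<le> 1"
  shows "norm (\<Prod>j\<in>I. g j) \<le> norm (g i)"
proof -
  have "norm (\<Prod>j\<in>I - {i}. g j) \<le> 1"
    unfolding prod_norm[symmetric] using assms by (intro prod_le_1) auto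
  then have "norm (g i) * norm (\<Prod>j\<in>I - {i}. g j) \<le> norm (g i) * 1" by (intro mult_left_mono) auto
  then show ?thesis using prod.remove[OF assms(1,2), of g] by (simp add: norm_mult)
qed

context zero_slices
begin

lemma holo_V:
  "continuous_on V G" "holo_along_lines V G" "continuous_on V discr" "holo_along_lines V discr"
proof -
  have *: "continuous (at z) G" "continuous (at z) discr"
    "(\<lambda>t. G (z + t *s v)) field_differentiable (at 0)" "(\<lambda>t. discr (z + t *s v)) field_differentiable (at 0)"
    if z: "z \<in> V" for z v
  proof -
    obtain d where d: "d > 0" "continuous_on (ball z d) G" "holo_along_lines (ball z d) G"
      "continuous_on (ball z d) discr" "holo_along_lines (ball z d) discr"
      using local_holo[OF z] by blast
    have zd: "z \<in> ball z d" using d(1) by simp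
    show "continuous (at z) G" "continuous (at z) discr"
      using d(2,4) zd by (simp_all add: continuous_on_eq_continuous_at)
    show "(\<lambda>t. G (z + t *s v)) field_differentiable (at 0)" "(\<lambda>t. discr (z + t *s v)) field_differentiable (at 0)"
      using d(3,5) zd unfolding holo_along_lines_def by blast+
  qed
  show "continuous_on V G" "continuous_on V discr"
    using *(1,2) by (simp_all add: continuous_on_eq_continuous_at open_V)
  show "holo_along_lines V G" "holo_along_lines V discr"
    unfolding holo_along_lines_def using *(3,4) by blast+
qed

lemma discr_nonzero: "z \<in> V \<Longrightarrow> discr z \<noteq> 0"
  using finite_slice_zeros V_subset by (auto simp: discr_def subset_iff)

lemma norm_slice_zeros_le: "w \<in> slice_zeros z \<Longrightarrow> norm w \<le> 1 / 2"
  using slice_zeros_ball[of w z] r(2) by linarith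

lemma norm_G_le_factor: "z \<in> ball p \<delta> \<Longrightarrow> w \<in> slice_zeros z \<Longrightarrow> norm (G z) \<le> norm w"
  unfolding G_def by (rule norm_prod_le_factor[OF finite_slice_zeros]) (use norm_slice_zeros_le in force)+

lemma norm_G_le: "z \<in> ball p \<delta> \<Longrightarrow> norm (G z) \<le> 1"
  unfolding G_def prod_norm[symmetric] by (intro prod_le_1) (use norm_slice_zeros_le in force)

lemma norm_discr_le_dist:
  assumes z: "z \<in> ball p \<delta>" and w: "w \<in> slice_zeros z" "w' \<in> slice_zeros z" "w \<noteq> w'"
  shows "norm (discr z) \<le> dist w w'"
proof -
  have diff: "norm (u - u') \<le> 1" if "u \<in> slice_zeros z" "u' \<in> slice_zeros z" for u u'
    using norm_triangle_ineq4[of u u'] norm_slice_zeros_le[OF that(1)] norm_slice_zeros_le[OF that(2)] by linarith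
  have "norm (discr z) \<le> norm (\<Prod>u'\<in>slice_zeros z - {w}. w - u')"
    unfolding discr_def
  proof (rule norm_prod_le_factor[OF finite_slice_zeros[OF z] w(1)])
    fix u assume "u \<in> slice_zeros z"
    then show "norm (\<Prod>w'\<in>slice_zeros z - {u}. u - w') \<le> 1"
      unfolding prod_norm[symmetric] using diff by (intro prod_le_1) auto
  qed
  also have "\<dots> \<le> norm (w - w')"
    by (rule norm_prod_le_factor[where g = "\<lambda>u'. w - u'"]) (use finite_slice_zeros[OF z] w diff in auto)
  finally show ?thesis by (simp add: dist_norm)
qed

definition discr_ext :: "complex ^ 'n \<Rightarrow> complex" where "discr_ext z = (if z \<in> V then discr z else 0)"

lemma discr_ext_nonzero_iff: "discr_ext z \<noteq> 0 \<longleftrightarrow> z \<in> V"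
  using discr_nonzero by (simp add: discr_ext_def)

text \<open>At a point with fewer zeros than the maximum, two of the zeros of every nearby generic slice
  are close to the same zero, by the pigeonhole principle, and their difference is a factor of
  the discriminant.\<close>

lemma continuous_discr_ext: "continuous_on (ball p \<delta>) discr_ext"
  unfolding continuous_on_eq_continuous_at[OF open_ball]
proof
  fix z0 assume z0: "z0 \<in> ball p \<delta>"
  show "continuous (at z0) discr_ext"
  proof (cases "z0 \<in> V")
    case True
    have "continuous_on V discr_ext"
      using holo_V(3) by (rule continuous_on_eq) (simp add: discr_ext_def)
    then show ?thesis using True by (simp add: continuous_on_eq_continuous_at open_V)
  next
    case False
    show ?thesis
      unfolding continuous_at_eps_delta
    proof (intro allI impI)
      fix \<eta> :: real assume \<eta>: "\<eta> > 0"
      obtain d where d: "d > 0" "\<And>z. z \<in> ball z0 d \<Longrightarrow> z \<in> ball p \<delta>"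
         "\<And>z w. z \<in> ball z0 d \<Longrightarrow> w \<in> slice_zeros z \<Longrightarrow> \<exists>w0\<in>slice_zeros z0. dist w0 w < \<eta> / 2"
        using zeros_near[OF z0, of "\<eta> / 2"] \<eta> by auto
      have "norm (discr_ext z) < \<eta>" if z: "z \<in> ball z0 d" for z
      proof (cases "z \<in> V")
        case True
        have "card (slice_zeros z0) < max_card" using card_le_max_card[OF z0] False z0 by (simp add: V_def)
        also have "max_card = card (slice_zeros z)" using True by (simp add: V_def)
        finally have less: "card (slice_zeros z0) < card (slice_zeros z)" .
        obtain q where q: "\<And>w. w \<in> slice_zeros z \<Longrightarrow> q w \<in> slice_zeros z0 \<and> dist (q w) w < \<eta> / 2"
          using d(3)[OF z] by metis
        have "card (q ` slice_zeros z) \<le> card (slice_zeros z0)"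
          by (rule card_mono[OF finite_slice_zeros[OF z0]]) (use q in blast)
        then have "\<not> inj_on q (slice_zeros z)" using pigeonhole[of q "slice_zeros z"] less by linarith
        then obtain w w' where w: "w \<in> slice_zeros z" "w' \<in> slice_zeros z" "w \<noteq> w'" "q w = q w'"
          unfolding inj_on_def by blast
        have "norm (discr z) \<le> dist w w'" by (rule norm_discr_le_dist[OF d(2)[OF z] w(1-3)])
        also have "\<dots> \<le> dist (q w) w + dist (q w) w'" using dist_triangle3 by blast
        also have "\<dots> < \<eta>" using q[OF w(1)] q[OF w(2)] w(4) by simp
        finally show ?thesis using True by (simp add: discr_ext_def)
      qed (simp add: discr_ext_def \<eta>)
      then show "\<exists>d>0. \<forall>z. dist z z0 < d \<longrightarrow> dist (discr_ext z) (discr_ext z0) < \<eta>"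
        using d(1) False by (intro exI[of _ d]) (auto simp: discr_ext_def dist_commute)
    qed
  qed
qed

text \<open>Rado's theorem, on each complex line.\<close>

lemma holo_discr_ext: "holo_along_lines (ball p \<delta>) discr_ext"
  unfolding holo_along_lines_def
proof (intro ballI allI)
  fix z v :: "complex ^ 'n" assume z: "z \<in> ball p \<delta>"
  define T where "T = {t. z + t *s v \<in> ball p \<delta>}"
  have T: "open T" unfolding T_def by (intro open_line_preimage open_ball)
  define W where "W = {t. z + t *s v \<in> V}"
  have W: "open W" unfolding W_def by (intro open_line_preimage open_V)
  have "(\<lambda>t. discr (z + t *s v)) holomorphic_on W"
    by (rule holo_along_lines_imp_holomorphic_on[OF holo_V(4)]) (simp add: W_def)
  then have "(\<lambda>t. discr_ext (z + t *s v)) holomorphic_on W"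
    by (rule holomorphic_transform) (simp add: W_def discr_ext_def)
  then have "(\<lambda>t. discr_ext (z + t *s v)) holomorphic_on {t \<in> T. discr_ext (z + t *s v) \<noteq> 0}"
    by (rule holomorphic_on_subset) (auto simp: W_def discr_ext_nonzero_iff)
  moreover have "continuous_on T (\<lambda>t. discr_ext (z + t *s v))"
    by (rule continuous_on_compose2[OF continuous_discr_ext]) (auto simp: T_def intro!: continuous_intros)
  ultimately have "(\<lambda>t. discr_ext (z + t *s v)) holomorphic_on T"
    using Rado[OF T, of "\<lambda>t. discr_ext (z + t *s v)"] by blast
  moreover have "0 \<in> T" using z by (simp add: T_def)
  ultimately show "(\<lambda>t. discr_ext (z + t *s v)) field_differentiable (at 0)"
    using T holomorphic_on_imp_differentiable_at by blast
qed

text \<open>The discriminant is not identically zero on the line from \<open>p\<close> to a generic point, so its zeros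
  on this line are isolated and small circles around \<open>p\<close> in the line consist of generic points.\<close>

lemma good_circle:
  "\<exists>e \<epsilon>. \<epsilon> > 0 \<and> (\<forall>t\<in>cball 0 \<epsilon>. p + t *s e \<in> ball p \<delta>) \<and> (\<forall>t\<in>sphere 0 \<epsilon>. p + t *s e \<in> V)"
proof -
  obtain z1 where z1: "z1 \<in> V" using V_nonempty by blast
  define e where "e = z1 - p"
  define T where "T = {t. p + t *s e \<in> ball p \<delta>}"
  define \<phi> where "\<phi> t = discr_ext (p + t *s e)" for t
  have T: "open T" unfolding T_def by (intro open_line_preimage open_ball)
  have cT: "connected T" unfolding T_def by (intro convex_connected convex_line_in_ball)
  have T01: "0 \<in> T" "1 \<in> T" using z1 V_subset \<delta> by (auto simp: T_def e_def)
  have \<phi>1: "\<phi> 1 \<noteq> 0" using z1 by (simp add: \<phi>_def e_def discr_ext_nonzero_iff)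
  have \<phi>h: "\<phi> holomorphic_on T"
    unfolding \<phi>_def[abs_def] by (rule holo_along_lines_imp_holomorphic_on[OF holo_discr_ext]) (simp add: T_def)
  have "\<exists>R>0. ball 0 R \<subseteq> T \<and> (\<forall>t\<in>ball 0 R - {0}. \<phi> t \<noteq> 0)"
  proof (cases "\<phi> 0 = 0")
    case True
    show ?thesis
    proof (rule isolated_zeros[OF \<phi>h T cT T01(1) True T01(2) \<phi>1])
      fix R :: real assume R: "0 < R" "ball 0 R \<subseteq> T" and nz: "\<And>z. z \<in> ball 0 R - {0} \<Longrightarrow> \<phi> z \<noteq> 0"
      show ?thesis by (intro exI[of _ R] conjI ballI R nz)
    qed
  next
    case False
    have "open (T \<inter> \<phi> -` (- {0}))"
      by (rule continuous_open_preimage[OF holomorphic_on_imp_continuous_on[OF \<phi>h] T]) auto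
    moreover have "0 \<in> T \<inter> \<phi> -` (- {0})" using T01 False by simp
    ultimately obtain R where "R > 0" "ball 0 R \<subseteq> T \<inter> \<phi> -` (- {0})" by (meson open_contains_ball)
    then show ?thesis by (intro exI[of _ R]) auto
  qed
  then obtain R where R: "R > 0" "ball 0 R \<subseteq> T" "\<And>t. t \<in> ball 0 R - {0} \<Longrightarrow> \<phi> t \<noteq> 0" by blast
  have "p + t *s e \<in> ball p \<delta>" if t: "t \<in> cball 0 (R / 2)" for t
  proof -
    have "t \<in> ball 0 R" using t R(1) by simp
    then show ?thesis using R(2) by (auto simp: T_def)
  qed
  moreover have "p + t *s e \<in> V" if t: "t \<in> sphere 0 (R / 2)" for t
  proof -
    have "t \<in> ball 0 R - {0}" using t R(1) by auto
    then show ?thesis using R(3) by (simp add: \<phi>_def discr_ext_nonzero_iff)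
  qed
  ultimately show ?thesis using R(1) by (intro exI[of _ e] exI[of _ "R / 2"]) auto
qed

lemma good_circles_nearby:
  "\<exists>e \<epsilon> d. \<epsilon> > 0 \<and> d > 0 \<and> d \<le> \<delta> \<and> (\<forall>z\<in>ball p d. (\<forall>t\<in>cball 0 \<epsilon>. z + t *s e \<in> ball p \<delta>) \<and>
    (\<forall>t\<in>sphere 0 \<epsilon>. z + t *s e \<in> V))"
proof -
  obtain e \<epsilon> where e: "\<epsilon> > 0" "\<And>t. t \<in> cball 0 \<epsilon> \<Longrightarrow> p + t *s e \<in> ball p \<delta>"
    "\<And>t. t \<in> sphere 0 \<epsilon> \<Longrightarrow> p + t *s e \<in> V"
    using good_circle by blast
  obtain d1 where d1: "d1 > 0" "\<And>z t. z \<in> ball p d1 \<Longrightarrow> t \<in> cball 0 \<epsilon> \<Longrightarrow> z + t *s e \<in> ball p \<delta>"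
    using line_compact_nearby[OF compact_cball open_ball e(2)] by blast
  obtain d2 where d2: "d2 > 0" "\<And>z t. z \<in> ball p d2 \<Longrightarrow> t \<in> sphere 0 \<epsilon> \<Longrightarrow> z + t *s e \<in> V"
    using line_compact_nearby[OF compact_sphere open_V e(3)] by blast
  show ?thesis
    by (rule exI[of _ e], rule exI[of _ \<epsilon>], rule exI[of _ "min (min d1 d2) \<delta>"])
      (use e(1) d1 d2 \<delta> in auto)
qed

end

lemma circlepath_in_sphere: "\<epsilon> > 0 \<Longrightarrow> circlepath 0 \<epsilon> x \<in> sphere 0 \<epsilon>"
  by (simp add: circlepath norm_mult norm_exp_eq_Re)

text \<open>The average over a circle of translates depends holomorphically on the centre as soon as the
  function is holomorphic near the circle; nothing is required inside. It thus serves as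
  the analytic continuation across the exceptional points.\<close>

lemma circle_average_holo:
  fixes G :: "complex ^ 'n \<Rightarrow> complex"
  assumes V: "open V" and G: "continuous_on V G" "holo_along_lines V G"
    and \<epsilon>: "\<epsilon> > 0" and U: "open U" "\<And>z t. z \<in> U \<Longrightarrow> t \<in> sphere (0 :: complex) \<epsilon> \<Longrightarrow> z + t *s e \<in> V"
  defines "g \<equiv> (\<lambda>z. integral (cbox 0 1) (\<lambda>x. G (z + circlepath 0 \<epsilon> x *s e)))"
  shows "holomorphic_Cn U g"
proof (rule holomorphic_Cn_if_holo_along_lines[OF U(1)])
  have c: "circlepath 0 \<epsilon> x \<in> sphere 0 \<epsilon>" for x by (rule circlepath_in_sphere[OF \<epsilon>])
  have cc: "continuous_on S (circlepath 0 \<epsilon>)" for S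
    by (rule continuous_on_subset[of UNIV]) (auto simp: circlepath[abs_def] intro!: continuous_intros)
  have cc2: "continuous_on S (\<lambda>y. circlepath 0 \<epsilon> (snd y))" for S :: "('a::topological_space \<times> real) set"
    by (rule continuous_on_compose2[OF cc continuous_on_snd[OF continuous_on_id]]) auto
  show "continuous_on U g"
    unfolding g_def
    by (rule integral_continuous_on_param, unfold case_prod_beta, rule continuous_on_compose2[OF G(1)])
      (use U(2) c in \<open>auto intro!: continuous_intros cc2\<close>)
  show "holo_along_lines U g"
    unfolding holo_along_lines_def
  proof (intro ballI allI)
    fix z v :: "complex ^ 'n" assume z: "z \<in> U"
    have "open {t :: complex. z + t *s v \<in> U}" by (intro open_line_preimage U(1))
    moreover have "0 \<in> {t :: complex. z + t *s v \<in> U}" using z by simp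
    ultimately obtain \<tau> where \<tau>: "\<tau> > 0" "ball 0 \<tau> \<subseteq> {t :: complex. z + t *s v \<in> U}"
      by (meson open_contains_ball)
    have inV: "(z + circlepath 0 \<epsilon> x *s e) + t *s v \<in> V" if t: "t \<in> ball 0 \<tau>" for t :: complex and x
    proof -
      have "(z + t *s v) + circlepath 0 \<epsilon> x *s e \<in> V" using U(2)[OF _ c] t \<tau>(2) by blast
      then show ?thesis by (simp add: add_ac)
    qed
    have "(\<lambda>t. integral (cbox 0 1) (\<lambda>x. G ((z + circlepath 0 \<epsilon> x *s e) + t *s v))) holomorphic_on ball 0 \<tau>"
    proof (rule leibniz_rule_holomorphic[where fx = "\<lambda>t x. line_deriv G ((z + circlepath 0 \<epsilon> x *s e) + t *s v) v"])
      fix t :: complex assume t: "t \<in> ball 0 \<tau>"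
      show "((\<lambda>t. G ((z + circlepath 0 \<epsilon> x *s e) + t *s v)) has_field_derivative
          line_deriv G ((z + circlepath 0 \<epsilon> x *s e) + t *s v) v) (at t within ball 0 \<tau>)" for x
        by (rule has_field_derivative_at_within[OF has_line_deriv[OF G(2) inV[OF t]]])
      show "(\<lambda>x. G ((z + circlepath 0 \<epsilon> x *s e) + t *s v)) integrable_on cbox 0 1"
        by (rule integrable_continuous, rule continuous_on_compose2[OF G(1)])
          (use inV[OF t] in \<open>auto intro!: continuous_intros cc\<close>)
    next
      show "continuous_on (ball 0 \<tau> \<times> cbox 0 1) (\<lambda>(t, x). line_deriv G ((z + circlepath 0 \<epsilon> x *s e) + t *s v) v)"
        unfolding case_prod_beta
        by (rule continuous_on_compose2[OF continuous_on_line_deriv[OF V G]])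
          (use inV in \<open>auto intro!: continuous_intros cc2\<close>)
    qed (rule convex_ball)
    then have "(\<lambda>t. g (z + t *s v)) holomorphic_on ball 0 \<tau>"
      unfolding g_def by (simp add: add_ac)
    then show "(\<lambda>t. g (z + t *s v)) field_differentiable (at 0)"
      using \<tau>(1) by (intro holomorphic_on_imp_differentiable_at[of _ "ball 0 \<tau>"]) auto
  qed
qed

lemma mean_value_circlepath:
  assumes "h holomorphic_on cball 0 \<epsilon>" "\<epsilon> > 0"
  shows "((\<lambda>x. h (circlepath 0 \<epsilon> x)) has_integral h 0) (cbox 0 1)"
proof -
  have nz: "circlepath 0 \<epsilon> x \<noteq> 0" for x using assms(2) by (simp add: circlepath)
  have "((\<lambda>u. h u / (u - 0)) has_contour_integral 2 * of_real pi * \<i> * h 0) (circlepath 0 \<epsilon>)"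
    by (rule Cauchy_integral_circlepath_simple[OF assms(1)]) (use assms(2) in simp)
  then have "((\<lambda>x. h (circlepath 0 \<epsilon> x) / circlepath 0 \<epsilon> x * vector_derivative (circlepath 0 \<epsilon>) (at x within {0..1}))
      has_integral 2 * of_real pi * \<i> * h 0) {0..1}"
    by (simp add: has_contour_integral_def)
  then have "((\<lambda>x. 2 * of_real pi * \<i> * h (circlepath 0 \<epsilon> x)) has_integral 2 * of_real pi * \<i> * h 0) {0..1}"
  proof (rule has_integral_eq[rotated])
    fix x :: real assume "x \<in> {0..1}"
    then have "vector_derivative (circlepath 0 \<epsilon>) (at x within {0..1}) = 2 * of_real pi * \<i> * circlepath 0 \<epsilon> x"
      by (simp add: vector_derivative_circlepath01) (simp add: circlepath)
    then show "h (circlepath 0 \<epsilon> x) / circlepath 0 \<epsilon> x * vector_derivative (circlepath 0 \<epsilon>) (at x within {0..1}) =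
        2 * of_real pi * \<i> * h (circlepath 0 \<epsilon> x)"
      using nz[of x] by simp
  qed
  from has_integral_mult_right[OF this, of "inverse (2 * of_real pi * \<i>)"] show ?thesis
    by (simp add: field_simps)
qed

context zero_slices
begin

text \<open>The line meets the exceptional set in finitely many points inside the circle, and the product of the zeros is
  bounded, so these singularities are removable and the mean value property identifies the average
  with the value of the extension at the centre.\<close>

lemma average_eq_limit:
  assumes z: "\<And>t. t \<in> cball 0 \<epsilon> \<Longrightarrow> z + t *s e \<in> ball p \<delta>" and \<epsilon>: "\<epsilon> > 0"
    and sph: "\<And>t. t \<in> sphere 0 \<epsilon> \<Longrightarrow> z + t *s e \<in> V"
  shows "((\<lambda>t. G (z + t *s e)) \<longlongrightarrow> integral (cbox 0 1) (\<lambda>x. G (z + circlepath 0 \<epsilon> x *s e))) (at 0) \<and>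
    (\<forall>\<^sub>F t in at 0. z + t *s e \<in> V)"
proof -
  define T where "T = {t. z + t *s e \<in> ball p \<delta>}"
  have T: "open T" "connected T" "cball 0 \<epsilon> \<subseteq> T"
    using z open_line_preimage[OF open_ball, of z e p \<delta>] convex_connected[OF convex_line_in_ball, of z e p \<delta>]
    by (auto simp: T_def)
  define \<phi> where "\<phi> t = discr_ext (z + t *s e)" for t
  have \<phi>h: "\<phi> holomorphic_on T"
    unfolding \<phi>_def[abs_def] by (rule holo_along_lines_imp_holomorphic_on[OF holo_discr_ext]) (simp add: T_def)
  have e_sph: "of_real \<epsilon> \<in> sphere (0 :: complex) \<epsilon>" using \<epsilon> by simp
  have \<phi>\<epsilon>: "\<phi> (of_real \<epsilon>) \<noteq> 0" using sph[OF e_sph] by (simp add: \<phi>_def discr_ext_nonzero_iff)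
  define X where "X = {t \<in> cball 0 \<epsilon>. \<phi> t = 0}"
  have X: "finite X"
  proof (cases "\<phi> constant_on T")
    case True
    have "of_real \<epsilon> \<in> T" using T(3) e_sph by auto
    then have "X = {}" using True \<phi>\<epsilon> T(3) unfolding constant_on_def X_def by fastforce
    then show ?thesis by simp
  next
    case False
    then show ?thesis
      unfolding X_def by (rule holomorphic_compact_finite_zeros[OF \<phi>h T(1,2) compact_cball T(3)])
  qed
  have XV: "z + t *s e \<in> V" if "t \<in> cball 0 \<epsilon>" "t \<notin> X" for t
    using that by (simp add: X_def \<phi>_def discr_ext_nonzero_iff[symmetric])
  define S where "S = {t. z + t *s e \<in> V} \<union> ball 0 \<epsilon>"
  have S: "open S" unfolding S_def by (intro open_Un open_line_preimage open_V open_ball)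
  have SV: "z + t *s e \<in> V" if "t \<in> S - X" for t
    using that XV[of t] by (auto simp: S_def)
  have cS: "cball 0 \<epsilon> \<subseteq> S" using sph by (force simp: S_def)
  have X_ball: "X \<subseteq> ball 0 \<epsilon>"
    using sph by (force simp: X_def \<phi>_def discr_ext_nonzero_iff[symmetric])
  have "\<exists>g. g holomorphic_on S \<and> (\<forall>t\<in>S - X. g t = G (z + t *s e))"
  proof (rule removable_singularities[OF X])
    show "X \<subseteq> interior S" using X_ball S by (auto simp: interior_open S_def)
    show "(\<lambda>t. G (z + t *s e)) holomorphic_on S - X"
      by (rule holo_along_lines_imp_holomorphic_on[OF holo_V(2) SV])
    fix x assume "x \<in> X"
    then have "x \<in> T" using T(3) by (auto simp: X_def)
    then have "\<forall>\<^sub>F t in at x. t \<in> T" by (rule eventually_at_in_open'[OF T(1)])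
    then show "(\<lambda>t. G (z + t *s e)) \<in> O[at x](\<lambda>_. 1)"
      by (intro bigoI[of _ 1]) (auto elim!: eventually_mono simp: T_def intro!: norm_G_le)
  qed
  then obtain g where g: "g holomorphic_on S" "\<And>t. t \<in> S - X \<Longrightarrow> g t = G (z + t *s e)" by blast
  have "((\<lambda>x. g (circlepath 0 \<epsilon> x)) has_integral g 0) (cbox 0 1)"
    by (rule mean_value_circlepath[OF holomorphic_on_subset[OF g(1) cS] \<epsilon>])
  moreover have "g (circlepath 0 \<epsilon> x) = G (z + circlepath 0 \<epsilon> x *s e)" for x
  proof (rule g(2))
    have "circlepath 0 \<epsilon> x \<in> sphere 0 \<epsilon>" by (rule circlepath_in_sphere[OF \<epsilon>])
    then show "circlepath 0 \<epsilon> x \<in> S - X" using X_ball cS by auto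
  qed
  ultimately have avg: "integral (cbox 0 1) (\<lambda>x. G (z + circlepath 0 \<epsilon> x *s e)) = g 0"
    by (simp add: integral_unique)
  have 0: "0 \<in> S" using \<epsilon> by (simp add: S_def)
  have "open (S - (X - {0}))" using X S by (intro open_Diff finite_imp_closed) auto
  then have "\<forall>\<^sub>F t in at 0. t \<in> S - (X - {0}) - {0}" using 0 by (intro eventually_at_in_open) auto
  then have ev: "\<forall>\<^sub>F t in at 0. t \<in> S - X" by (rule eventually_mono) auto
  have "(g \<longlongrightarrow> g 0) (at 0)"
    using holomorphic_on_imp_continuous_on[OF g(1)] 0 S
    by (simp add: continuous_on_eq_continuous_at isCont_def)
  then have "((\<lambda>t. G (z + t *s e)) \<longlongrightarrow> g 0) (at 0)"
    by (rule Lim_transform_eventually) (use ev g(2) in \<open>auto elim!: eventually_mono\<close>)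
  then show ?thesis using avg ev SV by (auto elim!: eventually_mono)
qed

lemma eventually_on_line:
  assumes "d > 0" "\<And>z'. z' \<in> ball z d \<Longrightarrow> P z'"
  shows "\<forall>\<^sub>F t in at 0. P (z + t *s (e :: complex ^ 'n))"
proof -
  have "\<forall>\<^sub>F t in at 0. t \<in> {t :: complex. z + t *s e \<in> ball z d}"
    by (rule eventually_at_in_open'[OF open_line_preimage[OF open_ball]]) (use assms(1) in simp)
  then show ?thesis by (rule eventually_mono) (use assms(2) in blast)
qed

text \<open>If \<open>f z = 0\<close>, then nearby slices have a zero close to \<open>0\<close>, so the product of the zeros
  tends to \<open>0\<close>. Otherwise the zeros of nearby slices are bounded away from \<open>0\<close>, and so is their
  product.\<close>

theorem zero_set_locally_hypersurface:
  "\<exists>U g. open U \<and> p \<in> U \<and> U \<subseteq> ball p \<delta> \<and> holomorphic_Cn U g \<and> (\<forall>z\<in>U. g z = 0 \<longleftrightarrow> f z = 0)"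
proof -
  obtain e \<epsilon> d where *: "\<epsilon> > 0" "d > 0" "d \<le> \<delta>" "\<And>z t. z \<in> ball p d \<Longrightarrow> t \<in> cball 0 \<epsilon> \<Longrightarrow> z + t *s e \<in> ball p \<delta>"
    "\<And>z t. z \<in> ball p d \<Longrightarrow> t \<in> sphere 0 \<epsilon> \<Longrightarrow> z + t *s e \<in> V"
    using good_circles_nearby by blast
  define g where "g z = integral (cbox 0 1) (\<lambda>x. G (z + circlepath 0 \<epsilon> x *s e))" for z
  have "holomorphic_Cn (ball p d) g"
    unfolding g_def[abs_def] by (rule circle_average_holo[OF open_V holo_V(1,2) *(1) open_ball *(5)])
  moreover have "g z = 0 \<longleftrightarrow> f z = 0" if z: "z \<in> ball p d" for z
  proof -
    have zB: "z \<in> ball p \<delta>" using z *(3) by auto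
    have lim: "((\<lambda>t. G (z + t *s e)) \<longlongrightarrow> g z) (at 0)" and ev: "\<forall>\<^sub>F t in at 0. z + t *s e \<in> V"
      using average_eq_limit[OF *(4)[OF z] *(1) *(5)[OF z]] by (auto simp: g_def)
    note nlim = tendsto_norm[OF lim]
    show ?thesis
    proof
      assume f0: "f z = 0"
      have w0: "0 \<in> slice_zeros z" using f0 r(1) by (simp add: slice_zeros_def)
      have "norm (g z) \<le> 0"
      proof (rule field_le_epsilon)
        fix \<eta> :: real assume \<eta>: "\<eta> > 0"
        obtain d1 where d1: "d1 > 0" "\<And>z'. z' \<in> ball z d1 \<Longrightarrow> z' \<in> ball p \<delta> \<and> (\<exists>w\<in>slice_zeros z'. dist 0 w < \<eta>)"
          using zero_persists[OF zB w0 \<eta>] by blast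
        have "norm (G z') \<le> \<eta>" if z': "z' \<in> ball z d1" for z'
        proof -
          obtain w where "w \<in> slice_zeros z'" "dist 0 w < \<eta>" using d1(2)[OF z'] by blast
          then show ?thesis using norm_G_le_factor[of z' w] d1(2)[OF z'] by simp
        qed
        then have "\<forall>\<^sub>F t in at 0. norm (G (z + t *s e)) \<le> \<eta>" by (rule eventually_on_line[OF d1(1)])
        then have "norm (g z) \<le> \<eta>" by (intro tendsto_upperbound[OF nlim]) auto
        then show "norm (g z) \<le> 0 + \<eta>" by simp
      qed
      then show "g z = 0" by simp
    next
      assume g0: "g z = 0"
      show "f z = 0"
      proof (rule ccontr)
        assume f0: "f z \<noteq> 0"
        obtain \<eta> where \<eta>: "\<eta> > 0" "\<And>w. w \<in> slice_zeros z \<Longrightarrow> w \<noteq> 0 \<Longrightarrow> \<eta> \<le> dist 0 w"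
          using finite_set_avoid[OF finite_slice_zeros[OF zB]] by metis
        have w0: "\<eta> \<le> norm w" if "w \<in> slice_zeros z" for w
        proof -
          have "w \<noteq> 0" using that f0 by (auto simp: slice_zeros_def)
          then show ?thesis using \<eta>(2)[OF that] by simp
        qed
        obtain d1 where d1: "d1 > 0" "\<And>z'. z' \<in> ball z d1 \<Longrightarrow> z' \<in> ball p \<delta>"
          "\<And>z' w. z' \<in> ball z d1 \<Longrightarrow> w \<in> slice_zeros z' \<Longrightarrow> \<exists>w0\<in>slice_zeros z. dist w0 w < \<eta> / 2"
          using zeros_near[OF zB, of "\<eta> / 2"] \<eta>(1) by auto
        have far: "\<eta> / 2 \<le> norm w" if z': "z' \<in> ball z d1" and w: "w \<in> slice_zeros z'" for z' w
        proof -
          obtain w1 where w1: "w1 \<in> slice_zeros z" "dist w1 w < \<eta> / 2" using d1(3)[OF z' w] by blast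
          have "norm w1 \<le> norm w + dist w1 w" using norm_triangle_sub[of w1 w] by (simp add: dist_norm)
          then show ?thesis using w0[OF w1(1)] w1(2) by linarith
        qed
        have low: "(\<eta> / 2) ^ max_card \<le> norm (G z')" if z': "z' \<in> ball z d1 \<inter> V" for z'
        proof -
          have "(\<eta> / 2) ^ max_card = (\<Prod>w\<in>slice_zeros z'. \<eta> / 2)" using z' by (simp add: V_def)
          also have "\<dots> \<le> (\<Prod>w\<in>slice_zeros z'. norm w)" using far z' \<eta>(1) by (intro prod_mono) auto
          finally show ?thesis by (simp add: G_def prod_norm)
        qed
        have "\<forall>\<^sub>F t in at 0. z + t *s e \<in> ball z d1" by (rule eventually_on_line[OF d1(1)])
        then have "\<forall>\<^sub>F t in at 0. (\<eta> / 2) ^ max_card \<le> norm (G (z + t *s e))"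
          using ev by eventually_elim (use low in blast)
        then have "(\<eta> / 2) ^ max_card \<le> norm (g z)" by (intro tendsto_lowerbound[OF nlim]) auto
        moreover have "(\<eta> / 2) ^ max_card > 0" using \<eta>(1) by simp
        ultimately show False using g0 by simp
      qed
    qed
  qed
  ultimately show ?thesis using *(2,3) by (intro exI[of _ "ball p d"] exI[of _ g]) auto
qed

end

section \<open>The zero set\<close>
text \<open>The direction \<open>b\<close> points to a nearby point where \<open>f \<noteq> 0\<close>, at \<open>w = 1\<close>. The slices are considered
  on the disc of radius \<open>7\<close> around \<open>1\<close>, on which \<open>f\<close> is comparable to a holomorphic function. At
  its centre \<open>f\<close> is bounded below, so Jensen's bound controls the zeros in the disc of radius \<open>2\<close>
  around \<open>1\<close>, which contains all small \<open>w\<close>.\<close>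

theorem zero_set_hypersurface_at_limit_of_nonzeros:
  fixes f :: "complex ^ 'n \<Rightarrow> complex"
  assumes \<Omega>: "open \<Omega>" and contf: "continuous_on \<Omega> f" and cmp: "curve_comparable \<Omega> f"
    and p: "p \<in> \<Omega>" "f p = 0" and lim: "\<And>d. d > 0 \<Longrightarrow> \<exists>q\<in>ball p d. f q \<noteq> 0"
  shows "\<exists>U g. open U \<and> p \<in> U \<and> U \<subseteq> \<Omega> \<and> holomorphic_Cn U g \<and> (\<forall>z\<in>U. g z = 0 \<longleftrightarrow> f z = 0)"
proof -
  obtain d where d: "d > 0" "cball p d \<subseteq> \<Omega>" using \<Omega> p(1) by (meson open_contains_cball)
  \<comment> \<open>for \<open>w\<close> of norm at most \<open>8\<close> this keeps \<open>z + w *s b\<close> in \<open>cball p d\<close>, because \<open>1 / 2 + 8 / 20 < 1\<close>\<close>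
  obtain q where q: "q \<in> ball p (d / 20)" "f q \<noteq> 0" using lim[of "d / 20"] d(1) by auto
  define b where "b = q - p"
  have nb: "norm b < d / 20" using q(1) by (simp add: b_def dist_norm norm_minus_commute)
  have line: "z + w *s b \<in> cball p d" if z: "z \<in> ball p (d / 2)" and w: "norm w \<le> 8" for z w
  proof -
    have "norm (w *s b) \<le> 8 * (d / 20)"
      unfolding norm_vector_scalar_mult using w nb by (intro mult_mono) auto
    moreover have "dist p (z + w *s b) \<le> dist p z + norm (w *s b)"
      using dist_triangle[of p "z + w *s b" z] by (simp add: dist_norm)
    ultimately show ?thesis using z d(1) by simp
  qed
  have norm8: "norm w \<le> 8" if "w \<in> cball 1 7" for w :: complex
    using that norm_triangle_sub[of w 1] by (simp add: dist_norm norm_minus_commute)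
  obtain M where M: "\<And>t0 V \<gamma> \<gamma>'.
      holo_curve V \<gamma> \<gamma>' \<Longrightarrow> cball t0 7 \<subseteq> V \<Longrightarrow> \<gamma> ` cball t0 7 \<subseteq> \<Omega> \<Longrightarrow>
      (\<forall>t\<in>cball t0 7. norm (\<gamma>' t) \<le> norm b) \<Longrightarrow> holo_comparable M (ball t0 7) (\<lambda>t. f (\<gamma> t))"
    using cmp norm_ge_zero[of b] unfolding curve_comparable_def by (meson zero_less_numeral)
  have cmpz: "holo_comparable M (ball 1 7) (\<lambda>w. f (z + w *s b))" if z: "z \<in> ball p (d / 2)" for z
    by (rule M[OF holo_curve_line]) (use line[OF z norm8] d(2) in auto)
  have pB: "p \<in> ball p (d / 2)" using d(1) by simp
  have pq: "p + 1 *s b = q" by (simp add: b_def)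
  obtain r0 where r0: "r0 > 0" "\<And>w. w \<in> ball 0 r0 - {0} \<Longrightarrow> f (p + w *s b) \<noteq> 0"
    using holo_comparable_isolated_zero[OF cmpz[OF pB], of 0 1] p(2) q(2) pq by auto
  define r where "r = min r0 1 / 2"
  have r: "r > 0" "r \<le> 1 / 2" "r < r0" using r0(1) by (auto simp: r_def)
  define W where "W = \<Omega> \<inter> f -` (- {0})"
  have W: "open W" unfolding W_def by (rule continuous_open_preimage[OF contf \<Omega>]) auto
  have "p + w *s b \<in> W" if w: "w \<in> sphere 0 r" for w
  proof -
    have "w \<in> ball 0 r0 - {0}" using w r by auto
    moreover have "p + w *s b \<in> cball p d" using w r by (intro line[OF pB]) simp
    ultimately show ?thesis using r0(2) d(2) by (auto simp: W_def)
  qed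
  from line_compact_nearby[OF compact_sphere W this]
  obtain d1 where d1: "d1 > 0" "\<And>z w. z \<in> ball p d1 \<Longrightarrow> w \<in> sphere 0 r \<Longrightarrow> z + w *s b \<in> W" by blast
  obtain C where C: "\<And>x. x \<in> cball p d \<Longrightarrow> norm (f x) \<le> C"
    using norm_bounded_on_compact[OF compact_cball continuous_on_subset[OF contf d(2)]] by blast
  have fq: "norm (f q) > 0" using q(2) by simp
  have "open (\<Omega> \<inter> f -` ball (f q) (norm (f q) / 2))"
    by (rule continuous_open_preimage[OF contf \<Omega> open_ball])
  moreover have "q \<in> \<Omega>" using line[OF pB, of 1] pq d(2) by auto
  then have "q \<in> \<Omega> \<inter> f -` ball (f q) (norm (f q) / 2)" using fq by simp
  ultimately obtain d2 where d2: "d2 > 0" "ball q d2 \<subseteq> \<Omega> \<inter> f -` ball (f q) (norm (f q) / 2)"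
    by (meson open_contains_ball)
  have base: "norm (f q) / 2 \<le> norm (f (z + 1 *s b))" if z: "z \<in> ball p d2" for z
  proof -
    have "z + 1 *s b \<in> ball q d2" using z by (simp add: b_def dist_norm norm_minus_commute algebra_simps)
    then have "dist (f q) (f (z + 1 *s b)) < norm (f q) / 2" using d2(2) by auto
    then show ?thesis using norm_triangle_ineq2[of "f q" "f (z + 1 *s b)"] by (simp add: dist_norm)
  qed
  obtain N where N: "exp (2 * M) * C / (norm (f q) / 2) < 2 ^ N"
    using real_arch_pow[of 2 "exp (2 * M) * C / (norm (f q) / 2)"] by auto
  define \<delta> where "\<delta> = min (d / 2) (min d1 d2)"
  have \<delta>: "\<delta> > 0" "\<delta> \<le> d / 2" "\<delta> \<le> d1" "\<delta> \<le> d2" using d(1) d1(1) d2(1) by (auto simp: \<delta>_def)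
  have \<delta>B: "z \<in> ball p (d / 2)" "z \<in> ball p d1" "z \<in> ball p d2" if "z \<in> ball p \<delta>" for z
    using that \<delta> by auto
  have card: "finite {w \<in> ball 0 r. f (z + w *s b) = 0} \<and> card {w \<in> ball 0 r. f (z + w *s b) = 0} \<le> N"
    if z: "z \<in> ball p \<delta>" for z
  proof (rule finite_if_finite_subsets_card_bdd)
    fix A assume A: "A \<subseteq> {w \<in> ball 0 r. f (z + w *s b) = 0}" "finite A"
    have "2 ^ card A * norm (f (z + 1 *s b)) \<le> exp (2 * M) * C"
    proof (rule holo_comparable_card_zeros[OF cmpz[OF \<delta>B(1)[OF z]], of 2 C A])
      show "norm (f (z + w *s b)) \<le> C" if "w \<in> ball 1 7" for w
        using that by (intro C line[OF \<delta>B(1)[OF z]] norm8) simp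
      show "A \<subseteq> ball 1 2"
      proof
        fix w assume "w \<in> A"
        then have "norm w < r" using A(1) by auto
        then show "w \<in> ball 1 2" using r(2) norm_triangle_ineq4[of 1 w] by (simp add: dist_norm)
      qed
    qed (use A in auto)
    moreover have "2 ^ card A * (norm (f q) / 2) \<le> 2 ^ card A * norm (f (z + 1 *s b))"
      by (intro mult_left_mono base \<delta>B(3)[OF z]) simp
    ultimately have "2 ^ card A * (norm (f q) / 2) \<le> exp (2 * M) * C" by linarith
    then have "2 ^ card A \<le> exp (2 * M) * C / (norm (f q) / 2)"
      using pos_le_divide_eq[of "norm (f q) / 2"] fq by simp
    then have "(2 :: real) ^ card A < 2 ^ N" using N by linarith
    then show "card A \<le> N" by simp
  qed
  have "ball p \<delta> \<subseteq> cball p d" using \<delta>(2) d(1) by auto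
  then have ball\<Omega>: "ball p \<delta> \<subseteq> \<Omega>" using d(2) by (rule order_trans)
  interpret zero_slices \<Omega> f p b \<delta> r N
  proof
    show "z + w *s b \<in> \<Omega>" if "z \<in> ball p \<delta>" "w \<in> cball 0 r" for z w
    proof -
      have "z + w *s b \<in> cball p d" using that(2) r(2) by (intro line[OF \<delta>B(1)[OF that(1)]]) simp
      then show ?thesis using d(2) by blast
    qed
    show "f (z + w *s b) \<noteq> 0" if "z \<in> ball p \<delta>" "w \<in> sphere 0 r" for z w
      using d1(2)[OF \<delta>B(2)[OF that(1)] that(2)] by (simp add: W_def)
  qed (use contf cmp \<delta>(1) r(1,2) card in blast)+
  obtain U g where U: "open U" "p \<in> U" "U \<subseteq> ball p \<delta>" "holomorphic_Cn U g" "\<forall>z\<in>U. g z = 0 \<longleftrightarrow> f z = 0"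
    using zero_set_locally_hypersurface by blast
  then show ?thesis using ball\<Omega> by (intro exI[of _ U] exI[of _ g]) auto
qed

theorem propositionA:
  fixes \<Omega> :: "(complex ^ 'n) set" and f :: "complex ^ 'n \<Rightarrow> complex" and K :: real
  assumes "open \<Omega>"
    and "continuous_on \<Omega> f"
    and "K > 0"
    and "dbar_le (\<Omega> - f -` {0}) f K"
  shows "analytic_subset \<Omega> (\<Omega> \<inter> f -` {0})"
  unfolding analytic_subset_def
proof (intro conjI ballI)
  show "closedin (top_of_set \<Omega>) (\<Omega> \<inter> f -` {0})"
    using assms(2) by (rule continuous_closedin_preimage) simp
  have cmp: "curve_comparable \<Omega> f"
    using assms by (intro dbar_le_imp_curve_comparable) auto
  fix p assume p: "p \<in> \<Omega>"
  show "\<exists>U F. open U \<and> p \<in> U \<and> U \<subseteq> \<Omega> \<and> finite F \<and> (\<forall>g\<in>F. holomorphic_Cn U g) \<and>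
      \<Omega> \<inter> f -` {0} \<inter> U = {z \<in> U. \<forall>g\<in>F. g z = 0}"
  proof (cases "f p = 0")
    case False
    have "open (\<Omega> \<inter> f -` (- {0}))"
      by (rule continuous_open_preimage[OF assms(2,1)]) auto
    moreover have "holomorphic_Cn U (\<lambda>_. 1)" for U :: "(complex ^ 'n) set"
      unfolding holomorphic_Cn_def by (auto intro!: exI[of _ "\<lambda>_. 0"])
    ultimately show ?thesis
      using p False by (intro exI[of _ "\<Omega> \<inter> f -` (- {0})"] exI[of _ "{\<lambda>_. 1}"]) auto
  next
    case True
    show ?thesis
    proof (cases "\<exists>d>0. \<forall>q\<in>ball p d. f q = 0")
      case True
      then obtain d where d: "d > 0" "\<And>q. q \<in> ball p d \<Longrightarrow> f q = 0" by blast
      then show ?thesis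
        using p assms(1) by (intro exI[of _ "\<Omega> \<inter> ball p d"] exI[of _ "{}"]) auto
    next
      case nonzeros: False
      have "\<exists>U g. open U \<and> p \<in> U \<and> U \<subseteq> \<Omega> \<and> holomorphic_Cn U g \<and> (\<forall>z\<in>U. g z = 0 \<longleftrightarrow> f z = 0)"
        by (rule zero_set_hypersurface_at_limit_of_nonzeros[OF assms(1,2) cmp p True]) (use nonzeros in blast)
      then obtain U g where "open U" "p \<in> U" "U \<subseteq> \<Omega>" "holomorphic_Cn U g" "\<And>z. z \<in> U \<Longrightarrow> g z = 0 \<longleftrightarrow> f z = 0"
        by blast
      then show ?thesis by (intro exI[of _ U] exI[of _ "{g}"]) auto
    qed
  qed
qed

end
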